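(* Every finite simple graph $G$ with maximum degree $\Delta(G)\ge 7.4\times 10^9$ satisfies $\chi(G)\le \max\{\Delta(G)-1,\omega(G)\}$.
   Context: $\chi(G)$ is the chromatic number of $G$ and $\omega(G)$ is the size of a largest clique of $G$. *)

theory Defs
  imports Complex_Main "HOL-Library.Ramsey"
begin

locale finite_simple_graph =
  fixes V :: "'a set" and E :: "'a set set"
  assumes finite_verts: "finite V"
    and edges: "E \<subseteq> [V]\<^bsup>2\<^esup>"

definition neighbourhood :: "'a set set \<Rightarrow> 'a \<Rightarrow> 'a set" where
  "neighbourhood E v = {w. {v, w} \<in> E}"

definition vertex_degree :: "'a set set \<Rightarrow> 'a \<Rightarrow> nat" where
  "vertex_degree E v = card (neighbourhood E v)"

text \<open>Inserting 0 only matters for the graph without vertices, whose maximum degree is 0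
  by convention (\<^term>\<open>Max {}\<close> is unspecified).\<close>

definition max_degree :: "'a set \<Rightarrow> 'a set set \<Rightarrow> nat" where
  "max_degree V E = Max (insert 0 (vertex_degree E ` V))"

definition clique_number :: "'a set \<Rightarrow> 'a set set \<Rightarrow> nat" where
  "clique_number V E = Max {card K | K. K \<subseteq> V \<and> clique K E}"

definition proper_colouring :: "'a set \<Rightarrow> 'a set set \<Rightarrow> nat \<Rightarrow> ('a \<Rightarrow> nat) \<Rightarrow> bool" where
  "proper_colouring V E k c \<longleftrightarrow>
     c ` V \<subseteq> {..<k} \<and> (\<forall>v\<in>V. \<forall>w\<in>V. {v, w} \<in> E \<longrightarrow> c v \<noteq> c w)"

definition chromatic_number :: "'a set \<Rightarrow> 'a set set \<Rightarrow> nat" where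
  "chromatic_number V E = (LEAST k. \<exists>c. proper_colouring V E k c)"

end

theory Submission
  imports Defs
begin

text \<open>Let \<open>D\<close> be the maximum degree. The main case is that there is no clique on \<open>D\<close> vertices, where \<open>D - 1\<close> colours
  must suffice; consider a minimal counterexample. A vertex whose neighbourhood spans less than \<open>D\<^sup>2 / 100\<close> ordered
  nonadjacent pairs lies in a clique with at least \<open>0.93 D\<close> vertices; fix a disjoint family of such
  cliques with largest possible union. A vertex can be coloured greedily at the end of the process once two (or one, if
  its degree is \<open>D - 1\<close>) of its coloured neighbours repeat colours of other neighbours. Minimality, also applied to
  graphs with an added edge, shows that all but at most one of the outside neighbours of a vertex in a clique \<open>C\<close> of
  the family have few neighbours in \<open>C\<close>, so \<open>C\<close> has linearly many disjoint blocks, each consisting of a vertex of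
  \<open>C\<close> and one or two such outside neighbours.

  Three random partial colourings with disjoint palettes produce the repetitions by the local lemma: the first
  repeats three colours around every sparse vertex, the other two colour the first and the second outside neighbours of
  some blocks with colours that also occur in the clique, and leave the clique vertices of these blocks uncoloured. A colour
  class is generated as a random set of density \<open>1 / (2 D)\<close>, and the failure probabilities are bounded by the decay of
  \<open>2 ^ - g\<close>, where \<open>g\<close> counts the repetitions. Then everything is completed greedily: first the vertices outside
  the cliques, then the cliques except for two saved vertices each, and finally these.

  If there is a clique on \<open>D\<close> but none on \<open>D + 1\<close> vertices, then \<open>D\<close> colours suffice by Brooks' theorem, which is
  derived from the main case; if there is a clique on \<open>D + 1\<close> vertices, then greedy colouring is enough.\<close>

section \<open>Random subsets and the local lemma\<close>

text \<open>The cliques dictate the shape of the argument. Colouring at random a neighbourhood with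
  many nonadjacent pairs produces repetitions by itself. At a vertex of a clique of the family,
  however, each repetition is obtained from one of its few outside neighbours together with a
  nonneighbour of that neighbour inside the clique. An outside vertex that sees most of the clique
  leaves too few partners; hence the structural half. Two repetitions at one clique vertex need two
  outside neighbours, and this vertex must stay uncoloured throughout, the second neighbour until
  its own round; hence the reserved vertices.

  With density \<open>1 / (2 * D)\<close>, a supply of order D^2 pairs lets each colour class
  succeed with probability bounded below, while order D vertices avoid the class with bounded
  probability. Linearly many classes make failure exponentially small in D. The bound
  \<open>exp (- real D / 40000000)\<close> beats the D^6 dependencies of the local lemma above the
  threshold; the second round at the cliques, starting from only \<open>D div 25000\<close> blocks
  per clique, leaves the least room.\<close>

definition subset_weight :: "real \<Rightarrow> 'b set \<Rightarrow> 'b set \<Rightarrow> real" where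
  "subset_weight q I A = q ^ card A * (1 - q) ^ card (I - A)"

definition ev :: "real \<Rightarrow> 'b set \<Rightarrow> ('b set \<Rightarrow> real) \<Rightarrow> real" where
  "ev q I g = (\<Sum>A\<in>Pow I. subset_weight q I A * g A)"

definition pr :: "real \<Rightarrow> 'b set \<Rightarrow> ('b set \<Rightarrow> bool) \<Rightarrow> real" where
  "pr q I P = ev q I (\<lambda>A. of_bool (P A))"

lemma ev_empty [simp]: "ev q {} g = g {}"
  by (simp add: ev_def subset_weight_def)

lemma ev_insert:
  assumes "finite I" "x \<notin> I"
  shows "ev q (insert x I) g = q * ev q I (\<lambda>A. g (insert x A)) + (1 - q) * ev q I g"
proof -
  have "ev q (insert x I) g = (\<Sum>A\<in>Pow I. subset_weight q (insert x I) A * g A)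
      + (\<Sum>A\<in>insert x ` Pow I. subset_weight q (insert x I) A * g A)"
    unfolding ev_def Pow_insert by (rule sum.union_disjoint) (use assms in auto)
  also have "(\<Sum>A\<in>insert x ` Pow I. subset_weight q (insert x I) A * g A)
      = (\<Sum>A\<in>Pow I. subset_weight q (insert x I) (insert x A) * g (insert x A))"
    by (subst sum.reindex) (use assms in \<open>auto simp: inj_on_def\<close>)
  also have "\<dots> = (\<Sum>A\<in>Pow I. q * (subset_weight q I A * g (insert x A)))"
  proof (rule sum.cong[OF refl])
    fix A assume "A \<in> Pow I"
    moreover from this have "finite A" "x \<notin> A" using assms finite_subset by auto
    moreover have "insert x I - insert x A = I - A" using assms by auto
    ultimately show "subset_weight q (insert x I) (insert x A) * g (insert x A) = q * (subset_weight q I A * g (insert x A))"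
      by (simp add: subset_weight_def)
  qed
  also have "(\<Sum>A\<in>Pow I. subset_weight q (insert x I) A * g A) = (\<Sum>A\<in>Pow I. (1 - q) * (subset_weight q I A * g A))"
  proof (rule sum.cong[OF refl])
    fix A assume "A \<in> Pow I"
    then have "x \<notin> A" using assms by auto
    then have "insert x I - A = insert x (I - A)" by auto
    then show "subset_weight q (insert x I) A * g A = (1 - q) * (subset_weight q I A * g A)"
      using assms by (simp add: subset_weight_def)
  qed
  finally show ?thesis by (simp add: ev_def sum_distrib_left)
qed

lemma ev_cong: "(\<And>A. A \<subseteq> I \<Longrightarrow> g A = h A) \<Longrightarrow> ev q I g = ev q I h"
  unfolding ev_def by (rule sum.cong) auto

lemma ev_union:
  assumes "finite I" "finite J" "I \<inter> J = {}"
  shows "ev q (I \<union> J) g = ev q I (\<lambda>A. ev q J (\<lambda>B. g (A \<union> B)))"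
  using assms(1,3)
proof (induction I arbitrary: g rule: finite_induct)
  case (insert x I)
  have "ev q (insert x (I \<union> J)) g
      = q * ev q (I \<union> J) (\<lambda>A. g (insert x A)) + (1 - q) * ev q (I \<union> J) g"
    using insert assms by (intro ev_insert) auto
  with insert show ?case by (simp add: ev_insert)
qed simp

lemma ev_add: "ev q I (\<lambda>A. g A + h A) = ev q I g + ev q I h"
  by (simp add: ev_def sum.distrib distrib_left)

lemma ev_cmult: "ev q I (\<lambda>A. c * g A) = c * ev q I g"
  by (simp add: ev_def sum_distrib_left mult.left_commute)

lemma ev_diff: "ev q I (\<lambda>A. g A - h A) = ev q I g - ev q I h"
  by (simp add: ev_def sum_subtractf right_diff_distrib)

lemma ev_sum: "ev q I (\<lambda>A. \<Sum>s\<in>S. g s A) = (\<Sum>s\<in>S. ev q I (g s))"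
  unfolding ev_def by (simp add: sum_distrib_left) (rule sum.swap)

lemma ev_mono:
  assumes "0 \<le> q" "q \<le> 1" "\<And>A. A \<subseteq> I \<Longrightarrow> g A \<le> h A"
  shows "ev q I g \<le> ev q I h"
  unfolding ev_def using assms by (intro sum_mono mult_left_mono) (auto simp: subset_weight_def)

lemma ev_const [simp]: "finite I \<Longrightarrow> ev q I (\<lambda>A. c) = c"
  by (induction I rule: finite_induct) (auto simp: ev_insert algebra_simps)

text \<open>The generating function of a binomial variable: each element of
  \<open>I \<inter> U\<close> contributes the factor \<open>1 + q * (c - 1)\<close>. With
  \<open>c = 2\<close> it gives both the tail bounds and the expected growth of the
  potential.\<close>

lemma ev_power_card:
  assumes "finite I"
  shows "ev q I (\<lambda>A. c ^ card (A \<inter> U)) = (1 + q * (c - 1)) ^ card (I \<inter> U)"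
  using assms
proof (induction I rule: finite_induct)
  case (insert x I)
  have "ev q I (\<lambda>A. c ^ card (insert x A \<inter> U)) = ev q I (\<lambda>A. (if x \<in> U then c else 1) * c ^ card (A \<inter> U))"
  proof (rule ev_cong)
    fix A assume "A \<subseteq> I"
    then have "finite A" "x \<notin> A" using insert finite_subset by auto
    then show "c ^ card (insert x A \<inter> U) = (if x \<in> U then c else 1) * c ^ card (A \<inter> U)"
      by (simp add: Int_insert_left)
  qed
  also have "\<dots> = (if x \<in> U then c else 1) * (1 + q * (c - 1)) ^ card (I \<inter> U)"
    by (simp add: ev_cmult insert.IH)
  finally show ?case
    using insert by (simp add: ev_insert Int_insert_left algebra_simps)
qed simp

lemma pr_mono:
  assumes "0 \<le> q" "q \<le> 1" "\<And>A. A \<subseteq> I \<Longrightarrow> P A \<Longrightarrow> Q A"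
  shows "pr q I P \<le> pr q I Q"
  unfolding pr_def using assms by (intro ev_mono) auto

lemma pr_nonneg: "0 \<le> q \<Longrightarrow> q \<le> 1 \<Longrightarrow> 0 \<le> pr q I P"
  unfolding pr_def ev_def by (intro sum_nonneg) (auto simp: subset_weight_def)

text \<open>The two events live on complementary factors of the product measure, so the expectation
  of the product splits along \<open>ev_union\<close>.\<close>

lemma pr_indep:
  assumes "finite I" "\<And>A. A \<subseteq> I \<Longrightarrow> P A = P (A \<inter> J)" "\<And>A. A \<subseteq> I \<Longrightarrow> Q A = Q (A - J)"
  shows "pr q I (\<lambda>A. P A \<and> Q A) = pr q I P * pr q I Q"
proof -
  let ?J = "I \<inter> J" and ?K = "I - J"
  have split: "ev q I g = ev q ?J (\<lambda>A. ev q ?K (\<lambda>B. g (A \<union> B)))" for g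
    using ev_union[of ?J ?K q g] assms(1) by (simp add: Int_Diff_disjoint Int_Diff_Un)
  have P: "P (A \<union> B) = P A" and Q: "Q (A \<union> B) = Q B" if "A \<subseteq> ?J" "B \<subseteq> ?K" for A B
  proof -
    have "(A \<union> B) \<inter> J = A" "(A \<union> B) - J = B" "A \<union> B \<subseteq> I" using that by auto
    then show "P (A \<union> B) = P A" "Q (A \<union> B) = Q B"
      using assms(2)[of "A \<union> B"] assms(3)[of "A \<union> B"] by simp_all
  qed
  have "pr q I (\<lambda>A. P A \<and> Q A) = ev q ?J (\<lambda>A. ev q ?K (\<lambda>B. of_bool (P A) * of_bool (Q B)))"
    unfolding pr_def split by (intro ev_cong) (auto simp: P Q)
  moreover have "pr q I P = ev q ?J (\<lambda>A. ev q ?K (\<lambda>B. of_bool (P A)))"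
    unfolding pr_def split by (intro ev_cong) (auto simp: P)
  moreover have "pr q I Q = ev q ?J (\<lambda>A. ev q ?K (\<lambda>B. of_bool (Q B)))"
    unfolding pr_def split by (intro ev_cong) (auto simp: Q)
  ultimately show ?thesis
    using assms(1) by (simp add: ev_cmult mult.commute[of _ "ev q ?K _"])
qed

lemma pr_Int_eq:
  assumes "finite I" "Z \<subseteq> I" "T \<subseteq> Z"
  shows "pr q I (\<lambda>A. A \<inter> Z = T) = q ^ card T * (1 - q) ^ card (Z - T)"
proof -
  have fin: "finite Z" using assms finite_subset by auto
  have "pr q I (\<lambda>A. A \<inter> Z = T) = ev q Z (\<lambda>A. ev q (I - Z) (\<lambda>B. of_bool ((A \<union> B) \<inter> Z = T)))"
    unfolding pr_def using ev_union[of Z "I - Z"] assms fin by (simp add: Un_absorb1)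
  also have "\<dots> = ev q Z (\<lambda>A. ev q (I - Z) (\<lambda>B. of_bool (A = T)))"
  proof (intro ev_cong)
    fix A B assume "A \<subseteq> Z" "B \<subseteq> I - Z"
    then have "(A \<union> B) \<inter> Z = A" by auto
    then show "(of_bool ((A \<union> B) \<inter> Z = T) :: real) = of_bool (A = T)" by simp
  qed
  also have "\<dots> = ev q Z (\<lambda>A. of_bool (A = T))"
    using assms(1) by simp
  also have "\<dots> = (\<Sum>A\<in>Pow Z. if A = T then subset_weight q Z A else 0)"
    unfolding ev_def by (rule sum.cong) auto
  also have "\<dots> = subset_weight q Z T"
    using assms fin by (subst sum.delta) auto
  finally show ?thesis by (simp add: subset_weight_def)
qed

text \<open>The symmetric Lovasz local lemma; independence is expressed by disjointness of supports.\<close>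

lemma local_lemma:
  assumes fin: "finite I" "finite T" and q: "0 \<le> q" "q \<le> 1"
    and loc: "\<And>t A. t \<in> T \<Longrightarrow> A \<subseteq> I \<Longrightarrow> bad t A = bad t (A \<inter> supp t)"
    and p: "\<And>t. t \<in> T \<Longrightarrow> pr q I (bad t) \<le> p"
    and d: "\<And>t. t \<in> T \<Longrightarrow> card {s \<in> T. supp s \<inter> supp t \<noteq> {}} \<le> d" "1 \<le> d"
    and pd: "4 * p * real d \<le> 1" and p0: "0 \<le> p"
  shows "\<exists>A\<subseteq>I. \<forall>t\<in>T. \<not> bad t A"
proof -
  define good where "good S A \<longleftrightarrow> (\<forall>s\<in>S. \<not> bad s A)" for S A
  have p_le: "4 * p \<le> 1"
    using pd d(2) p0 mult_left_mono[of 1 "real d" "4 * p"] by simp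
  \<comment> \<open>The bound 2 p for the probability of \<open>bad t\<close> given
    \<open>good S\<close> is stated without division. Positivity is carried along to reach a nonzero
    probability at the end: each further event removes at most half of the measure, since 2 p \<le>
    1/2.\<close>
  have main: "\<forall>S\<subseteq>T. card S = n \<longrightarrow> 0 < pr q I (good S) \<and>
      (\<forall>t\<in>T. pr q I (\<lambda>A. bad t A \<and> good S A) \<le> 2 * p * pr q I (good S))" for n
  proof (induction n rule: less_induct)
    case (less n)
    show ?case
    proof (intro allI impI)
      fix S assume S: "S \<subseteq> T" "card S = n"
      have finS: "finite S" using S fin finite_subset by auto
      have IH: "0 < pr q I (good S')"
        "t \<in> T \<Longrightarrow> pr q I (\<lambda>A. bad t A \<and> good S' A) \<le> 2 * p * pr q I (good S')"
        if "S' \<subset> S" for S' t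
        using less.IH[of "card S'"] that S psubset_card_mono[OF finS that] by auto
      have pos: "0 < pr q I (good S)"
      proof (cases "S = {}")
        case True
        then show ?thesis using fin by (simp add: good_def pr_def)
      next
        case False
        then obtain s where s: "s \<in> S" by auto
        have eq: "pr q I (good S) = pr q I (good (S - {s})) - pr q I (\<lambda>A. bad s A \<and> good (S - {s}) A)"
          unfolding pr_def ev_diff[symmetric] using s by (intro ev_cong) (auto simp: good_def)
        have "2 * p * pr q I (good (S - {s})) \<le> (1/2) * pr q I (good (S - {s}))"
          using p_le by (intro mult_right_mono pr_nonneg q) auto
        moreover have "S - {s} \<subset> S" "s \<in> T" using s S by auto
        ultimately show ?thesis using IH(1)[of "S - {s}"] IH(2)[of "S - {s}" s] eq by linarith
      qed
      moreover have "pr q I (\<lambda>A. bad t A \<and> good S A) \<le> 2 * p * pr q I (good S)" if t: "t \<in> T" for t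
      proof -
        define S1 where "S1 = {s \<in> S. supp s \<inter> supp t \<noteq> {}}"
        define S2 where "S2 = S - S1"
        have finS1: "finite S1" using finS by (simp add: S1_def)
        have indep: "pr q I (\<lambda>A. bad t A \<and> good S2 A) = pr q I (bad t) * pr q I (good S2)"
        proof (rule pr_indep[where J = "supp t"])
          fix A assume A: "A \<subseteq> I"
          show "bad t A = bad t (A \<inter> supp t)" using loc t A by auto
          have "bad s A = bad s (A - supp t)" if "s \<in> S2" for s
          proof -
            have "(A - supp t) \<inter> supp s = A \<inter> supp s" "s \<in> T" "A - supp t \<subseteq> I"
              using that S A by (auto simp: S1_def S2_def)
            then show ?thesis using loc[of s A] loc[of s "A - supp t"] A by simp
          qed
          then show "good S2 A = good S2 (A - supp t)" by (auto simp: good_def)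
        qed (use fin in auto)
        have "pr q I (\<lambda>A. bad t A \<and> good S A) \<le> pr q I (\<lambda>A. bad t A \<and> good S2 A)"
          by (intro pr_mono q) (auto simp: good_def S2_def)
        also have "\<dots> \<le> p * pr q I (good S2)"
          unfolding indep using p[OF t] by (intro mult_right_mono pr_nonneg q)
        \<comment> \<open>Adding the good events of the dependent set \<open>S1\<close> to the
          condition costs at most a factor 2: given \<open>good S2\<close>, each of its at most
          \<open>d\<close> events has probability at most 2 p, and 2 p d \<le> 1/2.\<close>
        also have "\<dots> \<le> 2 * p * pr q I (good S)"
        proof (cases "S1 = {}")
          case True
          then have "S2 = S" by (simp add: S2_def)
          then show ?thesis using p0 pr_nonneg[OF q, of I "good S"]
            by (simp add: mult.assoc mult_nonneg_nonneg)
        next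
          case False
          then have sub: "S2 \<subset> S" by (auto simp: S1_def S2_def)
          have "card S1 \<le> card {s \<in> T. supp s \<inter> supp t \<noteq> {}}"
            using S fin by (intro card_mono) (auto simp: S1_def)
          then have c: "real (card S1) \<le> real d" using d(1)[OF t] by linarith
          have "pr q I (good S2) - pr q I (good S)
              = ev q I (\<lambda>A. of_bool (good S2 A) - of_bool (good S A))"
            by (simp add: pr_def ev_diff)
          also have "\<dots> \<le> ev q I (\<lambda>A. \<Sum>s\<in>S1. of_bool (bad s A \<and> good S2 A))"
          proof (intro ev_mono q)
            fix A
            show "of_bool (good S2 A) - of_bool (good S A) \<le> (\<Sum>s\<in>S1. of_bool (bad s A \<and> good S2 A) :: real)"
            proof (cases "good S2 A \<and> \<not> good S A")
              case True
              then obtain s where s: "s \<in> S1" "bad s A" by (auto simp: good_def S2_def)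
              have "(1::real) = of_bool (bad s A \<and> good S2 A)" using s True by simp
              also have "\<dots> \<le> (\<Sum>s\<in>S1. of_bool (bad s A \<and> good S2 A))"
                using s finS1 by (intro member_le_sum) auto
              finally show ?thesis using True by simp
            next
              case False
              have "0 \<le> (\<Sum>s\<in>S1. of_bool (bad s A \<and> good S2 A) :: real)" by (intro sum_nonneg) auto
              then show ?thesis using False by (auto split: if_splits)
            qed
          qed
          also have "\<dots> = (\<Sum>s\<in>S1. pr q I (\<lambda>A. bad s A \<and> good S2 A))"
            by (simp add: ev_sum pr_def)
          also have "\<dots> \<le> (\<Sum>s\<in>S1. 2 * p * pr q I (good S2))"
            using S sub by (intro sum_mono IH) (auto simp: S1_def)
          also have "\<dots> = (2 * p * real (card S1)) * pr q I (good S2)" by simp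
          also have "\<dots> \<le> (1/2) * pr q I (good S2)"
          proof (intro mult_right_mono pr_nonneg q)
            show "2 * p * real (card S1) \<le> 1 / 2"
              using mult_left_mono[OF c, of "2 * p"] p0 pd by simp
          qed
          finally have "pr q I (good S2) \<le> 2 * pr q I (good S)" by simp
          then show ?thesis using mult_left_mono[of _ _ p] p0 by fastforce
        qed
        finally show ?thesis .
      qed
      ultimately show "0 < pr q I (good S) \<and>
        (\<forall>t\<in>T. pr q I (\<lambda>A. bad t A \<and> good S A) \<le> 2 * p * pr q I (good S))" by blast
    qed
  qed
  have "0 < pr q I (good T)" using main[of "card T"] by blast
  then have "\<exists>A\<subseteq>I. good T A"
  proof (rule contrapos_pp)
    assume "\<not> (\<exists>A\<subseteq>I. good T A)"
    then have "pr q I (good T) = ev q I (\<lambda>_. 0)"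
      unfolding pr_def by (intro ev_cong) auto
    then show "\<not> 0 < pr q I (good T)" using fin by simp
  qed
  then show ?thesis by (auto simp: good_def)
qed

section \<open>Random partial colourings\<close>

text \<open>A random set \<open>A \<subseteq> W \<times> {..<K}\<close> encodes a partial colouring: \<open>v\<close> gets the least colour \<open>a\<close> with
  \<open>(v, a) \<in> A\<close>, and keeps it if no neighbour \<open>w\<close> has \<open>(w, a) \<in> A\<close>. If \<open>y\<close> is \<open>saved\<close>, then it shares its colour
  with a partner in \<open>X\<close>. It is \<open>safe\<close> if moreover its reserved vertices \<open>R y\<close> are never
  selected. The pairs in \<open>avail\<close> can still become monochromatic in a later row when \<open>F\<close> is the set of vertices
  selected so far.\<close>

definition saved :: "('a \<Rightarrow> 'a \<Rightarrow> bool) \<Rightarrow> 'a set \<Rightarrow> nat \<Rightarrow> ('a \<times> nat) set \<Rightarrow> 'a \<Rightarrow> bool" where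
  "saved adj X k A y \<longleftrightarrow> (\<exists>a<k. \<exists>x\<in>X. (y, a) \<in> A \<and> (x, a) \<in> A \<and>
     (\<forall>w. adj w y \<or> adj w x \<longrightarrow> (w, a) \<notin> A) \<and> (\<forall>b<a. (y, b) \<notin> A \<and> (x, b) \<notin> A))"

definition safe :: "('a \<Rightarrow> 'a \<Rightarrow> bool) \<Rightarrow> 'a set \<Rightarrow> ('a \<Rightarrow> 'a set) \<Rightarrow> ('a \<Rightarrow> 'a set) \<Rightarrow> nat
    \<Rightarrow> ('a \<times> nat) set \<Rightarrow> 'a set" where
  "safe adj Y X R k A = {y \<in> Y. saved adj (X y) k A y \<and> R y \<inter> fst ` A = {}}"

definition avail :: "'a set \<Rightarrow> ('a \<Rightarrow> 'a set) \<Rightarrow> ('a \<Rightarrow> 'a set) \<Rightarrow> 'a set \<Rightarrow> 'a set set" where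
  "avail Y X R F = {{y, x} | y x. y \<in> Y \<and> x \<in> X y \<and> y \<notin> F \<and> x \<notin> F \<and> R y \<inter> F = {}}"

text \<open>\<open>Y\<close> contains the vertices that look for a partner, \<open>X y\<close> the
  admissible partners, and \<open>R y\<close> what has to stay uncoloured. \<open>Z\<close> covers
  all of them: prescribing a colour class on the whole of \<open>Z\<close> separates the successes
  of different pairs and protects every reserved vertex. \<open>n\<close> bounds the number of
  vertices that a success has to leave unselected.\<close>

locale demand =
  fixes adj :: "'a \<Rightarrow> 'a \<Rightarrow> bool" and W Y Z :: "'a set" and X R :: "'a \<Rightarrow> 'a set"
    and n :: nat
  assumes finW: "finite W" and ZW: "Z \<subseteq> W" and YZ: "Y \<subseteq> Z"
    and sym: "\<And>u v. adj u v \<Longrightarrow> adj v u" and irr: "\<And>u. \<not> adj u u"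
    and XZ: "\<And>y. y \<in> Y \<Longrightarrow> X y \<subseteq> Z" and RZ: "\<And>y. y \<in> Y \<Longrightarrow> R y \<subseteq> Z"
    and XY: "\<And>y x. y \<in> Y \<Longrightarrow> x \<in> X y \<Longrightarrow> x \<noteq> y \<and> \<not> adj x y"
    and YR: "\<And>y y'. y \<in> Y \<Longrightarrow> y' \<in> Y \<Longrightarrow> y \<notin> R y'"
    and XR: "\<And>y x y'. y \<in> Y \<Longrightarrow> x \<in> X y \<Longrightarrow> y' \<in> Y \<Longrightarrow> x \<notin> R y'"
    and RR: "\<And>y y'. y \<in> Y \<Longrightarrow> y' \<in> Y \<Longrightarrow> y \<noteq> y' \<Longrightarrow> R y \<inter> R y' = {}"
    and cardR: "\<And>y. y \<in> Y \<Longrightarrow> card (R y) \<le> 2"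
    and nbh: "\<And>y x. y \<in> Y \<Longrightarrow> x \<in> X y \<Longrightarrow> card (Z \<union> {w \<in> W. adj w y \<or> adj w x}) \<le> n"
begin

lemma finY: "finite Y" using YZ ZW finW finite_subset by metis

text \<open>The pointwise inequality behind the potential argument. Reserved sets are disjoint, so
  every safe vertex lost in the new row is charged to its own selected reserved vertex, at a factor
  2. On \<open>hit\<close>, the row meets \<open>Z\<close> in exactly one available pair; then
  nothing is lost and one vertex becomes safe, which gives the factor 1 - 1/2.\<close>

lemma safe_step:
  fixes k :: nat
  assumes A: "A \<subseteq> W \<times> {..<k}" and B: "B \<subseteq> W \<times> {k}"
  defines "RG \<equiv> \<Union> (R ` safe adj Y X R k A)"
    and "hit \<equiv> \<exists>s\<in>avail Y X R (fst ` A). B \<inter> ((Z \<union> {w \<in> W. \<exists>u\<in>s. adj w u}) \<times> {k}) = s \<times> {k}"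
  shows "(1/2::real) ^ card (safe adj Y X R (Suc k) (A \<union> B))
    \<le> (1/2) ^ card (safe adj Y X R k A) * (2 ^ card (B \<inter> (RG \<times> {k})) - of_bool hit / 2)"
proof -
  let ?S = "safe adj Y X R k A" and ?S' = "safe adj Y X R (Suc k) (A \<union> B)"
  have fin: "finite ?S" "finite ?S'" using finY by (auto simp: safe_def)
  have finB: "finite B" using B finW finite_subset by (metis finite.emptyI finite_SigmaI finite_insert)
  have memA: "(w, b) \<in> A \<union> B \<longleftrightarrow> (w, b) \<in> A" if "b < k" for w b using B that by auto
  have memB: "(w, k) \<in> A \<union> B \<longleftrightarrow> (w, k) \<in> B" for w using A by auto
  have keep: "y \<in> ?S'" if y: "y \<in> ?S" "R y \<inter> fst ` B = {}" for y
  proof -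
    from y obtain a x where a: "a < k" "x \<in> X y" "(y, a) \<in> A" "(x, a) \<in> A"
      "\<forall>w. adj w y \<or> adj w x \<longrightarrow> (w, a) \<notin> A" "\<forall>b<a. (y, b) \<notin> A \<and> (x, b) \<notin> A"
      unfolding safe_def saved_def by blast
    have "saved adj (X y) (Suc k) (A \<union> B) y"
      unfolding saved_def
    proof (intro exI[of _ a] bexI[of _ x] conjI allI impI)
      show "(w, a) \<notin> A \<union> B" if "adj w y \<or> adj w x" for w using a memA[of a w] that by blast
      show "(y, b) \<notin> A \<union> B" "(x, b) \<notin> A \<union> B" if "b < a" for b
        using a memA[of b] that by (auto dest: less_trans)
    qed (use a in auto)
    then show ?thesis using y by (auto simp: safe_def image_Un)
  qed
  have lose: "card ?S \<le> card ?S' + card (B \<inter> (RG \<times> {k}))"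
  proof -
    have "\<forall>y\<in>?S - ?S'. \<exists>r. r \<in> R y \<and> (r, k) \<in> B"
    proof
      fix y assume "y \<in> ?S - ?S'"
      then have "R y \<inter> fst ` B \<noteq> {}" using keep by blast
      then show "\<exists>r. r \<in> R y \<and> (r, k) \<in> B" using B by force
    qed
    then obtain f where f: "\<And>y. y \<in> ?S - ?S' \<Longrightarrow> f y \<in> R y \<and> (f y, k) \<in> B" by metis
    have "inj_on (\<lambda>y. (f y, k)) (?S - ?S')"
    proof (rule inj_onI, rule ccontr)
      fix y y' assume h: "y \<in> ?S - ?S'" "y' \<in> ?S - ?S'" "(f y, k) = (f y', k)" "y \<noteq> y'"
      then have "f y \<in> R y \<inter> R y'" using f by fastforce
      then show False using RR[of y y'] h by (auto simp: safe_def)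
    qed
    moreover have "(\<lambda>y. (f y, k)) ` (?S - ?S') \<subseteq> B \<inter> (RG \<times> {k})"
      using f by (auto simp: RG_def)
    ultimately have "card (?S - ?S') \<le> card (B \<inter> (RG \<times> {k}))"
      using finB by (intro card_inj_on_le) auto
    moreover have "card ?S \<le> card (?S \<inter> ?S') + card (?S - ?S')"
      using fin by (metis card_Un_le Int_Diff_Un)
    moreover have "card (?S \<inter> ?S') \<le> card ?S'" using fin by (intro card_mono) auto
    ultimately show ?thesis by linarith
  qed
  show ?thesis
  proof (cases hit)
    case False
    have "(1/2::real) ^ (card ?S' + card (B \<inter> (RG \<times> {k}))) \<le> (1/2) ^ card ?S"
      by (rule power_decreasing[OF lose]) auto
    then have "(1/2::real) ^ card ?S' * (1/2) ^ card (B \<inter> (RG \<times> {k})) * 2 ^ card (B \<inter> (RG \<times> {k}))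
        \<le> (1/2) ^ card ?S * 2 ^ card (B \<inter> (RG \<times> {k}))"
      by (intro mult_right_mono) (auto simp: power_add)
    moreover have "(1/2::real) ^ card (B \<inter> (RG \<times> {k})) * 2 ^ card (B \<inter> (RG \<times> {k})) = 1"
      by (simp add: power_mult_distrib[symmetric])
    ultimately show ?thesis using False by (simp add: mult.assoc)
  next
    case True
    then obtain y x where yx: "y \<in> Y" "x \<in> X y" "y \<notin> fst ` A" "x \<notin> fst ` A" "R y \<inter> fst ` A = {}"
      "B \<inter> ((Z \<union> {w \<in> W. \<exists>u\<in>{y,x}. adj w u}) \<times> {k}) = {y, x} \<times> {k}"
      unfolding hit_def avail_def by blast
    have inB: "(y, k) \<in> B" "(x, k) \<in> B" using yx(6) by auto
    have onlyB: "w = y \<or> w = x" if "(w, k) \<in> B" "w \<in> Z \<or> adj w y \<or> adj w x" for w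
    proof -
      have "w \<in> W" using that B by auto
      then have "(w, k) \<in> B \<inter> ((Z \<union> {w \<in> W. \<exists>u\<in>{y,x}. adj w u}) \<times> {k})" using that by auto
      then show ?thesis unfolding yx(6) by auto
    qed
    have "saved adj (X y) (Suc k) (A \<union> B) y"
      unfolding saved_def
    proof (intro exI[of _ k] bexI[of _ x] conjI allI impI)
      show "(w, k) \<notin> A \<union> B" if "adj w y \<or> adj w x" for w
      proof
        assume "(w, k) \<in> A \<union> B"
        then have "w = y \<or> w = x" using memB onlyB that by blast
        then show False using that irr[of x] irr[of y] XY[OF yx(1,2)] sym[of y x] by auto
      qed
      show "(y, b) \<notin> A \<union> B" "(x, b) \<notin> A \<union> B" if "b < k" for b
        using memA[OF that] yx(3,4) by (metis fst_conv image_eqI)+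
    qed (use inB yx in auto)
    moreover have "R y \<inter> fst ` B = {}"
    proof (rule ccontr)
      assume "R y \<inter> fst ` B \<noteq> {}"
      then obtain r where r: "r \<in> R y" "(r, k) \<in> B" using B by force
      then have "r = y \<or> r = x" using onlyB[of r] RZ[OF yx(1)] by auto
      then show False using r YR XR yx by blast
    qed
    ultimately have new: "y \<in> ?S'"
      unfolding safe_def using yx(1,5) by (simp add: image_Un Int_Un_distrib)
    have "y \<notin> ?S"
    proof
      assume "y \<in> ?S"
      then obtain a where "(y, a) \<in> A" unfolding safe_def saved_def by blast
      then show False using yx(3) by force
    qed
    have RG: "B \<inter> (RG \<times> {k}) = {}"
    proof (rule ccontr)
      assume "B \<inter> (RG \<times> {k}) \<noteq> {}"
      then obtain r y' where r: "r \<in> R y'" "y' \<in> Y" "(r, k) \<in> B" by (auto simp: RG_def safe_def)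
      then have "r = y \<or> r = x" using onlyB[of r] RZ[OF r(2)] by auto
      then show False using r YR XR yx by blast
    qed
    have "?S \<subseteq> ?S'"
    proof
      fix y' assume y': "y' \<in> ?S"
      have "(r, k) \<notin> B" if "r \<in> R y'" for r using RG y' that unfolding RG_def by blast
      then have "R y' \<inter> fst ` B = {}" using B by force
      then show "y' \<in> ?S'" using keep y' by blast
    qed
    then have "card (insert y ?S) \<le> card ?S'" using new fin by (intro card_mono) auto
    then have "Suc (card ?S) \<le> card ?S'" using \<open>y \<notin> ?S\<close> fin by simp
    then have "(1/2::real) ^ card ?S' \<le> (1/2) ^ Suc (card ?S)" by (rule power_decreasing) auto
    then show ?thesis using True RG by simp
  qed
qed

text \<open>The events for distinct pairs exclude each other, because the row restricted to
  \<open>Z\<close> determines the pair. Hence their probabilities add up, and each is at least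
  \<open>q\<^sup>2 * (1 - q) ^ n\<close>.\<close>

lemma pr_hit:
  fixes k :: nat
  assumes q: "0 \<le> q" "q \<le> 1" and N: "real N \<le> real (card (avail Y X R F))"
  shows "real N * q\<^sup>2 * (1 - q) ^ n \<le> pr q (W \<times> {k}) (\<lambda>B. \<exists>s\<in>avail Y X R F.
     B \<inter> ((Z \<union> {w \<in> W. \<exists>u\<in>s. adj w u}) \<times> {k}) = s \<times> {k})"
proof -
  let ?Z = "\<lambda>s. (Z \<union> {w \<in> W. \<exists>u\<in>s. adj w u}) \<times> {k}" and ?av = "avail Y X R F"
  have sZ: "s \<subseteq> Z" if "s \<in> ?av" for s using that YZ XZ by (auto simp: avail_def)
  have finav: "finite ?av"
    by (rule finite_subset[of _ "Pow Z"]) (use sZ ZW finW finite_subset in auto)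
  have finI: "finite (W \<times> {k})" using finW by simp
  have each: "q\<^sup>2 * (1 - q) ^ n \<le> pr q (W \<times> {k}) (\<lambda>B. B \<inter> ?Z s = s \<times> {k})" if s: "s \<in> ?av" for s
  proof -
    obtain y x where yx: "s = {y, x}" "y \<in> Y" "x \<in> X y" using s by (auto simp: avail_def)
    have "card s = 2" using XY[OF yx(2,3)] yx(1) by auto
    have "?Z s - s \<times> {k} \<subseteq> (Z \<union> {w \<in> W. adj w y \<or> adj w x}) \<times> {k}" using yx by auto
    moreover have fz: "finite (Z \<union> {w \<in> W. adj w y \<or> adj w x})" using finW ZW finite_subset by auto
    ultimately have "card (?Z s - s \<times> {k}) \<le> card ((Z \<union> {w \<in> W. adj w y \<or> adj w x}) \<times> {k})"
      by (intro card_mono) auto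
    also have "\<dots> \<le> n" using nbh[OF yx(2,3)] by (simp add: card_cartesian_product)
    finally have c: "card (?Z s - s \<times> {k}) \<le> n" .
    have "pr q (W \<times> {k}) (\<lambda>B. B \<inter> ?Z s = s \<times> {k}) = q ^ card (s \<times> {k}) * (1 - q) ^ card (?Z s - s \<times> {k})"
      using sZ[OF s] ZW by (intro pr_Int_eq finI) auto
    also have "card (s \<times> {k}) = 2" using \<open>card s = 2\<close> by (simp add: card_cartesian_product)
    finally show ?thesis
      using power_decreasing[OF c, of "1 - q"] q by (simp add: mult_left_mono)
  qed
  have "real N * q\<^sup>2 * (1 - q) ^ n \<le> real (card ?av) * (q\<^sup>2 * (1 - q) ^ n)"
    using N q by (simp add: mult.assoc mult_right_mono)
  also have "\<dots> \<le> (\<Sum>s\<in>?av. pr q (W \<times> {k}) (\<lambda>B. B \<inter> ?Z s = s \<times> {k}))"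
    using sum_mono[of ?av "\<lambda>s. q\<^sup>2 * (1 - q) ^ n", OF each] by simp
  also have "\<dots> = ev q (W \<times> {k}) (\<lambda>B. \<Sum>s\<in>?av. of_bool (B \<inter> ?Z s = s \<times> {k}))"
    by (simp add: pr_def ev_sum)
  also have "\<dots> \<le> pr q (W \<times> {k}) (\<lambda>B. \<exists>s\<in>?av. B \<inter> ?Z s = s \<times> {k})"
    unfolding pr_def
  proof (intro ev_mono q)
    fix B
    show "(\<Sum>s\<in>?av. of_bool (B \<inter> ?Z s = s \<times> {k})) \<le> (of_bool (\<exists>s\<in>?av. B \<inter> ?Z s = s \<times> {k}) :: real)"
    proof (cases "\<exists>s\<in>?av. B \<inter> ?Z s = s \<times> {k}")
      case True
      then obtain s where s: "s \<in> ?av" "B \<inter> ?Z s = s \<times> {k}" by blast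
      have uniq: "s' = s" if "s' \<in> ?av" "B \<inter> ?Z s' = s' \<times> {k}" for s'
      proof -
        have *: "B \<inter> (Z \<times> {k}) = t \<times> {k}" if t: "t \<in> ?av" "B \<inter> ?Z t = t \<times> {k}" for t
        proof -
          have "B \<inter> (Z \<times> {k}) = (B \<inter> ?Z t) \<inter> (Z \<times> {k})" by auto
          also have "\<dots> = t \<times> {k}" using t sZ[OF t(1)] by auto
          finally show ?thesis .
        qed
        have "s' \<times> {k} = s \<times> {k}" using *[OF that] *[OF s] by simp
        then show ?thesis by auto
      qed
      have "(\<Sum>s\<in>?av. of_bool (B \<inter> ?Z s = s \<times> {k}) :: real) = (\<Sum>s'\<in>?av. if s' = s then 1 else 0)"
      proof (rule sum.cong[OF refl])
        fix s' assume s': "s' \<in> ?av"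
        show "(of_bool (B \<inter> ?Z s' = s' \<times> {k}) :: real) = (if s' = s then 1 else 0)"
        proof (cases "s' = s")
          case True
          then show ?thesis using s(2) by simp
        next
          case False
          then have "B \<inter> ?Z s' \<noteq> s' \<times> {k}" using uniq s' by blast
          then show ?thesis using False by simp
        qed
      qed
      then show ?thesis using s finav True by simp
    qed simp
  qed
  finally show ?thesis .
qed

text \<open>The rows are revealed one at a time. The potential \<open>2 ^ - g\<close>, where \<open>g\<close> is the number of safe
  vertices, shrinks by the factor \<open>1 - p / 4\<close> in expectation while \<open>g < L\<close>: a new safe vertex appears with probability
  at least \<open>p\<close>, and few reserved vertices can be hit. When \<open>g \<ge> L\<close>, the expected potential after the
  row is at most \<open>\<theta> ^ L\<close>. The predicate \<open>ok\<close> holds as long as few vertices are selected near the demand, and is what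
  keeps \<open>avail\<close> large.\<close>

lemma pr_few_safe:
  assumes q: "0 \<le> q" "q \<le> 1" and p: "0 \<le> p" "p \<le> 1" "p \<le> real N * q\<^sup>2 * (1 - q) ^ n"
    and ok: "\<And>F F'. ok F' \<Longrightarrow> F \<subseteq> F' \<Longrightarrow> ok F"
    and N: "\<And>F. F \<subseteq> W \<Longrightarrow> ok F \<Longrightarrow> real N \<le> real (card (avail Y X R F))"
    and L: "(1 + q) ^ (2 * L) \<le> 1 + p / 4" and \<theta>: "(1 + q)\<^sup>2 / 2 \<le> \<theta>" "\<theta> \<le> 1"
  shows "pr q (W \<times> {..<K}) (\<lambda>A. ok (fst ` A) \<and> card (safe adj Y X R K A) < G)
    \<le> 2 ^ G * ((1 - p / 4) ^ K + real K * \<theta> ^ L)"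
proof -
  define \<Phi> where "\<Phi> k A = of_bool (ok (fst ` A)) * (1/2::real) ^ card (safe adj Y X R k A)" for k A
  have \<theta>0: "0 \<le> \<theta>" using \<theta>(1) q by (meson order_trans zero_le_divide_iff zero_le_numeral zero_le_power2)
  have step: "ev q (W \<times> {k}) (\<lambda>B. \<Phi> (Suc k) (A \<union> B)) \<le> (1 - p/4) * \<Phi> k A + \<theta> ^ L"
    if A: "A \<subseteq> W \<times> {..<k}" for A k
  proof (cases "ok (fst ` A)")
    case False
    then have "\<Phi> (Suc k) (A \<union> B) = 0" for B
      using ok[of "fst ` (A \<union> B)" "fst ` A"] by (auto simp: \<Phi>_def)
    then show ?thesis using False \<theta>0 finW by (simp add: \<Phi>_def)
  next
    case True
    let ?S = "safe adj Y X R k A"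
    let ?g = "card ?S"
    define RG where "RG = \<Union> (R ` ?S)"
    define hit where "hit B \<longleftrightarrow> (\<exists>s\<in>avail Y X R (fst ` A).
      B \<inter> ((Z \<union> {w \<in> W. \<exists>u\<in>s. adj w u}) \<times> {k}) = s \<times> {k})" for B
    have finS: "finite ?S" using finY by (auto simp: safe_def)
    have RGW: "RG \<subseteq> W" using RZ ZW by (force simp: RG_def safe_def)
    have "ev q (W \<times> {k}) (\<lambda>B. \<Phi> (Suc k) (A \<union> B))
      \<le> ev q (W \<times> {k}) (\<lambda>B. (1/2) ^ ?g * (2 ^ card (B \<inter> (RG \<times> {k})) - 1/2 * of_bool (hit B)))"
    proof (intro ev_mono q)
      fix B assume B: "B \<subseteq> W \<times> {k}"
      have "\<Phi> (Suc k) (A \<union> B) \<le> (1/2) ^ card (safe adj Y X R (Suc k) (A \<union> B))"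
        by (simp add: \<Phi>_def)
      also note safe_step[OF A B, folded RG_def hit_def]
      finally show "\<Phi> (Suc k) (A \<union> B) \<le> (1/2) ^ ?g * (2 ^ card (B \<inter> (RG \<times> {k})) - 1/2 * of_bool (hit B))"
        by simp
    qed
    also have "\<dots> = (1/2) ^ ?g * ((1 + q) ^ card ((W \<times> {k}) \<inter> (RG \<times> {k})) - pr q (W \<times> {k}) hit / 2)"
      unfolding ev_cmult ev_diff pr_def using finW by (simp add: ev_power_card)
    \<comment> \<open>Each safe vertex reserves at most two vertices, which bounds the exponent of
      \<open>1 + q\<close>.\<close>
    also have "\<dots> \<le> (1/2) ^ ?g * ((1 + q) ^ (2 * ?g) - p / 2)"
    proof (intro mult_left_mono diff_mono power_increasing)
      have "card ((W \<times> {k}) \<inter> (RG \<times> {k})) \<le> card (RG \<times> {k})"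
        using finite_subset[OF RGW finW] by (intro card_mono) auto
      also have "\<dots> = card RG" by (simp add: card_cartesian_product)
      also have "\<dots> \<le> (\<Sum>y\<in>?S. card (R y))" unfolding RG_def by (rule card_UN_le[OF finS])
      also have "\<dots> \<le> (\<Sum>y\<in>?S. 2)" by (rule sum_mono) (use cardR in \<open>auto simp: safe_def\<close>)
      finally show "card ((W \<times> {k}) \<inter> (RG \<times> {k})) \<le> 2 * ?g" by simp
      have "fst ` A \<subseteq> W" using A by auto
      then show "p / 2 \<le> pr q (W \<times> {k}) hit / 2"
        using pr_hit[OF q N[OF _ True], where k = k] p(3) by (auto simp: hit_def[abs_def])
    qed (use q in auto)
    \<comment> \<open>Below \<open>L\<close>, the expected losses consume at most
      \<open>p / 4\<close> of the gain \<open>p / 2\<close>. From \<open>L\<close> on, the potential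
      is so small that it stays below \<open>\<theta> ^ L\<close> even after the losses.\<close>
    also have "\<dots> \<le> (1 - p/4) * (1/2) ^ ?g + \<theta> ^ L"
    proof (cases "?g < L")
      case g: True
      have "(1 + q) ^ (2 * ?g) \<le> (1 + q) ^ (2 * L)" using g q by (intro power_increasing) auto
      then have "(1 + q) ^ (2 * ?g) - p / 2 \<le> 1 - p / 4" using L by linarith
      then have "(1/2) ^ ?g * ((1 + q) ^ (2 * ?g) - p / 2) \<le> (1/2) ^ ?g * (1 - p/4)"
        by (intro mult_left_mono) auto
      then show ?thesis
        using zero_le_power[OF \<theta>0, of L] by (subst mult.commute[of "1 - p/4"]) linarith
    next
      case g: False
      have "(1/2) ^ ?g * ((1 + q) ^ (2 * ?g) - p / 2) \<le> (1/2) ^ ?g * (1 + q) ^ (2 * ?g)"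
        using p by (intro mult_left_mono) auto
      also have "\<dots> = ((1 + q)\<^sup>2 / 2) ^ ?g" by (simp add: power_mult power_divide)
      also have "\<dots> \<le> \<theta> ^ ?g" using \<theta>(1) by (intro power_mono) auto
      also have "\<dots> \<le> \<theta> ^ L" using g \<theta>0 \<theta>(2) by (intro power_decreasing) auto
      finally have "(1/2) ^ ?g * ((1 + q) ^ (2 * ?g) - p / 2) \<le> \<theta> ^ L" .
      moreover have "0 \<le> (1 - p/4) * (1/2::real) ^ ?g" using p by simp
      ultimately show ?thesis by linarith
    qed
    finally show ?thesis using True by (simp add: \<Phi>_def)
  qed
  have main: "ev q (W \<times> {..<k}) (\<Phi> k) \<le> (1 - p/4) ^ k + real k * \<theta> ^ L" for k
  proof (induction k)
    case 0
    then show ?case by (simp add: \<Phi>_def safe_def saved_def)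
  next
    case (Suc k)
    have eq: "W \<times> {..<Suc k} = W \<times> {..<k} \<union> W \<times> {k}" by auto
    have "ev q (W \<times> {..<Suc k}) (\<Phi> (Suc k))
        = ev q (W \<times> {..<k}) (\<lambda>A. ev q (W \<times> {k}) (\<lambda>B. \<Phi> (Suc k) (A \<union> B)))"
      unfolding eq using finW by (intro ev_union) auto
    also have "\<dots> \<le> ev q (W \<times> {..<k}) (\<lambda>A. (1 - p/4) * \<Phi> k A + \<theta> ^ L)"
      by (intro ev_mono q step)
    also have "\<dots> = (1 - p/4) * ev q (W \<times> {..<k}) (\<Phi> k) + \<theta> ^ L"
      using finW by (simp add: ev_add ev_cmult)
    also have "\<dots> \<le> (1 - p/4) * ((1 - p/4) ^ k + real k * \<theta> ^ L) + \<theta> ^ L"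
      using p Suc by (intro add_right_mono mult_left_mono) auto
    also have "\<dots> \<le> (1 - p/4) ^ Suc k + real (Suc k) * \<theta> ^ L"
    proof -
      have "(1 - p/4) * (real k * \<theta> ^ L) \<le> 1 * (real k * \<theta> ^ L)"
        using p \<theta>0 by (intro mult_right_mono) auto
      then show ?thesis by (simp add: algebra_simps)
    qed
    finally show ?case .
  qed
  have "pr q (W \<times> {..<K}) (\<lambda>A. ok (fst ` A) \<and> card (safe adj Y X R K A) < G)
      \<le> ev q (W \<times> {..<K}) (\<lambda>A. 2 ^ G * \<Phi> K A)"
    unfolding pr_def
  proof (intro ev_mono q)
    fix A
    show "of_bool (ok (fst ` A) \<and> card (safe adj Y X R K A) < G) \<le> 2 ^ G * \<Phi> K A"
    proof (cases "ok (fst ` A) \<and> card (safe adj Y X R K A) < G")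
      case True
      have "1 = (2::real) ^ G * (1/2) ^ G" by (simp add: power_mult_distrib[symmetric])
      also have "\<dots> \<le> 2 ^ G * (1/2) ^ card (safe adj Y X R K A)"
        using True by (intro mult_left_mono power_decreasing) auto
      finally show ?thesis using True by (simp add: \<Phi>_def)
    next
      case False
      moreover have "0 \<le> 2 ^ G * \<Phi> K A" by (simp add: \<Phi>_def)
      ultimately show ?thesis by (simp only: of_bool_eq)
    qed
  qed
  also have "\<dots> \<le> 2 ^ G * ((1 - p / 4) ^ K + real K * \<theta> ^ L)"
    using main[of K] by (simp add: ev_cmult)
  finally show ?thesis .
qed

end

text \<open>Markov's inequality applied to 2 to the power of the number of selected pairs over
  \<open>U\<close>. This number is at least the number of selected vertices of
  \<open>U\<close>.\<close>

lemma pr_cap_exceeded: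
  assumes "finite W" "finite U" "0 \<le> q" "q \<le> 1"
  shows "pr q (W \<times> {..<K}) (\<lambda>A. e < real (card (fst ` A \<inter> U)))
    \<le> 2 powr (- e) * exp (q * real K * real (card U))"
proof -
  let ?I = "W \<times> {..<K}" and ?U = "U \<times> (UNIV :: nat set)"
  have "pr q ?I (\<lambda>A. e < real (card (fst ` A \<inter> U))) \<le> ev q ?I (\<lambda>A. 2 powr (- e) * 2 ^ card (A \<inter> ?U))"
    unfolding pr_def
  proof (intro ev_mono assms)
    fix A assume A: "A \<subseteq> ?I"
    then have "finite A" using assms finite_subset by blast
    show "of_bool (e < real (card (fst ` A \<inter> U))) \<le> 2 powr (- e) * 2 ^ card (A \<inter> ?U)"
    proof (cases "e < real (card (fst ` A \<inter> U))")
      case True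
      have "fst ` A \<inter> U = fst ` (A \<inter> ?U)" by force
      then have "card (fst ` A \<inter> U) \<le> card (A \<inter> ?U)" using \<open>finite A\<close> by (simp add: card_image_le)
      then have "e \<le> real (card (A \<inter> ?U))" using True by linarith
      then have "2 powr 0 \<le> (2::real) powr (- e + real (card (A \<inter> ?U)))" by (intro powr_mono) auto
      also have "\<dots> = 2 powr (- e) * 2 ^ card (A \<inter> ?U)"
        unfolding powr_add by (simp add: powr_realpow)
      finally show ?thesis using True by simp
    qed simp
  qed
  also have "\<dots> = 2 powr (- e) * (1 + q) ^ card (?I \<inter> ?U)"
    using assms by (simp add: ev_cmult ev_power_card)
  also have "?I \<inter> ?U = (W \<inter> U) \<times> {..<K}" by auto
  also have "(1 + q) ^ card ((W \<inter> U) \<times> {..<K}) \<le> exp q ^ card ((W \<inter> U) \<times> {..<K})"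
    using assms by (intro power_mono) (auto simp: exp_ge_add_one_self)
  also have "\<dots> \<le> exp q ^ (card U * K)"
    using assms by (intro power_increasing) (auto simp: card_cartesian_product intro: card_mono)
  also have "\<dots> = exp (q * real K * real (card U))"
    by (simp add: exp_of_nat_mult[symmetric] mult_ac)
  finally show ?thesis by (simp add: mult_left_mono)
qed

text \<open>Adjacency in \<open>V\<close> is made reflexive, so that the n-th power relates vertices
  at distance at most n and grows with n.\<close>

definition nbrel :: "'a set \<Rightarrow> ('a \<Rightarrow> 'a \<Rightarrow> bool) \<Rightarrow> 'a rel" where
  "nbrel V adj = {(u, w). u = w \<or> (u \<in> V \<and> w \<in> V \<and> adj u w)}"

lemma nbrel_relpow_mono:
  assumes "m \<le> n" shows "nbrel V adj ^^ m \<subseteq> nbrel V adj ^^ n"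
proof -
  have Id: "Id \<subseteq> nbrel V adj ^^ k" for k
    by (induction k) (auto simp: nbrel_def)
  have "nbrel V adj ^^ n = nbrel V adj ^^ m O nbrel V adj ^^ (n - m)"
    using assms by (simp add: relpow_add[symmetric])
  then show ?thesis using Id[of "n - m"] by auto
qed

lemma nbrel_relpow_sym:
  assumes "\<And>u v. adj u v \<Longrightarrow> adj v u" "(u, w) \<in> nbrel V adj ^^ n"
  shows "(w, u) \<in> nbrel V adj ^^ n"
  using assms(2)
proof (induction n arbitrary: w)
  case (Suc n)
  then obtain z where z: "(u, z) \<in> nbrel V adj ^^ n" "(z, w) \<in> nbrel V adj" by auto
  then have "(w, z) \<in> nbrel V adj" using assms(1) by (auto simp: nbrel_def)
  then show ?case using Suc.IH[OF z(1)] by (rule relpow_Suc_I2)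
qed simp

lemma card_nbrel_ball:
  assumes "finite V" "\<And>v. v \<in> V \<Longrightarrow> card {w \<in> V. adj v w} \<le> D" "u \<in> V"
  shows "(nbrel V adj ^^ n) `` {u} \<subseteq> V" "card ((nbrel V adj ^^ n) `` {u}) \<le> (D + 1) ^ n"
proof -
  have "(nbrel V adj ^^ n) `` {u} \<subseteq> V \<and> card ((nbrel V adj ^^ n) `` {u}) \<le> (D + 1) ^ n"
  proof (induction n)
    case 0
    then show ?case using assms by simp
  next
    case (Suc n)
    let ?B = "(nbrel V adj ^^ n) `` {u}"
    have fin: "finite ?B" using Suc assms finite_subset by blast
    have eq: "(nbrel V adj ^^ Suc n) `` {u} = (\<Union>x\<in>?B. nbrel V adj `` {x})" by auto
    have one: "nbrel V adj `` {x} \<subseteq> insert x {w \<in> V. adj x w}" for x by (auto simp: nbrel_def)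
    have "card (nbrel V adj `` {x}) \<le> D + 1" if "x \<in> ?B" for x
    proof -
      have "card (nbrel V adj `` {x}) \<le> card (insert x {w \<in> V. adj x w})"
        using assms(1) by (intro card_mono one) auto
      also have "\<dots> \<le> Suc (card {w \<in> V. adj x w})" by (rule card_insert_le_m1) auto
      also have "\<dots> \<le> D + 1" using assms(2)[of x] that Suc by auto
      finally show ?thesis .
    qed
    then have "(\<Sum>x\<in>?B. card (nbrel V adj `` {x})) \<le> (\<Sum>x\<in>?B. D + 1)" by (rule sum_mono)
    also have "\<dots> \<le> (D + 1) ^ n * (D + 1)" using Suc by (simp add: mult_right_mono del: add_Suc_right mult_Suc mult_Suc_right)
    finally have "card ((nbrel V adj ^^ Suc n) `` {u}) \<le> (D + 1) ^ n * (D + 1)"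
      unfolding eq using card_UN_le[OF fin, of "\<lambda>x. nbrel V adj `` {x}"] by linarith
    moreover have "(nbrel V adj ^^ Suc n) `` {u} \<subseteq> V" unfolding eq using one Suc by fast
    ultimately show ?case by (simp add: mult.commute)
  qed
  then show "(nbrel V adj ^^ n) `` {u} \<subseteq> V" "card ((nbrel V adj ^^ n) `` {u}) \<le> (D + 1) ^ n" by auto
qed

text \<open>Each vertex has at most four bad events: exceeding one of its three caps \<open>e u k\<close> on the number of coloured
  vertices in \<open>U u k\<close>, and having too few safe vertices although the caps hold. All of them depend
  only on the ball of radius 3.\<close>

lemma random_partial_colouring:
  fixes adj :: "'a \<Rightarrow> 'a \<Rightarrow> bool" and U :: "'a \<Rightarrow> nat \<Rightarrow> 'a set" and e :: "'a \<Rightarrow> nat \<Rightarrow> real"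
    and Y Z :: "'a \<Rightarrow> 'a set" and X R :: "'a \<Rightarrow> 'a \<Rightarrow> 'a set"
  assumes finV: "finite V" and WV: "W \<subseteq> V"
    and sym: "\<And>u v. adj u v \<Longrightarrow> adj v u" and deg: "\<And>v. v \<in> V \<Longrightarrow> card {w \<in> V. adj v w} \<le> D"
    and q: "0 \<le> q" "q \<le> 1"
    and UV: "\<And>u k. u \<in> V \<Longrightarrow> k < 3 \<Longrightarrow> U u k \<subseteq> (nbrel V adj ^^ 2) `` {u}"
    and cap: "\<And>u k. u \<in> V \<Longrightarrow> k < 3 \<Longrightarrow> 2 powr (- e u k) * exp (q * real K * real (card (U u k))) \<le> pp"
    and Dm: "Dm \<subseteq> V" and dem: "\<And>u. u \<in> Dm \<Longrightarrow> demand adj W (Y u) (Z u) (X u) (R u) n"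
    and Zb: "\<And>u. u \<in> Dm \<Longrightarrow> Z u \<subseteq> (nbrel V adj ^^ 2) `` {u}"
    and p: "0 \<le> p" "p \<le> 1" "p \<le> real N * q\<^sup>2 * (1 - q) ^ n"
    and N: "\<And>u F. u \<in> Dm \<Longrightarrow> F \<subseteq> W \<Longrightarrow> (\<forall>k<3. real (card (F \<inter> U u k)) \<le> e u k)
      \<Longrightarrow> real N \<le> real (card (avail (Y u) (X u) (R u) F))"
    and L: "(1 + q) ^ (2 * L) \<le> 1 + p / 4" and \<theta>: "(1 + q)\<^sup>2 / 2 \<le> \<theta>" "\<theta> \<le> 1"
    and fail: "2 ^ G * ((1 - p / 4) ^ K + real K * \<theta> ^ L) \<le> pp"
    and pp: "16 * pp * real ((D + 1) ^ 6) \<le> 1"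
  shows "\<exists>S \<phi>. S \<subseteq> W \<and> \<phi> ` S \<subseteq> {..<K} \<and> (\<forall>v\<in>S. \<forall>w\<in>S. adj v w \<longrightarrow> \<phi> v \<noteq> \<phi> w) \<and>
    (\<forall>u\<in>V. \<forall>k<3. real (card (S \<inter> U u k)) \<le> e u k) \<and>
    (\<forall>u\<in>Dm. \<exists>Y'\<subseteq>Y u. G \<le> card Y' \<and>
       (\<forall>y\<in>Y'. y \<in> S \<and> R u y \<inter> S = {} \<and> (\<exists>x\<in>X u y. x \<in> S \<and> \<phi> x = (\<phi> y :: nat))))"
proof (cases "V = {}")
  case True
  then show ?thesis using Dm by (intro exI[of _ "{}"]) auto
next
  case False
  then obtain v0 where v0: "v0 \<in> V" by auto
  have pp0: "0 \<le> pp"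
    using order_trans[OF _ cap[OF v0, of 0]] by simp
  define ball where "ball m u = (nbrel V adj ^^ m) `` {u}" for m u
  define ok where "ok u F \<longleftrightarrow> (\<forall>k<3. real (card (F \<inter> U u k)) \<le> e u k)" for u F
  define bad where "bad t A \<longleftrightarrow> (case t of (u, k) \<Rightarrow>
     if k < 3 then e u k < real (card (fst ` A \<inter> U u k))
     else u \<in> Dm \<and> ok u (fst ` A) \<and> card (safe adj (Y u) (X u) (R u) K A) < G)"
    for t :: "'a \<times> nat" and A
  define supp where "supp t = ball 3 (fst t) \<times> (UNIV :: nat set)" for t :: "'a \<times> nat"
  let ?T = "V \<times> {..<4::nat}" and ?I = "W \<times> {..<K}"
  have finW: "finite W" using finV WV finite_subset by auto
  have ballV: "ball m u \<subseteq> V" if "u \<in> V" for m u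
    unfolding ball_def by (rule card_nbrel_ball(1)[OF finV deg that])
  have ball_fin: "finite (ball m u)" if "u \<in> V" for m u
    by (rule finite_subset[OF ballV[OF that] finV])
  have finU: "finite (U u k)" if "u \<in> V" "k < 3" for u k
    by (rule finite_subset[OF UV[OF that] ball_fin[OF that(1), unfolded ball_def]])
  have ball23: "ball 2 u \<subseteq> ball 3 u" for u
    unfolding ball_def using nbrel_relpow_mono[of 2 3 V adj] by auto
  have okmono: "ok u F" if "ok u F'" "F \<subseteq> F'" "u \<in> V" for u F F'
    unfolding ok_def
  proof (intro allI impI)
    fix k :: nat assume k: "k < 3"
    have "card (F \<inter> U u k) \<le> card (F' \<inter> U u k)" using finU[OF that(3) k] that by (intro card_mono) auto
    then show "real (card (F \<inter> U u k)) \<le> e u k" using that(1) k unfolding ok_def by fastforce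
  qed
  have "\<exists>A\<subseteq>?I. \<forall>t\<in>?T. \<not> bad t A"
  \<comment> \<open>The supports are balls of radius 3, so dependent events are centred at distance
    at most 6. Such a ball has at most \<open>(D + 1) ^ 6\<close> vertices, and each carries four
    events.\<close>
  proof (rule local_lemma[where supp = supp and p = pp and d = "4 * (D + 1) ^ 6" and q = q])
    show "pr q ?I (bad t) \<le> pp" if t: "t \<in> ?T" for t
    proof -
      obtain u k where uk: "t = (u, k)" "u \<in> V" "k < 4" using t by auto
      show ?thesis
      proof (cases "k < 3")
        case True
        have "pr q ?I (bad t) = pr q ?I (\<lambda>A. e u k < real (card (fst ` A \<inter> U u k)))"
          using True uk by (simp add: bad_def[abs_def])
        also have "\<dots> \<le> 2 powr (- e u k) * exp (q * real K * real (card (U u k)))"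
          by (rule pr_cap_exceeded[OF finW finU[OF uk(2) True] q])
        also note cap[OF uk(2) True]
        finally show ?thesis .
      next
        case False
        show ?thesis
        proof (cases "u \<in> Dm")
          case u: True
          interpret demand adj W "Y u" "Z u" "X u" "R u" n by (rule dem[OF u])
          have "pr q ?I (bad t) = pr q ?I (\<lambda>A. ok u (fst ` A) \<and> card (safe adj (Y u) (X u) (R u) K A) < G)"
            using False uk u by (simp add: bad_def[abs_def])
          also have "\<dots> \<le> 2 ^ G * ((1 - p / 4) ^ K + real K * \<theta> ^ L)"
            by (rule pr_few_safe[OF q p _ _ L \<theta>])
              (use okmono uk N[OF u] in \<open>auto simp: ok_def\<close>)
          also note fail
          finally show ?thesis .
        next
          case u: False
          have "pr q ?I (bad t) = ev q ?I (\<lambda>_. 0)"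
            using False uk u by (simp add: bad_def[abs_def] pr_def)
          also have "\<dots> = 0" using finW by simp
          also note pp0
          finally show ?thesis .
        qed
      qed
    qed
    show "bad t A = bad t (A \<inter> supp t)" if t: "t \<in> ?T" and A: "A \<subseteq> ?I" for t A
    proof -
      obtain u k where uk: "t = (u, k)" "u \<in> V" "k < 4" using t by auto
      let ?A = "A \<inter> supp t"
      have mem: "(w, a) \<in> ?A \<longleftrightarrow> (w, a) \<in> A" if "w \<in> ball 3 u" for w a
        using that uk by (auto simp: supp_def)
      have fstI: "fst ` ?A \<inter> H = fst ` A \<inter> H" if "H \<subseteq> ball 2 u" for H
      proof
        show "fst ` ?A \<inter> H \<subseteq> fst ` A \<inter> H" by auto
        show "fst ` A \<inter> H \<subseteq> fst ` ?A \<inter> H"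
        proof
          fix w assume "w \<in> fst ` A \<inter> H"
          then obtain a where a: "(w, a) \<in> A" "w \<in> H" by auto
          then have "(w, a) \<in> ?A" using mem that ball23 by blast
          then show "w \<in> fst ` ?A \<inter> H" using a(2) by force
        qed
      qed
      have cU: "fst ` ?A \<inter> U u k = fst ` A \<inter> U u k" if "k < 3" for k
        using UV[OF uk(2) that] by (intro fstI) (auto simp: ball_def)
      have okeq: "ok u (fst ` ?A) = ok u (fst ` A)" unfolding ok_def using cU by auto
      have "safe adj (Y u) (X u) (R u) K ?A = safe adj (Y u) (X u) (R u) K A" if u: "u \<in> Dm"
      proof -
        interpret demand adj W "Y u" "Z u" "X u" "R u" n by (rule dem[OF u])
        have Z2: "Z u \<subseteq> ball 2 u" using Zb[OF u] by (simp add: ball_def)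
        \<comment> \<open>Being saved is a condition on all neighbours of the vertex and of its
          partner. Both lie in \<open>Z u\<close>, within distance 2, hence the radius 3.\<close>
        have nbr: "(w, a) \<in> ?A \<longleftrightarrow> (w, a) \<in> A" if "z \<in> Z u" "adj w z" for w z a
        proof -
          have "w \<in> ball 3 u" if h: "(w, a) \<in> A"
          proof -
            have "w \<in> V" "z \<in> V" using h A WV ZW \<open>z \<in> Z u\<close> by auto
            then have "(z, w) \<in> nbrel V adj" using \<open>adj w z\<close> sym by (auto simp: nbrel_def)
            moreover have "(u, z) \<in> nbrel V adj ^^ 2" using Z2 \<open>z \<in> Z u\<close> by (auto simp: ball_def)
            ultimately have "(u, w) \<in> nbrel V adj ^^ Suc 2" by (intro relpow_Suc_I)
            moreover have "Suc 2 = 3" by simp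
            ultimately show ?thesis by (simp only: ball_def Image_singleton_iff)
          qed
          then show ?thesis using mem by blast
        qed
        have sv: "saved adj (X u y) K ?A y \<longleftrightarrow> saved adj (X u y) K A y" if y: "y \<in> Y u" for y
        proof -
          have yZ: "y \<in> Z u" using y YZ by auto
          have m: "(z, a) \<in> ?A \<longleftrightarrow> (z, a) \<in> A" if "z \<in> Z u" for z a using mem Z2 ball23 that by blast
          have xZ: "x \<in> Z u" if "x \<in> X u y" for x using XZ[OF y] that by auto
          have n: "(\<forall>w. adj w y \<or> adj w x \<longrightarrow> (w, a) \<notin> ?A) \<longleftrightarrow> (\<forall>w. adj w y \<or> adj w x \<longrightarrow> (w, a) \<notin> A)"
            if "x \<in> X u y" for x a using nbr[OF yZ] nbr[OF xZ[OF that]] by blast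
          show ?thesis unfolding saved_def
            by (intro ex_cong1 conj_cong refl bex_cong) (simp_all only: m[OF yZ] m[OF xZ] n)
        qed
        have "R u y \<inter> fst ` ?A = R u y \<inter> fst ` A" if "y \<in> Y u" for y
          using fstI[of "R u y"] RZ[OF that] Z2 by blast
        then show ?thesis unfolding safe_def using sv by (intro Collect_cong conj_cong refl) simp_all
      qed
      then show ?thesis using cU okeq uk by (auto simp: bad_def)
    qed
    show "card {s \<in> ?T. supp s \<inter> supp t \<noteq> {}} \<le> 4 * (D + 1) ^ 6" if t: "t \<in> ?T" for t
    proof -
      have "{s \<in> ?T. supp s \<inter> supp t \<noteq> {}} \<subseteq> ball 6 (fst t) \<times> {..<4}"
      proof
        fix s assume s: "s \<in> {s \<in> ?T. supp s \<inter> supp t \<noteq> {}}"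
        then obtain w where w: "(fst s, w) \<in> nbrel V adj ^^ 3" "(fst t, w) \<in> nbrel V adj ^^ 3"
          by (auto simp: supp_def ball_def)
        have "(w, fst s) \<in> nbrel V adj ^^ 3" by (rule nbrel_relpow_sym[OF _ w(1)]) (rule sym)
        then have "(fst t, fst s) \<in> nbrel V adj ^^ 3 O nbrel V adj ^^ 3"
          using w(2) by blast
        then have "(fst t, fst s) \<in> nbrel V adj ^^ 6" unfolding relpow_add[symmetric] by simp
        then show "s \<in> ball 6 (fst t) \<times> {..<4}" using s by (cases s) (auto simp: ball_def)
      qed
      moreover have "fst t \<in> V" using t by auto
      ultimately have "card {s \<in> ?T. supp s \<inter> supp t \<noteq> {}} \<le> card (ball 6 (fst t) \<times> {..<4::nat})"
        using ball_fin by (intro card_mono) auto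
      also have "\<dots> \<le> 4 * (D + 1) ^ 6"
        using card_nbrel_ball(2)[OF finV deg \<open>fst t \<in> V\<close>, where n = 6]
        by (simp add: card_cartesian_product ball_def)
      finally show ?thesis .
    qed
    show "0 \<le> pp" by (rule pp0)
  qed (use finV finW q pp in auto)
  then obtain A where A: "A \<subseteq> ?I" "\<And>t. t \<in> ?T \<Longrightarrow> \<not> bad t A" by auto
  \<comment> \<open>Decoding the random set. Adjacent vertices of \<open>S\<close> get different
    colours, because each one's own pair \<open>(w, c w)\<close> lies in \<open>A\<close> and would
    have eliminated the other.\<close>
  define c where "c w = (LEAST a. (w, a) \<in> A)" for w
  define S where "S = {w \<in> fst ` A. \<forall>w'. adj w' w \<longrightarrow> (w', c w) \<notin> A}"
  have cA: "(w, c w) \<in> A" if "w \<in> fst ` A" for w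
    using that unfolding c_def by (auto intro: LeastI)
  have SW: "S \<subseteq> W" using A by (auto simp: S_def)
  have okA: "real (card (fst ` A \<inter> U u k)) \<le> e u k" if "u \<in> V" "k < 3" for u k
    using A(2)[of "(u, k)"] that by (auto simp: bad_def)
  show ?thesis
  proof (rule exI[of _ S], rule exI[of _ c], intro conjI ballI allI impI)
    show "S \<subseteq> W" by (rule SW)
    show "c ` S \<subseteq> {..<K}" using cA A(1) by (force simp: S_def)
    show "c v \<noteq> c w" if "v \<in> S" "w \<in> S" "adj v w" for v w
      using that cA unfolding S_def by force
    show "real (card (S \<inter> U u k)) \<le> e u k" if "u \<in> V" "k < 3" for u k
    proof -
      have "card (S \<inter> U u k) \<le> card (fst ` A \<inter> U u k)"
        using finU[OF that] by (intro card_mono) (auto simp: S_def)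
      then show ?thesis using okA[OF that] by linarith
    qed
    fix u assume u: "u \<in> Dm"
    interpret demand adj W "Y u" "Z u" "X u" "R u" n by (rule dem[OF u])
    have uV: "u \<in> V" using u Dm by auto
    let ?S = "safe adj (Y u) (X u) (R u) K A"
    have "G \<le> card ?S"
      using A(2)[of "(u, 3)"] uV u okA[OF uV] by (auto simp: bad_def ok_def)
    moreover have "y \<in> S \<and> R u y \<inter> S = {} \<and> (\<exists>x\<in>X u y. x \<in> S \<and> c x = c y)" if y: "y \<in> ?S" for y
    proof -
      obtain a x where a: "x \<in> X u y" "(y, a) \<in> A" "(x, a) \<in> A"
        "\<forall>w. adj w y \<or> adj w x \<longrightarrow> (w, a) \<notin> A" "\<forall>b<a. (y, b) \<notin> A \<and> (x, b) \<notin> A"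
        using y unfolding safe_def saved_def by blast
      have "c y = a" unfolding c_def by (rule Least_equality, rule a(2), meson a(5) not_le)
      moreover have "c x = a" unfolding c_def by (rule Least_equality, rule a(3), meson a(5) not_le)
      moreover have "y \<in> fst ` A" "x \<in> fst ` A" using a(2,3) by (metis fst_conv image_eqI)+
      ultimately have "y \<in> S" "x \<in> S" using a(4) unfolding S_def by auto
      moreover have "R u y \<inter> S = {}" using y by (auto simp: safe_def S_def)
      ultimately show ?thesis using a(1) \<open>c y = a\<close> \<open>c x = a\<close> by auto
    qed
    ultimately show "\<exists>Y'\<subseteq>Y u. G \<le> card Y' \<and>
       (\<forall>y\<in>Y'. y \<in> S \<and> R u y \<inter> S = {} \<and> (\<exists>x\<in>X u y. x \<in> S \<and> c x = c y))"
      by (intro exI[of _ ?S]) (auto simp: safe_def)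
  qed
qed

section \<open>Greedy extension of partial colourings\<close>

definition nb :: "'a set \<Rightarrow> ('a \<Rightarrow> 'a \<Rightarrow> bool) \<Rightarrow> 'a \<Rightarrow> 'a set" where
  "nb V adj v = {w \<in> V. adj v w}"

definition proper_on :: "('a \<Rightarrow> 'a \<Rightarrow> bool) \<Rightarrow> nat \<Rightarrow> 'a set \<Rightarrow> ('a \<Rightarrow> nat) \<Rightarrow> bool" where
  "proper_on adj k S \<phi> \<longleftrightarrow> \<phi> ` S \<subseteq> {..<k} \<and> (\<forall>v\<in>S. \<forall>w\<in>S. adj v w \<longrightarrow> \<phi> v \<noteq> \<phi> w)"

definition complete_on :: "('a \<Rightarrow> 'a \<Rightarrow> bool) \<Rightarrow> 'a set \<Rightarrow> bool" where
  "complete_on adj C \<longleftrightarrow> (\<forall>u\<in>C. \<forall>v\<in>C. u \<noteq> v \<longrightarrow> adj u v)"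

lemma complete_on_subset: "complete_on adj C \<Longrightarrow> T \<subseteq> C \<Longrightarrow> complete_on adj T"
  unfolding complete_on_def by blast

lemma ex_free_colour:
  assumes "card F < k" "finite F" shows "\<exists>c<k. c \<notin> (F :: nat set)"
proof (rule ccontr)
  assume "\<not> ?thesis"
  then have "{..<k} \<subseteq> F" by auto
  then have "card {..<k} \<le> card F" using assms(2) by (intro card_mono)
  then show False using assms(1) by simp
qed

locale finite_graph =
  fixes V :: "'a set" and adj :: "'a \<Rightarrow> 'a \<Rightarrow> bool"
  assumes finV: "finite V" and sym: "\<And>u v. adj u v \<Longrightarrow> adj v u" and irr: "\<And>u. \<not> adj u u"
begin

abbreviation N :: "'a \<Rightarrow> 'a set" where "N \<equiv> nb V adj"

lemma finN [simp]: "finite (N v)" using finV by (simp add: nb_def)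

lemma N_subset: "N v \<subseteq> V" by (auto simp: nb_def)

lemma fin_subset: "S \<subseteq> V \<Longrightarrow> finite S" using finV finite_subset by blast

text \<open>\<open>saves \<phi> S u s\<close>: at least \<open>s\<close> coloured neighbours of \<open>u\<close> are redundant, because their
  colours already occur on other neighbours.\<close>

definition saves :: "('a \<Rightarrow> nat) \<Rightarrow> 'a set \<Rightarrow> 'a \<Rightarrow> nat \<Rightarrow> bool" where
  "saves \<phi> S u s \<longleftrightarrow> card (\<phi> ` (N u \<inter> S)) + s \<le> card (N u \<inter> S)"

lemma saves_0: "saves \<phi> S u 0"
  by (simp add: saves_def card_image_le)

lemma saves_mono_colouring:
  assumes "saves \<phi> S u s" "S \<subseteq> S'" "\<And>v. v \<in> S \<Longrightarrow> \<phi>' v = \<phi> v"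
  shows "saves \<phi>' S' u s"
proof -
  have eq: "N u \<inter> S' = (N u \<inter> S) \<union> (N u \<inter> (S' - S))" using assms(2) by auto
  have "\<phi>' ` (N u \<inter> S) = \<phi> ` (N u \<inter> S)" using assms(3) by (auto simp: image_iff)
  then have "\<phi>' ` (N u \<inter> S') = \<phi> ` (N u \<inter> S) \<union> \<phi>' ` (N u \<inter> (S' - S))"
    unfolding eq image_Un by simp
  then have "card (\<phi>' ` (N u \<inter> S')) \<le> card (\<phi> ` (N u \<inter> S)) + card (N u \<inter> (S' - S))"
    using card_Un_le[of "\<phi> ` (N u \<inter> S)" "\<phi>' ` (N u \<inter> (S' - S))"]
      card_image_le[of "N u \<inter> (S' - S)" \<phi>'] by simp
  moreover have "card (N u \<inter> S') = card (N u \<inter> S) + card (N u \<inter> (S' - S))"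
    by (subst eq) (rule card_Un_disjoint, auto)
  ultimately show ?thesis using assms(1) by (simp add: saves_def)
qed

text \<open>Deleting \<open>T\<close> from the coloured neighbours loses no colour. The partners
  must lie outside \<open>T\<close>, since otherwise two members of \<open>T\<close> could vouch for
  each other.\<close>

lemma saves_I:
  assumes T: "T \<subseteq> N u \<inter> S" "\<And>t. t \<in> T \<Longrightarrow> \<exists>x\<in>N u \<inter> S - T. \<phi> x = \<phi> t" and "s \<le> card T"
  shows "saves \<phi> S u s"
proof -
  have "\<phi> ` (N u \<inter> S) \<subseteq> \<phi> ` (N u \<inter> S - T)"
  proof
    fix c assume "c \<in> \<phi> ` (N u \<inter> S)"
    then obtain z where z: "z \<in> N u \<inter> S" "c = \<phi> z" by auto
    show "c \<in> \<phi> ` (N u \<inter> S - T)"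
    proof (cases "z \<in> T")
      case True
      then obtain x where "x \<in> N u \<inter> S - T" "\<phi> x = \<phi> z" using T(2) by blast
      then show ?thesis using z(2) by (metis image_eqI)
    qed (use z in auto)
  qed
  then have "card (\<phi> ` (N u \<inter> S)) \<le> card (N u \<inter> S - T)"
    by (meson card_image_le card_mono finN finite_Diff finite_Int finite_imageI order_trans)
  also have "\<dots> = card (N u \<inter> S) - card T"
    using T finite_subset[OF T(1)] by (intro card_Diff_subset) auto
  finally have "card (\<phi> ` (N u \<inter> S)) \<le> card (N u \<inter> S) - card T" .
  moreover have "card T \<le> card (N u \<inter> S)" using T by (intro card_mono) auto
  ultimately show ?thesis using assms(3) by (simp add: saves_def)
qed

lemma proper_on_insert:
  assumes "proper_on adj k S \<phi>" "S \<subseteq> V" "u \<notin> S" "c < k" "c \<notin> \<phi> ` (N u \<inter> S)"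
  shows "proper_on adj k (insert u S) (\<phi>(u := c))"
proof -
  have ne: "\<phi> z \<noteq> c" if "z \<in> S" "adj u z" for z
    using assms(2,5) that by (auto simp: nb_def)
  have "(\<phi>(u := c)) v \<noteq> (\<phi>(u := c)) w" if vw: "v \<in> insert u S" "w \<in> insert u S" "adj v w" for v w
  proof -
    consider "v = u" "w \<in> S" | "w = u" "v \<in> S" | "v \<in> S" "w \<in> S" using vw irr by blast
    then show ?thesis
    proof cases
      case 1
      then show ?thesis using ne[of w] vw assms(3) by auto
    next
      case 2
      then show ?thesis using ne[of v] sym[OF vw(3)] assms(3) by auto
    next
      case 3
      then show ?thesis using assms(1,3) vw unfolding proper_on_def by auto
    qed
  qed
  moreover have "(\<phi>(u := c)) ` insert u S \<subseteq> {..<k}"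
    using assms(1,4) unfolding proper_on_def by auto
  ultimately show ?thesis unfolding proper_on_def by blast
qed

text \<open>Greedy colouring in any order. The bounded quantity is the number of colours seen plus
  the number of neighbours still waiting in the layer; colouring a neighbour lowers the second by
  one and raises the first by at most one.\<close>

lemma extend_layer:
  assumes "proper_on adj k S \<phi>" "S \<subseteq> V" "L \<subseteq> V" "L \<inter> S = {}"
    "\<And>u. u \<in> L \<Longrightarrow> card (\<phi> ` (N u \<inter> S)) + card (N u \<inter> L) < k"
  shows "\<exists>\<phi>'. proper_on adj k (S \<union> L) \<phi>' \<and> (\<forall>v\<in>S. \<phi>' v = \<phi> v)"
  using fin_subset[OF assms(3)] assms
proof (induction L arbitrary: S \<phi> rule: finite_induct)
  case empty
  then show ?case by auto
next
  case (insert u L)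
  have "card (\<phi> ` (N u \<inter> S)) < k" using insert.prems(5)[of u] by simp
  then obtain c where c: "c < k" "c \<notin> \<phi> ` (N u \<inter> S)" using ex_free_colour[of "\<phi> ` (N u \<inter> S)" k] by auto
  let ?\<phi> = "\<phi>(u := c)"
  have uS: "u \<notin> S" "u \<in> V" using insert.prems by auto
  have colS: "proper_on adj k (insert u S) ?\<phi>"
    using insert.prems c uS by (intro proper_on_insert) auto
  have "\<exists>\<phi>'. proper_on adj k (insert u S \<union> L) \<phi>' \<and> (\<forall>v\<in>insert u S. \<phi>' v = ?\<phi> v)"
  proof (rule insert.IH[OF colS])
    fix w assume w: "w \<in> L"
    show "card (?\<phi> ` (N w \<inter> insert u S)) + card (N w \<inter> L) < k"
    proof (cases "u \<in> N w")
      case True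
      have "?\<phi> ` (N w \<inter> insert u S) \<subseteq> insert c (\<phi> ` (N w \<inter> S))" by auto
      then have "card (?\<phi> ` (N w \<inter> insert u S)) \<le> card (insert c (\<phi> ` (N w \<inter> S)))"
        by (intro card_mono) auto
      also have "\<dots> \<le> Suc (card (\<phi> ` (N w \<inter> S)))" by (rule card_insert_le_m1) auto
      finally have "card (?\<phi> ` (N w \<inter> insert u S)) \<le> Suc (card (\<phi> ` (N w \<inter> S)))" .
      moreover have "card (N w \<inter> insert u L) = Suc (card (N w \<inter> L))"
        using True insert.hyps by simp
      ultimately show ?thesis using insert.prems(5)[of w] w by simp
    next
      case False
      then have "?\<phi> ` (N w \<inter> insert u S) = \<phi> ` (N w \<inter> S)" "N w \<inter> insert u L = N w \<inter> L"
        using uS by auto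
      then show ?thesis using insert.prems(5)[of w] w by simp
    qed
  qed (use insert uS in auto)
  then show ?case using uS by auto
qed

text \<open>With \<open>D - 1\<close> colours, a vertex of degree \<open>D\<close> is two units
  short of a greedy colouring. Every redundant coloured neighbour, counted by \<open>s\<close>, and
  every neighbour left for later layers makes up for one unit.\<close>

lemma extend_layer_saves:
  assumes "proper_on adj (D - 1) S \<phi>" "S \<subseteq> V" "L \<subseteq> V" "L \<inter> S = {}" "2 \<le> D"
    "\<And>u. u \<in> L \<Longrightarrow> \<exists>s. saves \<phi> S u s \<and> card (N u) + 2 \<le> D + s + card (N u - (S \<union> L))"
  shows "\<exists>\<phi>'. proper_on adj (D - 1) (S \<union> L) \<phi>' \<and> (\<forall>v\<in>S. \<phi>' v = \<phi> v)"
proof (rule extend_layer[OF assms(1-4)])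
  fix u assume "u \<in> L"
  then obtain s where s: "saves \<phi> S u s" "card (N u) + 2 \<le> D + s + card (N u - (S \<union> L))"
    using assms(6) by blast
  have "card (N u) = card (N u \<inter> S) + card (N u - S)"
    using card_Un_disjoint[of "N u \<inter> S" "N u - S"] by (simp add: Int_Diff_Un Int_Diff_disjoint)
  also have "N u - S = (N u \<inter> L) \<union> (N u - (S \<union> L))" using assms(4) by auto
  also have "card \<dots> = card (N u \<inter> L) + card (N u - (S \<union> L))"
    by (rule card_Un_disjoint) auto
  finally show "card (\<phi> ` (N u \<inter> S)) + card (N u \<inter> L) < D - 1"
    using s assms(5) by (simp add: saves_def)
qed

text \<open>The deterministic source of repetitions: pairwise nonadjacent vertices receive one
  common colour as long as they have fewer than \<open>k\<close> coloured neighbours in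
  total.\<close>

lemma add_colour_class:
  assumes "proper_on adj k S \<phi>" "S \<subseteq> V" "T \<inter> S = {}" "finite T"
    and indep: "\<And>t t'. t \<in> T \<Longrightarrow> t' \<in> T \<Longrightarrow> \<not> adj t t'"
    and card: "card (\<Union>t\<in>T. N t \<inter> S) < k"
  obtains c where "c < k" "proper_on adj k (S \<union> T) (\<lambda>v. if v \<in> T then c else \<phi> v)"
proof -
  let ?F = "\<phi> ` (\<Union>t\<in>T. N t \<inter> S)"
  have fin: "finite (\<Union>t\<in>T. N t \<inter> S)" using assms(4) by auto
  have "card ?F < k" using card_image_le[OF fin, of \<phi>] card by simp
  then obtain c where c: "c < k" "c \<notin> ?F" using ex_free_colour fin by blast
  have ne: "\<phi> z \<noteq> c" if "z \<in> S" "t \<in> T" "adj t z" for z t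
    using c that assms(2) by (auto simp: nb_def)
  have ne': "\<phi> z \<noteq> c" if "z \<in> S" "t \<in> T" "adj z t" for z t
    using ne sym that by blast
  have "proper_on adj k (S \<union> T) (\<lambda>v. if v \<in> T then c else \<phi> v)"
    unfolding proper_on_def
  proof (intro conjI ballI impI)
    let ?\<psi> = "\<lambda>v. if v \<in> T then c else \<phi> v"
    show "?\<psi> ` (S \<union> T) \<subseteq> {..<k}" using assms(1) c(1) by (auto simp: proper_on_def)
    fix v w assume vw: "v \<in> S \<union> T" "w \<in> S \<union> T" "adj v w"
    consider "v \<in> T" "w \<in> T" | "v \<in> T" "w \<in> S" "w \<notin> T" | "w \<in> T" "v \<in> S" "v \<notin> T"
      | "v \<in> S" "w \<in> S" "v \<notin> T" "w \<notin> T" using vw by blast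
    then show "?\<psi> v \<noteq> ?\<psi> w"
    proof cases
      case 1
      then show ?thesis using indep vw by blast
    next
      case 2
      then show ?thesis using ne[of w v] vw by auto
    next
      case 3
      then show ?thesis using ne'[of v w] vw by auto
    next
      case 4
      then show ?thesis using assms(1) vw by (auto simp: proper_on_def)
    qed
  qed
  then show ?thesis using that c by blast
qed

text \<open>The order of the layers supplies the two missing units. Vertices outside the cliques
  have two savings or two waiting neighbours; the bulk of each clique has \<open>f C\<close> and
  \<open>g C\<close> waiting; \<open>g C\<close> has one saving and \<open>f C\<close> waiting;
  \<open>f C\<close> comes last and needs two savings, or one saving and smaller degree.\<close>

lemma finish_cliques:
  assumes deg: "\<And>v. v \<in> V \<Longrightarrow> card (N v) \<le> D" and D: "2 \<le> D"
    and \<phi>: "proper_on adj (D - 1) S \<phi>" and SV: "S \<subseteq> V"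
    and cl: "\<And>C. C \<in> \<C> \<Longrightarrow> C \<subseteq> V \<and> complete_on adj C"
    and disj: "\<And>C C'. C \<in> \<C> \<Longrightarrow> C' \<in> \<C> \<Longrightarrow> C \<noteq> C' \<Longrightarrow> C \<inter> C' = {}"
    and out: "\<And>u. u \<in> V - S - \<Union>\<C> \<Longrightarrow> saves \<phi> S u 2 \<or> 2 \<le> card (N u \<inter> (\<Union>\<C> - S))"
    and two: "\<And>C. C \<in> \<C> \<Longrightarrow> \<exists>v v'. v \<in> C - S \<and> v' \<in> C - S \<and> v \<noteq> v' \<and> saves \<phi> S v' 1 \<and>
       (saves \<phi> S v 2 \<or> saves \<phi> S v 1 \<and> card (N v) < D)"
  shows "\<exists>\<phi>. proper_on adj (D - 1) V \<phi>"
proof -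
  obtain f g where fg: "\<And>C. C \<in> \<C> \<Longrightarrow> f C \<in> C - S \<and> g C \<in> C - S \<and> f C \<noteq> g C \<and> saves \<phi> S (g C) 1 \<and>
       (saves \<phi> S (f C) 2 \<or> saves \<phi> S (f C) 1 \<and> card (N (f C)) < D)"
  proof -
    let ?P = "\<lambda>C v v'. v \<in> C - S \<and> v' \<in> C - S \<and> v \<noteq> v' \<and> saves \<phi> S v' 1 \<and>
       (saves \<phi> S v 2 \<or> saves \<phi> S v 1 \<and> card (N v) < D)"
    have "\<forall>C\<in>\<C>. \<exists>v v'. ?P C v v'" using two by blast
    then obtain f where "\<forall>C\<in>\<C>. \<exists>v'. ?P C (f C) v'" using bchoice[of \<C> "\<lambda>C v. \<exists>v'. ?P C v v'"] by blast
    then obtain g where "\<forall>C\<in>\<C>. ?P C (f C) (g C)" using bchoice[of \<C> "\<lambda>C v'. ?P C (f C) v'"] by blast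
    then show thesis using that[of f g] by blast
  qed
  define L1 where "L1 = V - S - \<Union>\<C>"
  define L2 where "L2 = \<Union>\<C> - S - f ` \<C> - g ` \<C>"
  define L3 where "L3 = g ` \<C>"
  define L4 where "L4 = f ` \<C>"
  have sub: "L1 \<subseteq> V" "L2 \<subseteq> V" "L3 \<subseteq> V" "L4 \<subseteq> V"
    using cl fg by (auto simp: L1_def L2_def L3_def L4_def)
  have f_g: "f C \<noteq> g C'" if "C \<in> \<C>" "C' \<in> \<C>" for C C'
  proof (cases "C = C'")
    case True
    then show ?thesis using fg[OF that(1)] by auto
  next
    case False
    have "f C \<in> C" "g C' \<in> C'" using fg[OF that(1)] fg[OF that(2)] by simp_all
    then show ?thesis using disj[OF that False] by auto
  qed
  have adjC: "x \<in> N u" if "C \<in> \<C>" "u \<in> C" "x \<in> C" "x \<noteq> u" for C u x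
    using cl[OF that(1)] that by (auto simp: complete_on_def nb_def)
  have "\<exists>\<phi>'. proper_on adj (D - 1) (S \<union> L1) \<phi>' \<and> (\<forall>v\<in>S. \<phi>' v = \<phi> v)"
  proof (rule extend_layer_saves[OF \<phi> SV sub(1) _ D])
    fix u assume u: "u \<in> L1"
    have "N u - (S \<union> L1) = N u \<inter> (\<Union>\<C> - S)" using N_subset[of u] cl by (auto simp: L1_def)
    then show "\<exists>s. saves \<phi> S u s \<and> card (N u) + 2 \<le> D + s + card (N u - (S \<union> L1))"
      using out[of u] u deg[of u] saves_0 by (fastforce simp: L1_def)
  qed (auto simp: L1_def)
  then obtain \<phi>1 where \<phi>1: "proper_on adj (D - 1) (S \<union> L1) \<phi>1" "\<And>v. v \<in> S \<Longrightarrow> \<phi>1 v = \<phi> v" by blast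
  have "\<exists>\<phi>'. proper_on adj (D - 1) (S \<union> L1 \<union> L2) \<phi>' \<and> (\<forall>v\<in>S \<union> L1. \<phi>' v = \<phi>1 v)"
  proof (rule extend_layer_saves[OF \<phi>1(1) _ sub(2) _ D])
    fix u assume u: "u \<in> L2"
    then obtain C where C: "C \<in> \<C>" "u \<in> C" by (auto simp: L2_def)
    have "{f C, g C} \<subseteq> N u - (S \<union> L1 \<union> L2)"
      using fg[OF C(1)] adjC[OF C] u C by (auto simp: L1_def L2_def)
    then have "card {f C, g C} \<le> card (N u - (S \<union> L1 \<union> L2))" by (intro card_mono) auto
    then have "2 \<le> card (N u - (S \<union> L1 \<union> L2))" using fg[OF C(1)] by simp
    then show "\<exists>s. saves \<phi>1 (S \<union> L1) u s \<and> card (N u) + 2 \<le> D + s + card (N u - (S \<union> L1 \<union> L2))"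
      using saves_0 deg[of u] u sub by (intro exI[of _ 0]) (auto intro: add_mono)
  qed (use SV sub in \<open>auto simp: L1_def L2_def\<close>)
  then obtain \<phi>2 where \<phi>2: "proper_on adj (D - 1) (S \<union> L1 \<union> L2) \<phi>2" "\<And>v. v \<in> S \<union> L1 \<Longrightarrow> \<phi>2 v = \<phi>1 v"
    by blast
  have \<phi>2S: "\<phi>2 v = \<phi> v" if "v \<in> S" for v using that \<phi>1(2) \<phi>2(2) by simp
  have "\<exists>\<phi>'. proper_on adj (D - 1) (S \<union> L1 \<union> L2 \<union> L3) \<phi>' \<and> (\<forall>v\<in>S \<union> L1 \<union> L2. \<phi>' v = \<phi>2 v)"
  proof (rule extend_layer_saves[OF \<phi>2(1) _ sub(3) _ D])
    fix u assume u: "u \<in> L3"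
    then obtain C where C: "C \<in> \<C>" "u = g C" by (auto simp: L3_def)
    have "f C \<in> N u - (S \<union> L1 \<union> L2 \<union> L3)"
      using fg[OF C(1)] adjC[OF C(1), of u "f C"] C f_g by (auto simp: L1_def L2_def L3_def)
    then have "1 \<le> card (N u - (S \<union> L1 \<union> L2 \<union> L3))"
      by (metis One_nat_def Suc_leI card_gt_0_iff empty_iff finN finite_Diff)
    moreover have "saves \<phi>2 (S \<union> L1 \<union> L2) u 1"
      by (rule saves_mono_colouring[of \<phi> S]) (use fg[OF C(1)] C \<phi>2S in auto)
    ultimately show "\<exists>s. saves \<phi>2 (S \<union> L1 \<union> L2) u s \<and> card (N u) + 2 \<le> D + s + card (N u - (S \<union> L1 \<union> L2 \<union> L3))"
      using deg[of u] u sub by (intro exI[of _ 1]) auto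
  qed (use SV sub fg in \<open>auto simp: L1_def L2_def L3_def\<close>)
  then obtain \<phi>3 where \<phi>3: "proper_on adj (D - 1) (S \<union> L1 \<union> L2 \<union> L3) \<phi>3"
    "\<And>v. v \<in> S \<union> L1 \<union> L2 \<Longrightarrow> \<phi>3 v = \<phi>2 v" by blast
  have \<phi>3S: "\<phi>3 v = \<phi> v" if "v \<in> S" for v using that \<phi>2S \<phi>3(2) by simp
  have "\<exists>\<phi>'. proper_on adj (D - 1) (S \<union> L1 \<union> L2 \<union> L3 \<union> L4) \<phi>' \<and> (\<forall>v\<in>S \<union> L1 \<union> L2 \<union> L3. \<phi>' v = \<phi>3 v)"
  proof (rule extend_layer_saves[OF \<phi>3(1) _ sub(4) _ D])
    fix u assume u: "u \<in> L4"
    then obtain C where C: "C \<in> \<C>" "u = f C" by (auto simp: L4_def)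
    have *: "saves \<phi>3 (S \<union> L1 \<union> L2 \<union> L3) u s" if "saves \<phi> S u s" for s
      by (rule saves_mono_colouring[OF that]) (use \<phi>3S in auto)
    show "\<exists>s. saves \<phi>3 (S \<union> L1 \<union> L2 \<union> L3) u s \<and>
        card (N u) + 2 \<le> D + s + card (N u - (S \<union> L1 \<union> L2 \<union> L3 \<union> L4))"
      using fg[OF C(1)] C(2) * deg[of u] u sub(4) by fastforce
  qed (use SV sub fg f_g in \<open>auto simp: L1_def L2_def L3_def L4_def\<close>)
  moreover have "S \<union> L1 \<union> L2 \<union> L3 \<union> L4 = V"
    using SV sub by (auto simp: L1_def L2_def L3_def L4_def)
  ultimately show ?thesis by auto
qed

end

lemma proper_on_union:
  assumes "proper_on adj k A \<phi>" "proper_on adj k' B \<psi>" "A \<inter> B = {}"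
  shows "proper_on adj (k + k') (A \<union> B) (\<lambda>v. if v \<in> A then \<phi> v else k + \<psi> v)"
  unfolding proper_on_def
proof (intro conjI ballI impI)
  have A: "\<phi> v < k" if "v \<in> A" for v using assms(1) that by (auto simp: proper_on_def)
  have B: "\<psi> v < k'" if "v \<in> B" for v using assms(2) that by (auto simp: proper_on_def)
  show "(\<lambda>v. if v \<in> A then \<phi> v else k + \<psi> v) ` (A \<union> B) \<subseteq> {..<k + k'}"
    using A B by (auto intro: trans_less_add1)
  fix v w assume vw: "v \<in> A \<union> B" "w \<in> A \<union> B" "adj v w"
  consider "v \<in> A" "w \<in> A" | "v \<in> A" "w \<notin> A" | "v \<notin> A" "w \<in> A" | "v \<notin> A" "w \<notin> A" by blast
  then show "(if v \<in> A then \<phi> v else k + \<psi> v) \<noteq> (if w \<in> A then \<phi> w else k + \<psi> w)"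
  proof cases
    case 1
    then show ?thesis using assms(1) vw by (simp add: proper_on_def)
  next
    case 2
    then show ?thesis using A[of v] by simp
  next
    case 3
    then show ?thesis using A[of w] by simp
  next
    case 4
    then show ?thesis using assms(2) vw by (simp add: proper_on_def)
  qed
qed

lemma card_le_cover:
  assumes "A \<subseteq> B \<union> C" "finite B" "finite C" shows "card A \<le> card B + card C"
  by (meson assms card_Un_le card_mono finite_UnI order_trans)

lemma two_elements:
  assumes "2 \<le> card m" shows "\<exists>t t'. t \<in> m \<and> t' \<in> m \<and> t \<noteq> t'"
proof -
  obtain m' where "m' \<subseteq> m" "card m' = 2" using assms by (meson obtain_subset_with_card_n)
  then show ?thesis by (auto simp: card_2_iff)
qed

lemma proper_on_mono: "proper_on adj k A \<phi> \<Longrightarrow> k \<le> k' \<Longrightarrow> proper_on adj k' A \<phi>"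
  by (auto simp: proper_on_def)

section \<open>Disjoint families\<close>

text \<open>\<open>M\<close> is maximal under inclusion, so a set missing all its members could be
  added. An empty \<open>f t\<close> misses everything, hence the proviso.\<close>

lemma maximal_packing:
  assumes "finite T"
  shows "\<exists>M. M \<subseteq> T \<and> (\<forall>t\<in>M. \<forall>t'\<in>M. t \<noteq> t' \<longrightarrow> f t \<inter> f t' = {}) \<and>
    (\<forall>t\<in>T. f t \<noteq> {} \<longrightarrow> f t \<inter> \<Union>(f ` M) \<noteq> {})"
proof -
  define F where "F = {M. M \<subseteq> T \<and> (\<forall>t\<in>M. \<forall>t'\<in>M. t \<noteq> t' \<longrightarrow> f t \<inter> f t' = {})}"
  have fin: "finite F" by (rule finite_subset[of _ "Pow T"]) (use assms in \<open>auto simp: F_def\<close>)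
  have ne: "F \<noteq> {}" by (auto simp: F_def)
  obtain M where M: "M \<in> F" "\<forall>b\<in>F. M \<le> b \<longrightarrow> M = b"
    using finite_has_maximal[OF fin ne] by (elim bexE) (rule that)
  have "f t \<inter> \<Union>(f ` M) \<noteq> {}" if t: "t \<in> T" "f t \<noteq> {}" for t
  proof
    assume h: "f t \<inter> \<Union>(f ` M) = {}"
    then have d: "f t \<inter> f t' = {}" "f t' \<inter> f t = {}" if "t' \<in> M" for t' using that by blast+
    have dM: "f s \<inter> f s' = {}" if "s \<in> M" "s' \<in> M" "s \<noteq> s'" for s s' using M(1) that by (simp add: F_def)
    have "f s \<inter> f s' = {}" if "s \<in> insert t M" "s' \<in> insert t M" "s \<noteq> s'" for s s'
      using that d dM by (cases "s = t"; cases "s' = t") auto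
    moreover have "insert t M \<subseteq> T" using M(1) t(1) by (simp add: F_def)
    ultimately have "insert t M \<in> F" by (simp add: F_def)
    then have "M = insert t M" using M(2) by blast
    then have "t \<in> M" by blast
    then show False using h t(2) by blast
  qed
  then show ?thesis using M(1) by (intro exI[of _ M]) (simp add: F_def)
qed

fun block_set :: "'a \<times> 'a \<times> 'a \<Rightarrow> 'a set" where "block_set (v, y, y') = {v, y, y'}"

lemma block_set_eq: "block_set t = {fst t, fst (snd t), snd (snd t)}"
  by (cases t) auto

lemma card_disjoint_sets_hit:
  assumes "finite (\<Union>(g ` T))" "\<And>t t'. t \<in> T \<Longrightarrow> t' \<in> T \<Longrightarrow> t \<noteq> t' \<Longrightarrow> g t \<inter> g t' = {}"
  shows "card {t \<in> T. g t \<inter> F \<noteq> {}} \<le> card (F \<inter> \<Union>(g ` T))"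
proof -
  let ?H = "{t \<in> T. g t \<inter> F \<noteq> {}}"
  have "\<forall>t\<in>?H. \<exists>z. z \<in> g t \<inter> F" by auto
  then obtain f where f: "\<And>t. t \<in> ?H \<Longrightarrow> f t \<in> g t \<inter> F" by metis
  have "inj_on f ?H"
  proof (rule inj_onI, rule ccontr)
    fix t t' assume h: "t \<in> ?H" "t' \<in> ?H" "f t = f t'" "t \<noteq> t'"
    then have "f t \<in> g t \<inter> g t'" using f[OF h(1)] f[OF h(2)] by auto
    then show False using assms(2)[of t t'] h by auto
  qed
  moreover have "f ` ?H \<subseteq> F \<inter> \<Union>(g ` T)" using f by blast
  ultimately show ?thesis using assms(1) by (intro card_inj_on_le) auto
qed

section \<open>Numerical estimates\<close>

lemma exp_ge_power_five_halves: "(5/2::real) ^ k \<le> exp (real k)"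
proof -
  have "(5/2::real) \<le> exp 1" using exp_lower_Taylor_quadratic[of 1] by simp
  then have "(5/2::real) ^ k \<le> exp 1 ^ k" by (intro power_mono) auto
  then show ?thesis by (simp add: exp_of_nat_mult[symmetric])
qed

text \<open>The tangent of \<open>exp\<close> at \<open>k\<close>, with \<open>exp k\<close>
  replaced by a rational lower bound. It turns comparisons of D with an exponential into linear
  inequalities.\<close>

lemma exp_tangent: "(5/2::real) ^ k * (1 + x - real k) \<le> exp x" if "real k \<le> x"
proof -
  have "(5/2::real) ^ k * (1 + (x - real k)) \<le> exp (real k) * exp (x - real k)"
    using that by (intro mult_mono exp_ge_power_five_halves exp_ge_add_one_self) auto
  then show ?thesis by (simp add: exp_add[symmetric] algebra_simps)
qed

text \<open>This and \<open>exp_seven_tenths\<close> enclose the logarithm of 2 between 2/3 and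
  7/10. The exponent is cut into eight pieces of size 1/12, where the quadratic upper bound for
  \<open>exp\<close> is accurate enough.\<close>

lemma exp_two_thirds: "exp (2/3) \<le> (2::real)"
proof -
  have "exp (1/12::real) \<le> 1 + 1/12 + (1/12)\<^sup>2" by (rule exp_bound) auto
  then have "exp (1/12) ^ 8 \<le> (157/144::real) ^ 8" by (intro power_mono) (auto simp: power2_eq_square)
  also have "\<dots> \<le> 2" by (simp add: power_divide)
  finally show ?thesis by (simp add: exp_of_nat_mult[symmetric])
qed

lemma exp_seven_tenths: "(2::real) \<le> exp (7/10)"
proof -
  have "(1105/1000::real) \<le> exp (1/10)" using exp_lower_Taylor_quadratic[of "1/10"] by (simp add: power2_eq_square)
  then have "(1105/1000::real) ^ 7 \<le> exp (1/10) ^ 7" by (intro power_mono) auto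
  moreover have "2 \<le> (1105/1000::real) ^ 7" by (simp add: power_divide)
  ultimately show ?thesis by (simp add: exp_of_nat_mult[symmetric])
qed

section \<open>Estimates above the degree threshold\<close>

context
  fixes D :: nat
  assumes D: "7400000000 \<le> D"
begin

lemma Dreal: "7400000000 \<le> real D" using D by linarith

text \<open>It absorbs the factor \<open>real K\<close> of the failure bound at the price of
  \<open>D / 100000000\<close> in the exponent.\<close>

lemma le_exp: "real D \<le> exp (real D / 100000000)"
proof -
  let ?t = "real D / 100000000"
  have t: "74 \<le> ?t" using Dreal by simp
  have "real D = 100000000 * ?t" by simp
  also have "\<dots> \<le> (5/2) ^ 37 * (1 + ?t - real 37)" using t by (simp add: power_divide)
  also have "\<dots> \<le> exp ?t" by (rule exp_tangent) (use t in simp)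
  finally show ?thesis .
qed

text \<open>The condition 4 p d \<le> 1 of the local lemma for d = 4 (D + 1)^6. Since 16 \<le> 2^6,
  taking sixth roots reduces it to 2 (D + 1) \<le> exp (D / 240000000).\<close>

lemma local_lemma_bound: "16 * exp (- real D / 40000000) * real ((D + 1) ^ 6) \<le> 1"
proof -
  let ?r = "real D / 240000000"
  have r: "30.8 \<le> ?r" using Dreal by simp
  have "2 * (real D + 1) \<le> 500000000 * ?r" using r by simp
  also have "\<dots> \<le> (5/2) ^ 30 * (1 + ?r - real 30)" using r by (simp add: power_divide)
  also have "\<dots> \<le> exp ?r" by (rule exp_tangent) (use r in simp)
  finally have "(2 * (real D + 1)) ^ 6 \<le> exp ?r ^ 6" by (intro power_mono) auto
  then have "64 * (real D + 1) ^ 6 \<le> exp ?r ^ 6" by (simp only: power_mult_distrib) simp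
  also have "exp ?r ^ 6 = exp (real D / 40000000)" by (simp add: exp_of_nat_mult[symmetric])
  finally have "64 * (real D + 1) ^ 6 \<le> exp (real D / 40000000)" .
  moreover have "0 \<le> (real D + 1) ^ 6" by simp
  ultimately have "16 * (real D + 1) ^ 6 \<le> exp (real D / 40000000)" by linarith
  then have "16 * (real D + 1) ^ 6 * exp (- real D / 40000000) \<le> exp (real D / 40000000) * exp (- real D / 40000000)"
    by (intro mult_right_mono) auto
  also have "\<dots> = 1" by (simp add: exp_add[symmetric])
  finally show ?thesis by (simp add: mult_ac add.commute)
qed

lemma cap_bound:
  fixes c d e :: real
  assumes "c + d \<le> 2/3 * e" "0 \<le> e"
  shows "2 powr (- e) * exp c \<le> exp (- d)"
proof -
  have "2/3 \<le> ln (2::real)" by (subst ln_ge_iff) (use exp_two_thirds in auto)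
  then have "2/3 * e \<le> ln 2 * e" using assms(2) by (rule mult_right_mono)
  then have "- (e * ln 2) + c \<le> - d" using assms(1) by (simp add: mult.commute)
  then show ?thesis by (simp add: powr_def exp_add[symmetric])
qed

text \<open>The factor \<open>2 ^ G\<close> costs \<open>7/10 * G\<close> in the exponent because 2
  \<le> exp (7/10). The rate 49/100 is 1 - 51/100. The summand 1 in both hypotheses pays for adding
  two terms, as 2 \<le> exp 1.\<close>

lemma fail_bound:
  assumes p: "0 \<le> p" "p \<le> 1" and K: "real K \<le> real D"
    and 1: "7/10 * real G + d + 1 \<le> p / 4 * real K"
    and 2: "7/10 * real G + d + 1 + real D / 100000000 \<le> 49/100 * real L"
  shows "2 ^ G * ((1 - p / 4) ^ K + real K * (51/100) ^ L) \<le> exp (- d)"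
proof -
  have "(2::real) ^ G \<le> exp (7/10 * real G)"
  proof -
    have "(2::real) ^ G \<le> exp (7/10) ^ G" by (intro power_mono exp_seven_tenths) auto
    then show ?thesis by (simp add: exp_of_nat_mult[symmetric] mult.commute)
  qed
  moreover have "(1 - p / 4) ^ K + real K * (51/100) ^ L \<le> 2 * exp (- (7/10 * real G + d + 1))"
  proof -
    have "(1 - p / 4) ^ K \<le> exp (- (p / 4)) ^ K"
      using p exp_ge_add_one_self[of "- (p / 4)"] by (intro power_mono) auto
    also have "\<dots> = exp (- (p / 4 * real K))" by (simp add: exp_of_nat_mult[symmetric] mult_ac)
    also have "\<dots> \<le> exp (- (7/10 * real G + d + 1))" using 1 by simp
    finally have a: "(1 - p / 4) ^ K \<le> exp (- (7/10 * real G + d + 1))" .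
    have "(51/100::real) ^ L \<le> exp (- (49/100)) ^ L"
      using exp_ge_add_one_self[of "- (49/100)"] by (intro power_mono) auto
    also have "\<dots> = exp (- (49/100 * real L))" by (simp add: exp_of_nat_mult[symmetric] mult_ac)
    finally have "real K * (51/100) ^ L \<le> exp (real D / 100000000) * exp (- (49/100 * real L))"
      using K le_exp by (intro mult_mono) auto
    also have "\<dots> \<le> exp (- (7/10 * real G + d + 1))" using 2 by (simp add: exp_add[symmetric])
    finally show ?thesis using a by simp
  qed
  ultimately have "2 ^ G * ((1 - p / 4) ^ K + real K * (51/100) ^ L)
      \<le> exp (7/10 * real G) * (2 * exp (- (7/10 * real G + d + 1)))"
    using p by (intro mult_mono add_nonneg_nonneg) auto
  also have "\<dots> = 2 * exp (- d - 1)" by (simp add: exp_add[symmetric])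
  also have "\<dots> = 2 / exp 1 * exp (- d)" by (simp add: exp_diff)
  also have "\<dots> \<le> 1 * exp (- d)"
    using exp_ge_add_one_self[of 1] by (intro mult_right_mono) auto
  finally show ?thesis by simp
qed

text \<open>The left side is at most exp (p / 5). The gap between p / 5 and p / 4 leaves room for
  the quadratic term, which is at most p / 25.\<close>

lemma growth_bound:
  assumes "0 \<le> p" "p \<le> 1" "real L \<le> p / 5 * real D"
  shows "(1 + 1 / (2 * real D)) ^ (2 * L) \<le> 1 + p / 4"
proof -
  have D0: "0 < real D" using Dreal by simp
  have "(1 + 1 / (2 * real D)) ^ (2 * L) \<le> exp (1 / (2 * real D)) ^ (2 * L)"
    by (intro power_mono exp_ge_add_one_self) auto
  also have "\<dots> = exp (real L / real D)" by (simp add: exp_of_nat_mult[symmetric])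
  also have "\<dots> \<le> exp (p / 5)" using assms(3) D0 by (simp add: field_simps)
  also have "\<dots> \<le> 1 + p / 5 + (p / 5)\<^sup>2" using assms by (intro exp_bound) auto
  also have "\<dots> \<le> 1 + p / 4"
    using mult_left_mono[OF assms(2,1)] assms by (simp add: power2_eq_square field_simps)
  finally show ?thesis .
qed

lemma theta_bound: "(1 + 1 / (2 * real D))\<^sup>2 / 2 \<le> 51/100"
proof -
  have "1 / (2 * real D) \<le> 1/1000" using Dreal by (simp add: field_simps)
  then have "(1 + 1 / (2 * real D))\<^sup>2 \<le> (1 + 1/1000)\<^sup>2" by (intro power_mono) auto
  then show ?thesis by (simp add: power2_eq_square)
qed

text \<open>The right side is the probability that \<open>m\<close> given vertices avoid a colour
  class. Bernoulli's inequality says nothing for \<open>m\<close> \<ge> 2 D, so larger exponents are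
  cut into pieces below.\<close>

lemma survive_linear: "1 - real m / (2 * real D) \<le> (1 - 1 / (2 * real D)) ^ m"
  using Bernoulli_inequality[of "- (1 / (2 * real D))" m] Dreal by simp

lemma survive_half: "3/4 \<le> (1 - 1 / (2 * real D)) ^ (D div 2)"
proof -
  have "real (D div 2) \<le> real D / 2" by linarith
  then have "real (D div 2) / (2 * real D) \<le> 1/4" using Dreal by (simp add: field_simps)
  then show ?thesis using survive_linear[of "D div 2"] by linarith
qed

lemma survive_clique: "237/1000 \<le> (1 - 1 / (2 * real D)) ^ (5 * (D div 2))"
proof -
  have "(3/4::real) ^ 5 \<le> ((1 - 1 / (2 * real D)) ^ (D div 2)) ^ 5"
    by (intro power_mono survive_half) auto
  moreover have "(237/1000::real) \<le> (3/4) ^ 5" by (simp add: power_divide)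
  ultimately have "237/1000 \<le> ((1 - 1 / (2 * real D)) ^ (D div 2)) ^ 5" by linarith
  then show ?thesis by (simp only: power_mult[symmetric] mult.commute)
qed

lemma survive_sparse: "1/8 \<le> (1 - 1 / (2 * real D)) ^ (3 * D)"
proof -
  have "1/2 \<le> (1 - 1 / (2 * real D)) ^ D" using survive_linear[of D] Dreal by (simp add: field_simps)
  then have "(1/2::real) ^ 3 \<le> ((1 - 1 / (2 * real D)) ^ D) ^ 3" by (intro power_mono) auto
  then have "1/8 \<le> ((1 - 1 / (2 * real D)) ^ D) ^ 3" by (simp add: power_divide)
  then show ?thesis by (simp only: power_mult[symmetric] mult.commute)
qed

text \<open>As the squared density is 1 / (4 D^2), a supply of \<open>\<nu>\<close> D^2 pairs gives
  each colour class a success probability of about \<open>\<nu> / 4\<close> times the survival bound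
  \<open>s\<close>. The correction 1 / 10^12 swallows the rounding loss \<open>- 1\<close>.\<close>

lemma hit_bound:
  assumes N: "\<nu> * (real D)\<^sup>2 - 1 \<le> real N" and s: "0 \<le> s" "s \<le> (1 - 1 / (2 * real D)) ^ n"
    and p: "p \<le> (\<nu> - 1/1000000000000) / 4 * s"
  shows "p \<le> real N * (1 / (2 * real D))\<^sup>2 * (1 - 1 / (2 * real D)) ^ n"
proof -
  have D0: "0 < real D" using Dreal by simp
  have "(1000000::real)\<^sup>2 \<le> (real D)\<^sup>2" using Dreal by (intro power_mono) auto
  then have "1 \<le> (real D)\<^sup>2 * (1/1000000000000)" by simp
  then have "(\<nu> - 1/1000000000000) * (real D)\<^sup>2 \<le> real N" using N by (simp add: algebra_simps)
  then have "(\<nu> - 1/1000000000000) / 4 \<le> real N * (1 / (2 * real D))\<^sup>2"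
    using D0 by (simp add: field_simps power2_eq_square)
  then have "(\<nu> - 1/1000000000000) / 4 * s \<le> real N * (1 / (2 * real D))\<^sup>2 * s"
    using s(1) by (rule mult_right_mono)
  also have "\<dots> \<le> real N * (1 / (2 * real D))\<^sup>2 * (1 - 1 / (2 * real D)) ^ n"
    using s(2) by (intro mult_left_mono) auto
  finally show ?thesis using p by simp
qed

end

section \<open>Cliques in a minimal counterexample\<close>

text \<open>\<open>minimal\<close> speaks about arbitrary symmetric relations on a proper subset,
  not only about induced subgraphs. This permits adding an edge after deleting vertices, provided
  that degrees stay at most \<open>D\<close> and no clique on \<open>D\<close> vertices
  arises.\<close>

locale minimal_counterexample = finite_graph V adj for V :: "'a set" and adj +
  fixes D :: nat
  assumes degD: "\<And>v. v \<in> V \<Longrightarrow> card (N v) \<le> D" and D: "7400000000 \<le> D"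
    and no_D_clique: "\<And>K. K \<subseteq> V \<Longrightarrow> complete_on adj K \<Longrightarrow> card K \<noteq> D"
    and not_colourable: "\<nexists>\<phi>. proper_on adj (D - 1) V \<phi>"
    and minimal: "\<And>V' adj'. V' \<subset> V \<Longrightarrow> (\<And>u v. adj' u v \<Longrightarrow> adj' v u) \<Longrightarrow> (\<And>u. \<not> adj' u u) \<Longrightarrow>
      (\<And>v. v \<in> V' \<Longrightarrow> card (nb V' adj' v) \<le> D) \<Longrightarrow>
      (\<And>K. K \<subseteq> V' \<Longrightarrow> complete_on adj' K \<Longrightarrow> card K \<noteq> D) \<Longrightarrow> \<exists>\<phi>. proper_on adj' (D - 1) V' \<phi>"
begin

lemma sub_colouring:
  assumes "V' \<subset> V"
  obtains \<phi> where "proper_on adj (D - 1) V' \<phi>"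
proof -
  have "\<exists>\<phi>. proper_on adj (D - 1) V' \<phi>"
  proof (rule minimal[OF assms sym irr])
    fix v assume "v \<in> V'"
    have "card (nb V' adj v) \<le> card (N v)" using assms by (intro card_mono finN) (auto simp: nb_def)
    then show "card (nb V' adj v) \<le> D" using degD[of v] \<open>v \<in> V'\<close> assms by fastforce
  qed (use assms no_D_clique in auto)
  then show thesis using that by blast
qed

lemma degree_ge: "v \<in> V \<Longrightarrow> D - 1 \<le> card (N v)"
proof (rule ccontr)
  assume v: "v \<in> V" "\<not> D - 1 \<le> card (N v)"
  obtain \<phi> where \<phi>: "proper_on adj (D - 1) (V - {v}) \<phi>" using sub_colouring[of "V - {v}"] v by blast
  have "\<exists>\<phi>'. proper_on adj (D - 1) (V - {v} \<union> {v}) \<phi>' \<and> (\<forall>w\<in>V - {v}. \<phi>' w = \<phi> w)"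
  proof (rule extend_layer[OF \<phi>])
    fix u assume "u \<in> {v}"
    then have u: "u = v" by simp
    have "N v \<inter> {v} = {}" using irr by (auto simp: nb_def)
    moreover have "card (\<phi> ` (N v \<inter> (V - {v}))) \<le> card (N v)"
      by (meson card_image_le card_mono finN finite_Int inf_le1 order_trans)
    ultimately show "card (\<phi> ` (N u \<inter> (V - {v}))) + card (N u \<inter> {v}) < D - 1" using v u by simp
  qed (use v in auto)
  moreover have "V - {v} \<union> {v} = V" using v by auto
  ultimately show False using not_colourable by metis
qed

lemma clique_card:
  assumes "K \<subseteq> V" "complete_on adj K" shows "card K \<le> D - 1"
proof (rule ccontr)
  assume "\<not> ?thesis"
  then have "D \<le> card K" by simp
  then obtain K' where "K' \<subseteq> K" "card K' = D" by (meson obtain_subset_with_card_n)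
  then show False using no_D_clique[of K'] assms complete_on_subset by blast
qed

lemma card_N_diff_clique:
  assumes "C \<subseteq> V" "complete_on adj C" "v \<in> C"
  shows "card (N v - C) + card C = card (N v) + 1"
proof -
  have "N v \<inter> C = C - {v}" using assms irr by (auto simp: nb_def complete_on_def)
  moreover have "card (N v) = card (N v \<inter> C) + card (N v - C)"
    using card_Un_disjoint[of "N v \<inter> C" "N v - C"] by (simp add: Int_Diff_Un Int_Diff_disjoint)
  moreover have "card C > 0" using assms fin_subset by (auto simp: card_gt_0_iff)
  ultimately show ?thesis using assms(3) by simp
qed

section \<open>Dense neighbourhoods\<close>

lemma card_N_split: "card (N v) = card (N v \<inter> C) + card (N v - C)"
  using card_Un_disjoint[of "N v \<inter> C" "N v - C"] by (simp add: Int_Diff_Un Int_Diff_disjoint)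

text \<open>Otherwise colour the rest by minimality, then each of the two nonedges with a single colour, and finish \<open>Q\<close>
  greedily; common neighbours of the four vertices come last.\<close>

lemma no_two_nonedges:
  assumes Q: "Q \<subseteq> V" "93 * D \<le> 100 * card Q" "\<And>u. u \<in> Q \<Longrightarrow> 100 * card (Q - N u) \<le> 15 * D"
    and P: "x1 \<in> Q" "y1 \<in> Q" "x2 \<in> Q" "y2 \<in> Q" "x1 \<noteq> y1" "x2 \<noteq> y2" "x1 \<noteq> x2" "x1 \<noteq> y2" "y1 \<noteq> x2" "y1 \<noteq> y2"
    and nonadj: "\<not> adj x1 y1" "\<not> adj x2 y2"
  shows False
proof -
  have finQ: "finite Q" using Q fin_subset by auto
  have nonadj': "\<not> adj y1 x1" "\<not> adj y2 x2" using nonadj sym by blast+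
  \<comment> \<open>At least (93 - 15)% of D neighbours of \<open>u\<close> lie in \<open>Q\<close>,
    which leaves 22% outside; two such outside sets cannot exhaust the colours.\<close>
  have out: "100 * card (N u - Q) \<le> 22 * D" if "u \<in> Q" for u
  proof -
    have "card Q = card (Q \<inter> N u) + card (Q - N u)"
      using card_Un_disjoint[of "Q \<inter> N u" "Q - N u"] finQ by (simp add: Int_Diff_Un Int_Diff_disjoint)
    then show ?thesis
      using card_N_split[of u Q] degD[of u] Q(2) Q(3)[OF that] that Q(1) by (auto simp: Int_commute)
  qed
  obtain \<phi> where \<phi>: "proper_on adj (D - 1) (V - Q) \<phi>" using sub_colouring[of "V - Q"] Q(1) P(1) by blast
  have NQ: "N u \<inter> (V - Q) = N u - Q" for u using N_subset by auto
  have "card (\<Union>t\<in>{x1, y1}. N t \<inter> (V - Q)) \<le> card (N x1 - Q) + card (N y1 - Q)"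
    by (simp add: NQ card_Un_le)
  then have c1: "card (\<Union>t\<in>{x1, y1}. N t \<inter> (V - Q)) < D - 1" using out[OF P(1)] out[OF P(2)] D by linarith
  obtain a where a: "proper_on adj (D - 1) (V - Q \<union> {x1, y1}) (\<lambda>v. if v \<in> {x1, y1} then a else \<phi> v)"
    by (rule add_colour_class[OF \<phi> _ _ _ _ c1]) (use P irr nonadj nonadj' in auto)
  let ?S1 = "V - Q \<union> {x1, y1}" and ?\<phi>1 = "\<lambda>v. if v \<in> {x1, y1} then a else \<phi> v"
  have "(\<Union>t\<in>{x2, y2}. N t \<inter> ?S1) \<subseteq> (N x2 - Q) \<union> (N y2 - Q) \<union> {x1, y1}" by auto
  then have "card (\<Union>t\<in>{x2, y2}. N t \<inter> ?S1) \<le> card ((N x2 - Q) \<union> (N y2 - Q) \<union> {x1, y1})"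
    by (intro card_mono) auto
  also have "\<dots> \<le> card (N x2 - Q) + card (N y2 - Q) + card {x1, y1}"
    by (meson card_Un_le add_right_mono order_trans)
  finally have c2: "card (\<Union>t\<in>{x2, y2}. N t \<inter> ?S1) < D - 1"
    using out[OF P(3)] out[OF P(4)] D P(5) by simp
  obtain b where b: "proper_on adj (D - 1) (?S1 \<union> {x2, y2}) (\<lambda>v. if v \<in> {x2, y2} then b else ?\<phi>1 v)"
    by (rule add_colour_class[OF a _ _ _ _ c2]) (use P Q irr nonadj nonadj' in auto)
  let ?S2 = "?S1 \<union> {x2, y2}" and ?\<phi>2 = "\<lambda>v. if v \<in> {x2, y2} then b else ?\<phi>1 v"
  define P where "P = {x1, y1, x2, y2}"
  \<comment> \<open>The vertices of \<open>K\<close> see both repetitions and may come last. At most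
    4 times 15% of D are missing from \<open>K\<close>, so at least 33% remain. Any other vertex of
    \<open>Q\<close> misses at most 15% of D in \<open>Q\<close> and therefore has waiting
    neighbours in \<open>K\<close>.\<close>
  define K where "K = {u \<in> Q - P. P \<subseteq> N u}"
  have PQ: "P \<subseteq> Q" using P by (simp add: P_def)
  have S2: "?S2 = V - Q \<union> P" by (auto simp: P_def)
  have "Q - K \<subseteq> (Q - N x1) \<union> (Q - N y1) \<union> (Q - N x2) \<union> (Q - N y2)"
    using PQ Q(1) irr sym by (auto simp: K_def P_def nb_def)
  then have "card (Q - K) \<le> card ((Q - N x1) \<union> (Q - N y1) \<union> (Q - N x2) \<union> (Q - N y2))"
    using finQ by (intro card_mono) auto
  also have "\<dots> \<le> card (Q - N x1) + card (Q - N y1) + card (Q - N x2) + card (Q - N y2)"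
    by (meson card_Un_le add_right_mono order_trans)
  finally have QK: "100 * card (Q - K) \<le> 60 * D"
    using Q(3)[OF P(1)] Q(3)[OF P(2)] Q(3)[OF P(3)] Q(3)[OF P(4)] by linarith
  have KQ: "K \<subseteq> Q" "finite K" using finQ by (auto simp: K_def)
  have "card (Q - K) = card Q - card K" using KQ finQ by (intro card_Diff_subset) auto
  then have cK: "33 * D \<le> 100 * card K" using QK Q(2) by linarith
  let ?L = "Q - P - K"
  have "\<exists>\<phi>'. proper_on adj (D - 1) (?S2 \<union> ?L) \<phi>' \<and> (\<forall>v\<in>?S2. \<phi>' v = ?\<phi>2 v)"
  proof (rule extend_layer_saves[OF b])
    fix u assume u: "u \<in> ?L"
    have "K \<subseteq> (N u - (?S2 \<union> ?L)) \<union> (Q - N u)" using KQ unfolding S2 by (auto simp: K_def)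
    then have "card K \<le> card ((N u - (?S2 \<union> ?L)) \<union> (Q - N u))" using finQ by (intro card_mono) auto
    also have "\<dots> \<le> card (N u - (?S2 \<union> ?L)) + card (Q - N u)" by (rule card_Un_le)
    finally have "2 \<le> card (N u - (?S2 \<union> ?L))" using cK Q(3)[of u] u D by auto
    then show "\<exists>s. saves ?\<phi>2 ?S2 u s \<and> card (N u) + 2 \<le> D + s + card (N u - (?S2 \<union> ?L))"
      using saves_0 degD[of u] u Q(1) by (intro exI[of _ 0]) auto
  qed (use Q PQ D in \<open>auto simp: P_def\<close>)
  then obtain \<phi>3 where \<phi>3: "proper_on adj (D - 1) (?S2 \<union> ?L) \<phi>3" "\<forall>v\<in>?S2. \<phi>3 v = ?\<phi>2 v" by blast
  have "\<exists>\<phi>'. proper_on adj (D - 1) (?S2 \<union> ?L \<union> K) \<phi>' \<and> (\<forall>v\<in>?S2 \<union> ?L. \<phi>' v = \<phi>3 v)"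
  proof (rule extend_layer_saves[OF \<phi>3(1)])
    fix u assume u: "u \<in> K"
    have PN: "P \<subseteq> N u" using u by (simp add: K_def)
    have "saves ?\<phi>2 ?S2 u 2"
    proof (rule saves_I[where T = "{y1, y2}"])
      show "{y1, y2} \<subseteq> N u \<inter> ?S2" using PN unfolding S2 by (auto simp: P_def)
      have "x1 \<in> N u \<inter> ?S2 - {y1, y2}" "x2 \<in> N u \<inter> ?S2 - {y1, y2}"
        using PN P unfolding S2 by (auto simp: P_def)
      moreover have "?\<phi>2 x1 = ?\<phi>2 y1" "?\<phi>2 x2 = ?\<phi>2 y2" using P by auto
      ultimately show "\<exists>x\<in>N u \<inter> ?S2 - {y1, y2}. ?\<phi>2 x = ?\<phi>2 t" if "t \<in> {y1, y2}" for t
        using that by blast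
    qed (use P in auto)
    then have "saves \<phi>3 (?S2 \<union> ?L) u 2" by (rule saves_mono_colouring) (use \<phi>3(2) in auto)
    then show "\<exists>s. saves \<phi>3 (?S2 \<union> ?L) u s \<and> card (N u) + 2 \<le> D + s + card (N u - (?S2 \<union> ?L \<union> K))"
      using degD[of u] u KQ Q(1) by (intro exI[of _ 2]) auto
  qed (use Q PQ D KQ in \<open>auto simp: P_def K_def\<close>)
  moreover have "?S2 \<union> ?L \<union> K = V" using Q(1) PQ KQ unfolding S2 by auto
  ultimately show False using not_colourable by metis
qed

text \<open>\<open>Q\<close> discards the neighbours of \<open>v\<close> with too many nonneighbours
  inside \<open>N v\<close>. Each of these accounts for nearly 15% of D nonadjacent pairs, so there
  are at most about D / 15 of them. By \<open>no_two_nonedges\<close>, \<open>Q\<close> has no two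
  disjoint nonedges; removing the ends of one leaves a clique, which \<open>v\<close>
  extends.\<close>

lemma clique_of_dense:
  assumes v: "v \<in> V" "100 * card {(x, y). x \<in> N v \<and> y \<in> N v \<and> x \<noteq> y \<and> \<not> adj x y} < D * D"
  shows "\<exists>C\<subseteq>V. v \<in> C \<and> complete_on adj C \<and> 93 * D \<le> 100 * card C"
proof -
  define Q where "Q = {x \<in> N v. 100 * card (N v - N x) \<le> 15 * D}"
  define B where "B = N v - Q"
  let ?P = "{(x, y). x \<in> N v \<and> y \<in> N v \<and> x \<noteq> y \<and> \<not> adj x y}"
  have fin: "finite B" "finite Q" by (auto simp: B_def Q_def)
  have "Sigma B (\<lambda>x. N v - N x - {x}) \<subseteq> ?P" using N_subset by (auto simp: B_def nb_def)
  moreover have "finite ?P" by (rule finite_subset[of _ "N v \<times> N v"]) auto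
  ultimately have "card (Sigma B (\<lambda>x. N v - N x - {x})) \<le> card ?P" by (intro card_mono)
  moreover have "card (Sigma B (\<lambda>x. N v - N x - {x})) = (\<Sum>x\<in>B. card (N v - N x - {x}))"
    using fin by (intro card_SigmaI) auto
  \<comment> \<open>Not counting \<open>x\<close> as its own nonneighbour costs 100, of which the
    strict inequality defining \<open>B\<close> gives back 1.\<close>
  moreover have "(\<Sum>x\<in>B. 15 * D - 99) \<le> (\<Sum>x\<in>B. 100 * card (N v - N x - {x}))"
  proof (rule sum_mono)
    fix x assume x: "x \<in> B"
    have "card (N v - N x) \<le> Suc (card (N v - N x - {x}))"
      by (metis card_Suc_Diff1 card_insert_le_m1 Diff_empty Diff_insert0 finN finite_Diff le_Suc_eq order_refl)
    moreover have "15 * D < 100 * card (N v - N x)" using x by (auto simp: B_def Q_def)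
    ultimately show "15 * D - 99 \<le> 100 * card (N v - N x - {x})" by linarith
  qed
  ultimately have "card B * (15 * D - 99) \<le> 100 * card ?P"
    by (simp add: sum_distrib_left[symmetric])
  then have lt: "card B * (15 * D - 99) < D * D" using v(2) by linarith
  \<comment> \<open>67/1000 is just above 1/15: the contradiction rests on 67 * 15 = 1005 exceeding
    1000.\<close>
  have cB: "1000 * card B \<le> 67 * D"
  proof (rule ccontr)
    assume "\<not> ?thesis"
    then have "67 * D * (15 * D - 99) \<le> 1000 * card B * (15 * D - 99)" by (intro mult_right_mono) auto
    also have "\<dots> < 1000 * (D * D)" using lt by (simp add: mult.assoc)
    finally have "67 * (15 * D - 99) < 1000 * D" using D by (simp add: mult.assoc[symmetric] mult.commute)
    then show False using D by linarith
  qed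
  have "card (N v) = card Q + card B"
    using card_N_split[of v Q] by (simp add: B_def Int_absorb1 Q_def Int_def)
  then have cQ: "1000 * card Q + 1000 \<ge> 933 * D" using cB degree_ge[OF v(1)] D by linarith
  have QV: "Q \<subseteq> V" "v \<notin> Q" using irr by (auto simp: Q_def nb_def)
  have cl: "complete_on adj (insert v Q')" if "complete_on adj Q'" "Q' \<subseteq> Q" for Q'
    using that sym unfolding complete_on_def by (auto simp: Q_def nb_def)
  have clique: "\<exists>C\<subseteq>V. v \<in> C \<and> complete_on adj C \<and> 93 * D \<le> 100 * card C"
    if Q': "complete_on adj Q'" "Q' \<subseteq> Q" "card Q \<le> card Q' + 2" for Q'
  proof (intro exI[of _ "insert v Q'"] conjI)
    have "card (insert v Q') = Suc (card Q')" using Q' QV fin finite_subset by (metis card_insert_disjoint subsetD)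
    then show "93 * D \<le> 100 * card (insert v Q')" using cQ Q'(3) D by linarith
  qed (use cl Q' QV v in auto)
  show ?thesis
  proof (cases "complete_on adj Q")
    case True
    then show ?thesis using clique[of Q] by simp
  next
    case False
    then obtain x y where xy: "x \<in> Q" "y \<in> Q" "x \<noteq> y" "\<not> adj x y" by (auto simp: complete_on_def)
    have "complete_on adj (Q - {x, y})"
      unfolding complete_on_def
    proof (intro ballI impI, rule ccontr)
      fix x' y' assume h: "x' \<in> Q - {x, y}" "y' \<in> Q - {x, y}" "x' \<noteq> y'" "\<not> adj x' y'"
      have bd: "100 * card (Q - N u) \<le> 15 * D" if "u \<in> Q" for u
      proof -
        have "card (Q - N u) \<le> card (N v - N u)" by (intro card_mono) (auto simp: Q_def)
        then show ?thesis using that by (auto simp: Q_def)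
      qed
      have "93 * D \<le> 100 * card Q" using cQ D by linarith
      then show False using no_two_nonedges[OF QV(1) _ bd, of x y x' y'] xy h by auto
    qed
    moreover have "card Q \<le> card (Q - {x, y}) + 2"
      using card_Diff_subset[of "{x, y}" Q] xy by simp
    ultimately show ?thesis using clique[of "Q - {x, y}"] by auto
  qed
qed

section \<open>An optimal family of disjoint large cliques\<close>

definition large_clique :: "'a set \<Rightarrow> bool" where
  "large_clique C \<longleftrightarrow> C \<subseteq> V \<and> complete_on adj C \<and> 93 * D \<le> 100 * card C"

definition clique_family :: "'a set set \<Rightarrow> bool" where
  "clique_family \<C> \<longleftrightarrow> (\<forall>C\<in>\<C>. large_clique C) \<and> (\<forall>C\<in>\<C>. \<forall>C'\<in>\<C>. C \<noteq> C' \<longrightarrow> C \<inter> C' = {})"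

text \<open>Maximising the union instead of the number of cliques rules out both adding a disjoint
  large clique and exchanging a member for a larger one.\<close>

definition optimal :: "'a set set \<Rightarrow> bool" where
  "optimal \<C> \<longleftrightarrow> clique_family \<C> \<and> (\<forall>\<C>'. clique_family \<C>' \<longrightarrow> card (\<Union>\<C>') \<le> card (\<Union>\<C>))"

lemma clique_family_Union: "clique_family \<C> \<Longrightarrow> \<Union>\<C> \<subseteq> V"
  by (auto simp: clique_family_def large_clique_def)

lemma optimal_exists: "\<exists>\<C>. optimal \<C>"
proof -
  have "\<exists>\<C>. clique_family \<C> \<and> (\<forall>\<C>'. clique_family \<C>' \<longrightarrow> card (\<Union>\<C>') \<le> card (\<Union>\<C>))"
  proof (rule ex_has_greatest_nat[where b = "Suc (card V)" and k = "{}"])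
    show "clique_family {}" by (simp add: clique_family_def)
    show "\<forall>\<C>. clique_family \<C> \<longrightarrow> card (\<Union>\<C>) < Suc (card V)"
      using clique_family_Union finV by (simp add: less_Suc_eq_le card_mono)
  qed
  then show ?thesis by (simp add: optimal_def)
qed

lemma large_clique_meets_optimal:
  assumes "optimal \<C>" "large_clique C" shows "\<exists>C'\<in>\<C>. C \<inter> C' \<noteq> {}"
proof (rule ccontr)
  assume h: "\<not> ?thesis"
  then have disj: "C \<inter> \<Union>\<C> = {}" by auto
  have clique_family: "clique_family (insert C \<C>)" using assms h unfolding optimal_def clique_family_def by auto
  have "card C > 0" using assms(2) D by (auto simp: large_clique_def)
  moreover have "card (\<Union>(insert C \<C>)) = card C + card (\<Union>\<C>)"
    using disj clique_family_Union[OF clique_family] fin_subset by (simp add: card_Un_disjoint)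
  ultimately show False using assms(1) clique_family unfolding optimal_def by fastforce
qed

lemma no_improving_swap:
  assumes "optimal \<C>" "C \<in> \<C>" "large_clique C'" "card C < card C'" "C' \<inter> \<Union>(\<C> - {C}) = {}"
  shows False
proof -
  let ?R = "\<Union>(\<C> - {C})"
  have clique_family: "clique_family \<C>" using assms by (simp add: optimal_def)
  have fam': "clique_family (insert C' (\<C> - {C}))" using assms clique_family unfolding clique_family_def by auto
  have fin: "finite ?R" "finite C" "finite C'"
    using clique_family_Union[OF clique_family] clique_family_Union[OF fam'] assms(2) by (auto intro!: fin_subset)
  have dj: "C \<inter> ?R = {}" using clique_family assms(2) by (auto simp: clique_family_def)
  have "\<Union>\<C> = C \<union> ?R" using assms(2) by auto
  then have "card (\<Union>\<C>) = card (C \<union> ?R)" by (rule arg_cong)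
  also have "\<dots> = card C + card ?R" by (rule card_Un_disjoint[OF fin(2,1) dj])
  also have "\<dots> < card C' + card ?R" using assms(4) by simp
  also have "\<dots> = card (C' \<union> ?R)" by (rule card_Un_disjoint[OF fin(3,1) assms(5), symmetric])
  also have "\<dots> = card (\<Union>(insert C' (\<C> - {C})))" by simp
  finally have "card (\<Union>\<C>) < card (\<Union>(insert C' (\<C> - {C})))" .
  moreover have "card (\<Union>(insert C' (\<C> - {C}))) \<le> card (\<Union>\<C>)"
    using assms(1) fam' unfolding optimal_def by blast
  ultimately show False by simp
qed

context
  fixes \<C> C assumes optimal: "optimal \<C>" and C: "C \<in> \<C>"
begin

lemma optimal_clique: "C \<subseteq> V" "complete_on adj C" "93 * D \<le> 100 * card C" "card C \<le> D - 1" "finite C"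
proof -
  show *: "C \<subseteq> V" "complete_on adj C" "93 * D \<le> 100 * card C"
    using optimal C by (auto simp: optimal_def clique_family_def large_clique_def)
  show "card C \<le> D - 1" "finite C" using clique_card * fin_subset by auto
qed

lemma card_ext: "x \<in> C \<Longrightarrow> card (N x - C) + card C \<le> D + 1"
  using card_N_diff_clique[OF optimal_clique(1,2), of x] degD[of x] optimal_clique(1) by auto

lemma clique_adjacent: "x \<in> C \<Longrightarrow> u \<in> C \<Longrightarrow> x \<noteq> u \<Longrightarrow> x \<in> N u"
  using optimal_clique(1,2) by (auto simp: complete_on_def nb_def)

text \<open>In another member, \<open>y\<close> would already have about 93% of D neighbours; 8%
  more in the disjoint \<open>C\<close> would exceed the maximum degree.\<close>

lemma not_in_other_clique:
  assumes y: "y \<in> V - C" "8 * D \<le> 100 * card (N y \<inter> C)"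
  shows "y \<notin> \<Union>(\<C> - {C})"
proof
  assume "y \<in> \<Union>(\<C> - {C})"
  then obtain C' where C': "C' \<in> \<C>" "C' \<noteq> C" "y \<in> C'" by auto
  have b: "C' \<subseteq> V" "complete_on adj C'" "93 * D \<le> 100 * card C'" "C' \<inter> C = {}"
    using optimal C C' by (auto simp: optimal_def clique_family_def large_clique_def)
  have "(C' - {y}) \<union> (N y \<inter> C) \<subseteq> N y" using b C'(3) by (auto simp: complete_on_def nb_def)
  then have "card ((C' - {y}) \<union> (N y \<inter> C)) \<le> D"
    using degD[of y] y card_mono[OF finN[of y]] by (meson DiffD1 order_trans)
  moreover have "card ((C' - {y}) \<union> (N y \<inter> C)) = card (C' - {y}) + card (N y \<inter> C)"
    using b fin_subset by (intro card_Un_disjoint) auto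
  moreover have "card (C' - {y}) = card C' - 1" using C'(3) by simp
  ultimately show False using b(3) y(2) D by linarith
qed

text \<open>Otherwise \<open>insert y C\<close> is a larger clique. With so many neighbours in
  \<open>C\<close>, \<open>y\<close> belongs to no other member, and exchanging \<open>C\<close>
  contradicts optimality. The nonneighbour will serve as the partner sharing the colour of
  \<open>y\<close>.\<close>

lemma ex_nonneighbour:
  assumes y: "y \<in> V - C" shows "\<exists>x\<in>C. x \<notin> N y"
proof (rule ccontr)
  assume "\<not> ?thesis"
  then have all: "C \<subseteq> N y" by auto
  have "large_clique (insert y C)"
    using optimal_clique y all sym unfolding large_clique_def complete_on_def by (auto simp: nb_def)
  moreover have "insert y C \<inter> \<Union>(\<C> - {C}) = {}"
  proof -
    have "N y \<inter> C = C" using all by auto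
    then have "y \<notin> \<Union>(\<C> - {C})" using optimal_clique(3) by (intro not_in_other_clique[OF y]) simp
    moreover have "C \<inter> \<Union>(\<C> - {C}) = {}" using optimal C by (auto simp: optimal_def clique_family_def)
    ultimately show ?thesis by auto
  qed
  moreover have "card C < card (insert y C)" using y optimal_clique(5) by simp
  ultimately show False using no_improving_swap[OF optimal C] by blast
qed

section \<open>Outside vertices with many neighbours in a clique\<close>

lemma no_clique_completion:
  assumes "proper_on adj (D - 1) S \<phi>" "S \<subseteq> V" "V - C \<subseteq> S"
    "v \<in> C - S" "v' \<in> C - S" "v \<noteq> v'" "saves \<phi> S v' 1"
    "saves \<phi> S v 2 \<or> saves \<phi> S v 1 \<and> card (N v) < D"
  shows False
proof -
  have "\<exists>\<phi>. proper_on adj (D - 1) V \<phi>"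
  proof (rule finish_cliques[OF degD _ assms(1,2), where \<C> = "{C}"])
    show "\<exists>v v'. v \<in> B - S \<and> v' \<in> B - S \<and> v \<noteq> v' \<and> saves \<phi> S v' 1 \<and>
       (saves \<phi> S v 2 \<or> saves \<phi> S v 1 \<and> card (N v) < D)" if "B \<in> {C}" for B
      using assms(4-8) that by (intro exI[of _ v] exI[of _ v']) auto
    show "saves \<phi> S u 2 \<or> 2 \<le> card (N u \<inter> (\<Union>{C} - S))" if "u \<in> V - S - \<Union>{C}" for u
      using that assms(3) by auto
  qed (use optimal_clique D in auto)
  then show False using not_colourable by blast
qed

text \<open>Write \<open>card C = D - 1 - j\<close>. A vertex outside \<open>C\<close> is big for \<open>C\<close> if it has at least \<open>j + 5\<close> neighbours in
  \<open>C\<close>. Giving a big vertex the colour of one of its nonneighbours in \<open>C\<close> saves a colour at each of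
  its neighbours in \<open>C\<close>.\<close>

lemma no_big_ext_low_degree:
  assumes v: "v \<in> C" "card (N v) < D" and y: "y \<in> N v - C" "D + 4 \<le> card (N y \<inter> C) + card C"
  shows False
proof -
  have yV: "y \<in> V - C" using y N_subset by auto
  obtain x where x: "x \<in> C" "x \<notin> N y" using ex_nonneighbour[OF yV] by blast
  have xy: "\<not> adj x y" "\<not> adj y x" "x \<noteq> y" using x yV optimal_clique(1) sym by (auto simp: nb_def)
  have vN: "v \<in> N y" using y v optimal_clique(1) sym by (auto simp: nb_def)
  let ?V0 = "V - C - {y}"
  obtain \<phi> where \<phi>: "proper_on adj (D - 1) ?V0 \<phi>" using sub_colouring[of ?V0] yV by blast
  have "(\<Union>t\<in>{y, x}. N t \<inter> ?V0) \<subseteq> (N y - C) \<union> (N x - C)" by auto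
  then have "card (\<Union>t\<in>{y, x}. N t \<inter> ?V0) \<le> card (N y - C) + card (N x - C)"
    by (meson card_Un_le card_mono finN finite_Diff finite_UnI order_trans)
  moreover have "card (N y) = card (N y \<inter> C) + card (N y - C)" by (rule card_N_split)
  \<comment> \<open>For \<open>card C\<close> = D - 1 - j, the two sets have at most D - j - 5 and j
    + 2 elements, together D - 3.\<close>
  ultimately have c: "card (\<Union>t\<in>{y, x}. N t \<inter> ?V0) < D - 1"
    using card_ext[OF x(1)] y(2) degD[of y] yV optimal_clique(4) D by auto
  obtain a where a: "proper_on adj (D - 1) (?V0 \<union> {y, x}) (\<lambda>v. if v \<in> {y, x} then a else \<phi> v)"
    by (rule add_colour_class[OF \<phi> _ _ _ _ c]) (use xy irr x in auto)
  let ?S = "?V0 \<union> {y, x}" and ?\<phi> = "\<lambda>v. if v \<in> {y, x} then a else \<phi> v"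
  have sv: "saves ?\<phi> ?S u 1" if "u \<in> N y \<inter> C" for u
  proof (rule saves_I[where T = "{y}"])
    have u: "u \<in> C" "u \<noteq> x" "y \<in> N u" using that x yV sym by (auto simp: nb_def)
    then show "{y} \<subseteq> N u \<inter> ?S" by auto
    have "x \<in> N u \<inter> ?S - {y}" using u x xy clique_adjacent by auto
    then show "\<exists>x\<in>N u \<inter> ?S - {y}. ?\<phi> x = ?\<phi> t" if "t \<in> {y}" for t
      using that by (intro bexI[of _ x]) auto
  qed auto
  have "5 \<le> card (N y \<inter> C)" using y(2) optimal_clique(4) D by linarith
  then have "\<not> N y \<inter> C \<subseteq> {v}" using card_mono[of "{v}" "N y \<inter> C"] by auto
  then obtain v' where v': "v' \<in> N y \<inter> C" "v' \<noteq> v" by auto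
  show False
    by (rule no_clique_completion[OF a, of v v']) (use v v' x vN sv optimal_clique(1) yV in auto)
qed

text \<open>Distinct nonneighbours \<open>x1\<close>, \<open>x2\<close> of \<open>y1\<close>,
  \<open>y2\<close> in \<open>C\<close> allow two repetitions at \<open>v\<close>. Otherwise
  \<open>y1\<close> and \<open>y2\<close> miss the same single vertex \<open>x1\<close>. If they are
  adjacent, exchanging \<open>x1\<close> for both enlarges the clique, against optimality; if not,
  one colour on \<open>y1\<close>, \<open>y2\<close> and \<open>x1\<close> already saves
  two.\<close>

lemma no_two_big_exts:
  assumes v: "v \<in> C" and y1: "y1 \<in> N v - C" "D + 4 \<le> card (N y1 \<inter> C) + card C"
    and y2: "y2 \<in> N v - C" "D + 4 \<le> card (N y2 \<inter> C) + card C" and ne: "y1 \<noteq> y2"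
  shows False
proof -
  have yV: "y1 \<in> V - C" "y2 \<in> V - C" using y1 y2 N_subset by auto
  have vN: "v \<in> N y1" "v \<in> N y2" using y1 y2 v optimal_clique(1) sym by (auto simp: nb_def)
  let ?V0 = "V - C - {y1, y2}"
  obtain \<phi> where \<phi>: "proper_on adj (D - 1) ?V0 \<phi>" using sub_colouring[of ?V0] yV by blast
  have five: "5 \<le> card (N y1 \<inter> C)" using y1(2) optimal_clique(4) D by linarith
  have outy: "card (N y1 - C) + D + 4 \<le> D + card C" "card (N y2 - C) + D + 4 \<le> D + card C"
    using card_N_split[of y1 C] card_N_split[of y2 C] y1(2) y2(2) degD yV by fastforce+
  obtain x1 where x1: "x1 \<in> C" "x1 \<notin> N y1" using ex_nonneighbour[OF yV(1)] by blast
  obtain x2 where x2: "x2 \<in> C" "x2 \<notin> N y2" using ex_nonneighbour[OF yV(2)] by blast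
  have partner: "x \<in> N u \<inter> S - {y1, y2}" if "x \<in> C" "u \<in> C" "x \<noteq> u" "x \<in> S" for x u S
    using that clique_adjacent yV by auto
  show False
  proof (cases "\<exists>x1 x2. x1 \<in> C - N y1 \<and> x2 \<in> C - N y2 \<and> x1 \<noteq> x2")
    case True
    then obtain x1 x2 where x: "x1 \<in> C" "x1 \<notin> N y1" "x2 \<in> C" "x2 \<notin> N y2" "x1 \<noteq> x2" by auto
    have xy: "\<not> adj x1 y1" "\<not> adj y1 x1" "\<not> adj x2 y2" "\<not> adj y2 x2"
      using x optimal_clique(1) sym by (auto simp: nb_def)
    have ne': "x1 \<noteq> y1" "x1 \<noteq> y2" "x2 \<noteq> y1" "x2 \<noteq> y2" using x yV by auto
    have "(\<Union>t\<in>{y1, x1}. N t \<inter> ?V0) \<subseteq> (N y1 - C) \<union> (N x1 - C)" by auto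
    then have "card (\<Union>t\<in>{y1, x1}. N t \<inter> ?V0) \<le> card (N y1 - C) + card (N x1 - C)"
      by (meson card_Un_le card_mono finN finite_Diff finite_UnI order_trans)
    then have c: "card (\<Union>t\<in>{y1, x1}. N t \<inter> ?V0) < D - 1"
      using card_ext[OF x(1)] outy(1) optimal_clique(4) D by auto
    obtain a where a: "proper_on adj (D - 1) (?V0 \<union> {y1, x1}) (\<lambda>v. if v \<in> {y1, x1} then a else \<phi> v)"
      by (rule add_colour_class[OF \<phi> _ _ _ _ c]) (use xy irr x in auto)
    let ?S1 = "?V0 \<union> {y1, x1}" and ?\<phi>1 = "\<lambda>v. if v \<in> {y1, x1} then a else \<phi> v"
    have "(\<Union>t\<in>{y2, x2}. N t \<inter> ?S1) \<subseteq> insert x1 ((N y2 - C) \<union> (N x2 - C))" using yV by auto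
    then have "card (\<Union>t\<in>{y2, x2}. N t \<inter> ?S1) \<le> card (insert x1 ((N y2 - C) \<union> (N x2 - C)))"
      by (intro card_mono) auto
    also have "\<dots> \<le> Suc (card ((N y2 - C) \<union> (N x2 - C)))" by (rule card_insert_le_m1) auto
    also have "\<dots> \<le> Suc (card (N y2 - C) + card (N x2 - C))" by (simp add: card_Un_le)
    \<comment> \<open>The 5 in j + 5 is needed in full: D - j - 5 and j + 2 outside neighbours and
      the already coloured \<open>x1\<close> give D - 2, one below the number of colours.\<close>
    finally have c2: "card (\<Union>t\<in>{y2, x2}. N t \<inter> ?S1) < D - 1"
      using card_ext[OF x(3)] outy(2) optimal_clique(4) D by auto
    obtain b where b: "proper_on adj (D - 1) (?S1 \<union> {y2, x2}) (\<lambda>v. if v \<in> {y2, x2} then b else ?\<phi>1 v)"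
      by (rule add_colour_class[OF a _ _ _ _ c2]) (use xy irr x ne ne' optimal_clique(1) yV in auto)
    let ?S = "?S1 \<union> {y2, x2}" and ?\<phi> = "\<lambda>v. if v \<in> {y2, x2} then b else ?\<phi>1 v"
    have val: "?\<phi> x1 = ?\<phi> y1" "?\<phi> x2 = ?\<phi> y2" using ne ne' x by auto
    have "\<not> N y1 \<inter> C \<subseteq> {v, x2}"
      using card_mono[of "{v, x2}" "N y1 \<inter> C"] five card_insert_le_m1[of 2 "{x2}" v] by auto
    then obtain v' where v': "v' \<in> N y1 \<inter> C" "v' \<noteq> v" "v' \<noteq> x2" by auto
    have vx: "v \<noteq> x1" "v \<noteq> x2" "v' \<noteq> x1" using vN x v' by auto
    have "saves ?\<phi> ?S v' 1"
    proof (rule saves_I[where T = "{y1}"])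
      show "{y1} \<subseteq> N v' \<inter> ?S" using v' yV sym by (auto simp: nb_def)
      show "\<exists>x\<in>N v' \<inter> ?S - {y1}. ?\<phi> x = ?\<phi> t" if "t \<in> {y1}" for t
      proof (rule bexI[of _ x1])
        show "x1 \<in> N v' \<inter> ?S - {y1}" using partner[of x1 v' ?S] x v' vx by auto
      qed (use that val in auto)
    qed auto
    moreover have "saves ?\<phi> ?S v 2"
    proof (rule saves_I[where T = "{y1, y2}"])
      show "{y1, y2} \<subseteq> N v \<inter> ?S" using y1 y2 by auto
      have "x1 \<in> N v \<inter> ?S - {y1, y2}" "x2 \<in> N v \<inter> ?S - {y1, y2}"
        using partner[of x1 v ?S] partner[of x2 v ?S] x v vx by auto
      then show "\<exists>x\<in>N v \<inter> ?S - {y1, y2}. ?\<phi> x = ?\<phi> t" if "t \<in> {y1, y2}" for t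
        using that val by blast
    qed (use ne in auto)
    ultimately show False
      by (intro no_clique_completion[OF b, of v v']) (use v v' x vx optimal_clique(1) yV in auto)
  next
    case False
    then have sub: "C - N y1 = {x1}" "C - N y2 = {x1}" using x1 x2 by blast+
    have N1: "N y1 \<inter> C = C - {x1}" "N y2 \<inter> C = C - {x1}" using sub by auto
    have cN: "card (N y1 \<inter> C) = card C - 1" "card (N y2 \<inter> C) = card C - 1" using N1 x1 by simp_all
    have big: "8 * D \<le> 100 * card (N y1 \<inter> C)" "8 * D \<le> 100 * card (N y2 \<inter> C)"
      unfolding cN using optimal_clique(3) D by linarith+
    show False
    proof (cases "adj y1 y2")
      case True
      let ?C = "insert y1 (insert y2 (C - {x1}))"
      have "complete_on adj ?C"
      proof -
        have a: "adj y1 u" "adj y2 u" if "u \<in> C" "u \<noteq> x1" for u using N1 that by (auto simp: nb_def)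
        then have a': "adj u y1" "adj u y2" if "u \<in> C" "u \<noteq> x1" for u using sym that by blast+
        have "adj u w" if "u \<in> C" "w \<in> C" "u \<noteq> w" for u w using optimal_clique(2) that by (simp add: complete_on_def)
        then show ?thesis using True sym[OF True] a a' unfolding complete_on_def by auto
      qed
      moreover have cc: "card ?C = card C + 1"
      proof -
        have "card ?C = Suc (Suc (card (C - {x1})))" using optimal_clique(5) ne yV by simp
        moreover have "card C = Suc (card (C - {x1}))" by (rule card_Suc_Diff1[OF optimal_clique(5) x1(1), symmetric])
        ultimately show ?thesis by simp
      qed
      ultimately have "large_clique ?C" using optimal_clique yV unfolding large_clique_def by auto
      moreover have "?C \<inter> \<Union>(\<C> - {C}) = {}"
      proof -
        have "C \<inter> \<Union>(\<C> - {C}) = {}" using optimal C by (auto simp: optimal_def clique_family_def)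
        then show ?thesis using not_in_other_clique[OF yV(1) big(1)] not_in_other_clique[OF yV(2) big(2)] by blast
      qed
      ultimately show False using no_improving_swap[OF optimal C, of ?C] cc by simp
    next
      case nadj: False
      have ne': "x1 \<noteq> y1" "x1 \<noteq> y2" using x1 yV by auto
      have xy: "\<not> adj x1 y1" "\<not> adj y1 x1" "\<not> adj x1 y2" "\<not> adj y2 x1" "\<not> adj y1 y2" "\<not> adj y2 y1"
        using sub x1 optimal_clique(1) sym nadj by (auto simp: nb_def)
      have "(\<Union>t\<in>{y1, y2, x1}. N t \<inter> ?V0) \<subseteq> (N y1 - C) \<union> (N y2 - C) \<union> (N x1 - C)" by auto
      then have "card (\<Union>t\<in>{y1, y2, x1}. N t \<inter> ?V0) \<le> card ((N y1 - C) \<union> (N y2 - C) \<union> (N x1 - C))"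
        by (intro card_mono) auto
      also have "\<dots> \<le> card (N y1 - C) + card (N y2 - C) + card (N x1 - C)"
        by (meson card_Un_le add_right_mono order_trans)
      finally have c: "card (\<Union>t\<in>{y1, y2, x1}. N t \<inter> ?V0) < D - 1"
        using card_ext[OF x1(1)] card_N_split[of y1 C] card_N_split[of y2 C] cN degD[of y1] degD[of y2]
          yV optimal_clique(3) D by auto
      obtain a where a: "proper_on adj (D - 1) (?V0 \<union> {y1, y2, x1}) (\<lambda>v. if v \<in> {y1, y2, x1} then a else \<phi> v)"
        by (rule add_colour_class[OF \<phi> _ _ _ _ c]) (use xy irr x1 in auto)
      let ?S = "?V0 \<union> {y1, y2, x1}" and ?\<phi> = "\<lambda>v. if v \<in> {y1, y2, x1} then a else \<phi> v"
      have sv: "saves ?\<phi> ?S u 2" if u: "u \<in> C - {x1}" for u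
      proof (rule saves_I[where T = "{y1, y2}"])
        show "{y1, y2} \<subseteq> N u \<inter> ?S" using u N1 yV sym by (auto simp: nb_def)
        show "\<exists>x\<in>N u \<inter> ?S - {y1, y2}. ?\<phi> x = ?\<phi> t" if "t \<in> {y1, y2}" for t
        proof (rule bexI[of _ x1])
          show "x1 \<in> N u \<inter> ?S - {y1, y2}" using partner[of x1 u ?S] x1 u by auto
        qed (use that in auto)
      qed (use ne in auto)
      have "\<not> N y1 \<inter> C \<subseteq> {v}" using card_mono[of "{v}" "N y1 \<inter> C"] five by auto
      then obtain v' where v': "v' \<in> N y1 \<inter> C" "v' \<noteq> v" by auto
      have "v' \<in> C - {x1}" "v \<in> C - {x1}" using v' v vN N1 by auto
      then show False
        using sv[of v] sv[of v']
        by (intro no_clique_completion[OF a, of v v']) (use v' x1 optimal_clique(1) yV in \<open>auto simp: saves_def\<close>)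
    qed
  qed
qed

text \<open>If the clique did not exist, then minimality would apply to the graph on \<open>V - C - {y}\<close> with the extra edge
  \<open>w1 w2\<close>, and the resulting colouring extends to \<open>C\<close> because \<open>w1\<close> and \<open>w2\<close> have different colours.\<close>

lemma pair_forces_clique:
  assumes full: "card C = D - 1" and y: "y \<in> V - C" "5 \<le> card (N y \<inter> C)"
    and v: "v1 \<in> N y \<inter> C" "v2 \<in> N y \<inter> C" and w: "N v1 - C = {y, w1}" "N v2 - C = {y, w2}"
    "w1 \<noteq> w2" "w1 \<noteq> y" "w2 \<noteq> y"
  shows "\<exists>A. A \<subseteq> V - C - {y} \<and> complete_on adj A \<and> card A = D - 2 \<and> A \<subseteq> N w1 \<inter> N w2 \<and> \<not> adj w1 w2"
proof (rule ccontr)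
  assume no: "\<not> ?thesis"
  have vne: "v1 \<noteq> v2" using w by auto
  let ?V = "V - C - {y}"
  have wV: "w1 \<in> ?V" "w2 \<in> ?V" using w N_subset[of v1] N_subset[of v2] by auto
  have vw: "v1 \<in> N w1" "v2 \<in> N w2" using w v optimal_clique(1) sym by (auto simp: nb_def)
  define adj' where "adj' a b \<longleftrightarrow> adj a b \<or> a = w1 \<and> b = w2 \<or> a = w2 \<and> b = w1" for a b
  have "\<exists>\<phi>. proper_on adj' (D - 1) ?V \<phi>"
  proof (rule minimal)
    show "?V \<subset> V" using y by auto
    show "adj' b a" if "adj' a b" for a b using that sym by (auto simp: adj'_def)
    show "\<not> adj' a a" for a using irr w(3) by (auto simp: adj'_def)
    have one: "card (insert b (N a - {u})) \<le> D" if "u \<in> N a" "a \<in> V" for a b u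
    proof -
      have "card (insert b (N a - {u})) \<le> Suc (card (N a - {u}))" by (rule card_insert_le_m1) auto
      also have "\<dots> = card (N a)" using that by (intro card_Suc_Diff1) auto
      finally show ?thesis using degD[OF that(2)] by simp
    qed
    \<comment> \<open>The ends of the new edge have lost the neighbours \<open>v1\<close> and
      \<open>v2\<close>, so their degrees do not grow.\<close>
    show "card (nb ?V adj' a) \<le> D" if a: "a \<in> ?V" for a
    proof -
      consider "a = w1" | "a = w2" | "a \<noteq> w1" "a \<noteq> w2" by blast
      then show ?thesis
      proof cases
        case 1
        then have "nb ?V adj' a \<subseteq> insert w2 (N w1 - {v1})" using v by (auto simp: nb_def adj'_def)
        then have "card (nb ?V adj' a) \<le> card (insert w2 (N w1 - {v1}))" by (intro card_mono) auto
        then show ?thesis using one[OF vw(1), of w2] wV by auto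
      next
        case 2
        then have "nb ?V adj' a \<subseteq> insert w1 (N w2 - {v2})" using v by (auto simp: nb_def adj'_def)
        then have "card (nb ?V adj' a) \<le> card (insert w1 (N w2 - {v2}))" by (intro card_mono) auto
        then show ?thesis using one[OF vw(2), of w1] wV by auto
      next
        case 3
        then have "nb ?V adj' a \<subseteq> N a" by (auto simp: nb_def adj'_def)
        then have "card (nb ?V adj' a) \<le> card (N a)" by (intro card_mono) auto
        then show ?thesis using degD[of a] a by auto
      qed
    qed
    show "card K \<noteq> D" if K: "K \<subseteq> ?V" "complete_on adj' K" for K
    proof
      assume cK: "card K = D"
      have "w1 \<in> K \<and> w2 \<in> K \<and> \<not> adj w1 w2"
      proof (rule ccontr)
        assume h: "\<not> ?thesis"
        have "complete_on adj K"
          unfolding complete_on_def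
        proof (intro ballI impI)
          fix a b assume ab: "a \<in> K" "b \<in> K" "a \<noteq> b"
          then have "adj' a b" using K(2) by (simp add: complete_on_def)
          then show "adj a b" using h ab sym by (auto simp: adj'_def)
        qed
        then show False using no_D_clique[of K] K(1) cK by auto
      qed
      then have wK: "w1 \<in> K" "w2 \<in> K" "\<not> adj w1 w2" by auto
      let ?A = "K - {w1, w2}"
      have "complete_on adj ?A" using K(2) unfolding complete_on_def by (auto simp: adj'_def)
      moreover have "?A \<subseteq> N w1 \<inter> N w2"
      proof
        fix a assume a: "a \<in> ?A"
        then have "adj' w1 a" "adj' w2 a" using K(2) wK unfolding complete_on_def by auto
        then show "a \<in> N w1 \<inter> N w2" using a K(1) by (auto simp: adj'_def nb_def)
      qed
      moreover have "card ?A = D - 2"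
        using card_Diff_subset[of "{w1, w2}" K] wK w(3) cK by simp
      moreover have "?A \<subseteq> ?V" using K(1) by auto
      ultimately have "\<exists>A. A \<subseteq> V - C - {y} \<and> complete_on adj A \<and> card A = D - 2 \<and>
          A \<subseteq> N w1 \<inter> N w2 \<and> \<not> adj w1 w2"
        using wK(3) by (intro exI[of _ ?A] conjI)
      then show False using no by contradiction
    qed
  qed
  then obtain \<phi> where \<phi>': "proper_on adj' (D - 1) ?V \<phi>" by blast
  have \<phi>: "proper_on adj (D - 1) ?V \<phi>" using \<phi>' by (auto simp: proper_on_def adj'_def)
  have dw: "\<phi> w1 \<noteq> \<phi> w2" using \<phi>' wV by (auto simp: proper_on_def adj'_def)
  have w1k: "\<phi> w1 < D - 1" using \<phi> wV by (auto simp: proper_on_def)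
  obtain x where x: "x \<in> C" "x \<notin> N y" using ex_nonneighbour[OF y(1)] by blast
  have xy: "\<not> adj x y" "\<not> adj y x" "x \<noteq> y" using x y optimal_clique(1) sym by (auto simp: nb_def)
  have "(\<Union>t\<in>{y, x}. N t \<inter> ?V) \<subseteq> (N y - C) \<union> (N x - C)" by auto
  then have "card (\<Union>t\<in>{y, x}. N t \<inter> ?V) \<le> card (N y - C) + card (N x - C)"
    by (meson card_Un_le card_mono finN finite_Diff finite_UnI order_trans)
  then have c: "card (\<Union>t\<in>{y, x}. N t \<inter> ?V) < D - 1"
    using card_ext[OF x(1)] full D card_N_split[of y C] degD[of y] y by auto
  obtain a where a: "proper_on adj (D - 1) (?V \<union> {y, x}) (\<lambda>v. if v \<in> {y, x} then a else \<phi> v)"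
    by (rule add_colour_class[OF \<phi> _ _ _ _ c]) (use xy irr x in auto)
  let ?S = "?V \<union> {y, x}" and ?\<phi> = "\<lambda>v. if v \<in> {y, x} then a else \<phi> v"
  have SV: "?S \<subseteq> V" using y x optimal_clique(1) by auto
  have inN: "y \<in> N u" "x \<in> N u" "u \<in> C" "u \<noteq> x" if "u \<in> N y \<inter> C" for u
    using that x y sym clique_adjacent by (auto simp: nb_def)
  have sv1: "saves ?\<phi> ?S u 1" if u: "u \<in> N y \<inter> C" for u
  proof (rule saves_I[where T = "{y}"])
    show "{y} \<subseteq> N u \<inter> ?S" using inN[OF u] by auto
    show "\<exists>x\<in>N u \<inter> ?S - {y}. ?\<phi> x = ?\<phi> t" if "t \<in> {y}" for t
      using that inN[OF u] xy by (intro bexI[of _ x]) auto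
  qed auto
  have w1: "w1 \<in> N v1" "w1 \<notin> {y, x}" "w2 \<notin> {y, x}" using w wV x by auto
  show False
  \<comment> \<open>If \<open>w1\<close> has the common colour of \<open>x\<close> and
    \<open>y\<close>, then \<open>x\<close> makes both \<open>y\<close> and \<open>w1\<close>
    redundant at \<open>v1\<close>. Otherwise the colour of \<open>w1\<close> is repeated on
    \<open>v2\<close>: the coloured neighbours of \<open>v2\<close> are among \<open>x\<close>,
    \<open>y\<close> and \<open>w2\<close>, and the added edge keeps that colour away from
    \<open>w2\<close>.\<close>
  proof (cases "\<phi> w1 = a")
    case True
    have "saves ?\<phi> ?S v1 2"
    proof (rule saves_I[where T = "{y, w1}"])
      show "{y, w1} \<subseteq> N v1 \<inter> ?S" using inN[OF v(1)] w1 wV by auto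
      have "x \<in> N v1 \<inter> ?S - {y, w1}" using inN[OF v(1)] w1 xy by auto
      then show "\<exists>x\<in>N v1 \<inter> ?S - {y, w1}. ?\<phi> x = ?\<phi> t" if "t \<in> {y, w1}" for t
        using that True by (intro bexI[of _ x]) auto
    qed (use w in auto)
    then show False
      using no_clique_completion[OF a SV, of v1 v2] sv1[OF v(2)] inN[OF v(1)] inN[OF v(2)] vne optimal_clique(1) y by auto
  next
    case False
    let ?\<psi> = "?\<phi>(v2 := \<phi> w1)"
    have v2S: "v2 \<notin> ?S" using v inN(4)[OF v(2)] y by auto
    have Nv2: "N v2 \<inter> ?S \<subseteq> {y, w2, x}" using w(2) by auto
    have "proper_on adj (D - 1) (insert v2 ?S) ?\<psi>"
    proof (rule proper_on_insert[OF a SV v2S w1k])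
      show "\<phi> w1 \<notin> ?\<phi> ` (N v2 \<inter> ?S)"
      proof
        assume "\<phi> w1 \<in> ?\<phi> ` (N v2 \<inter> ?S)"
        then have "\<phi> w1 \<in> ?\<phi> ` {y, w2, x}" using Nv2 by blast
        then show False using False dw w1 by auto
      qed
    qed
    note col = this
    have "\<not> N y \<inter> C \<subseteq> {v1, v2}" using card_mono[of "{v1, v2}" "N y \<inter> C"] y(2) vne by auto
    then obtain v3 where v3: "v3 \<in> N y \<inter> C" "v3 \<noteq> v1" "v3 \<noteq> v2" by auto
    have v2x: "v2 \<notin> {y, x, w1}" using v2S wV by auto
    have "saves ?\<psi> (insert v2 ?S) v3 1"
      by (rule saves_mono_colouring[OF sv1[OF v3(1)]]) (use v2S in auto)
    moreover have "saves ?\<psi> (insert v2 ?S) v1 2"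
    proof (rule saves_I[where T = "{y, w1}"])
      show "{y, w1} \<subseteq> N v1 \<inter> insert v2 ?S" using inN[OF v(1)] w1 wV by auto
      have "v2 \<in> N v1" using clique_adjacent[of v2 v1] v vne by auto
      then have "v2 \<in> N v1 \<inter> insert v2 ?S - {y, w1}" "?\<psi> v2 = ?\<psi> w1" using v2x w1 by auto
      moreover have "x \<in> N v1 \<inter> insert v2 ?S - {y, w1}" "?\<psi> x = ?\<psi> y" using inN[OF v(1)] w1 xy v2x by auto
      ultimately show "\<exists>x\<in>N v1 \<inter> insert v2 ?S - {y, w1}. ?\<psi> x = ?\<psi> t" if "t \<in> {y, w1}" for t
        using that by blast
    qed (use w in auto)
    ultimately show False
      using no_clique_completion[OF col, of v1 v3] v v3 inN(4)[OF v(1)] inN(4)[OF v3(1)] vne SV optimal_clique(1) y by auto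
  qed
qed

text \<open>Every neighbour v of \<open>y\<close> in \<open>C\<close> has exactly one further
  outside neighbour \<open>w v\<close>. It is not big, so \<open>w\<close> takes several values, and
  \<open>pair_forces_clique\<close> joins any two of them to a common clique on D - 2 vertices. Then
  each value is taken at most twice, and 5 neighbours give three values. Counting degrees at a
  vertex common to two of the cliques shows that they coincide. One clique is thus joined to three
  pairwise nonadjacent vertices; giving these a single colour saves two at each of its
  vertices.\<close>

lemma no_big_ext_full_clique:
  assumes full: "card C = D - 1" and y: "y \<in> V - C" "5 \<le> card (N y \<inter> C)"
  shows False
proof -
  let ?M = "N y \<inter> C"
  have big: "D + 4 \<le> card ?M + card C" using y full D by simp
  have ex_w: "\<exists>w. N v - C = {y, w} \<and> w \<noteq> y" if v: "v \<in> ?M" for v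
  proof -
    have yN: "y \<in> N v - C" "v \<in> C" "v \<in> V" using v y sym optimal_clique(1) by (auto simp: nb_def)
    have "\<not> card (N v) < D" using no_big_ext_low_degree[OF yN(2) _ yN(1) big] by blast
    then have "card (N v) = D" using degD[OF yN(3)] by simp
    then have "card (N v - C) = 2" using card_N_diff_clique[OF optimal_clique(1,2) yN(2)] full D by simp
    then obtain p r where pr: "N v - C = {p, r}" "p \<noteq> r" by (meson card_2_iff)
    then consider "y = p" | "y = r" using yN(1) by blast
    then show ?thesis using pr by cases (auto simp: insert_commute)
  qed
  define w where "w v = (SOME w. N v - C = {y, w} \<and> w \<noteq> y)" for v
  have w: "N v - C = {y, w v}" "w v \<noteq> y" if "v \<in> ?M" for v
    using someI_ex[OF ex_w[OF that]] by (auto simp: w_def)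
  have wN: "w v \<in> N v - C" "v \<in> N (w v) \<inter> C" if "v \<in> ?M" for v
  proof -
    show "w v \<in> N v - C" using w[OF that] by auto
    then show "v \<in> N (w v) \<inter> C" using that optimal_clique(1) sym by (auto simp: nb_def)
  qed
  have w4: "card (N (w v) \<inter> C) \<le> 4" if v: "v \<in> ?M" for v
  proof (rule ccontr)
    assume "\<not> ?thesis"
    then have "D + 4 \<le> card (N (w v) \<inter> C) + card C" using full D by simp
    moreover have "y \<in> N v - C" "v \<in> C" using v y sym by (auto simp: nb_def)
    ultimately show False using no_two_big_exts[of v y "w v"] big wN(1)[OF v] w(2)[OF v] by simp
  qed
  have other: "\<exists>u\<in>?M. w u \<noteq> w v" if v: "v \<in> ?M" for v
  proof (rule ccontr)
    assume "\<not> ?thesis"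
    then have eq: "w u = w v" if "u \<in> ?M" for u using that by blast
    have "?M \<subseteq> N (w v) \<inter> C"
    proof
      fix u assume u: "u \<in> ?M"
      show "u \<in> N (w v) \<inter> C" using wN(2)[OF u] eq[OF u] by simp
    qed
    then have "card ?M \<le> card (N (w v) \<inter> C)" by (intro card_mono) auto
    then show False using w4[OF v] y(2) by simp
  qed
  have pair: "\<exists>A. A \<subseteq> V - C - {y} \<and> complete_on adj A \<and> card A = D - 2 \<and> A \<subseteq> N (w v) \<inter> N (w u) \<and> \<not> adj (w v) (w u)"
    if "v \<in> ?M" "u \<in> ?M" "w v \<noteq> w u" for v u
    using pair_forces_clique[OF full y that(1,2) w(1)[OF that(1)] w(1)[OF that(2)] that(3) w(2)[OF that(1)] w(2)[OF that(2)]] .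
  have w2: "card (N (w v) \<inter> C) \<le> 2" if v: "v \<in> ?M" for v
  proof -
    obtain u where u: "u \<in> ?M" "w v \<noteq> w u" using other[OF v] by metis
    obtain A where A: "A \<subseteq> V - C - {y}" "card A = D - 2" "A \<subseteq> N (w v) \<inter> N (w u)"
      using pair[OF v u] by (elim exE conjE) (rule that)
    have "A \<subseteq> N (w v) - C" using A(1,3) by auto
    then have "D - 2 \<le> card (N (w v) - C)" using A(2) card_mono[of "N (w v) - C" A] by auto
    moreover have "w v \<in> V" using wN(1)[OF v] N_subset by auto
    ultimately show ?thesis using card_N_split[of "w v" C] degD[of "w v"] D by linarith
  qed
  have fib: "card {u \<in> ?M. w u = w v} \<le> 2" if v: "v \<in> ?M" for v
  proof -
    have "{u \<in> ?M. w u = w v} \<subseteq> N (w v) \<inter> C"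
    proof
      fix u assume "u \<in> {u \<in> ?M. w u = w v}"
      then have u: "u \<in> ?M" "w u = w v" by auto
      show "u \<in> N (w v) \<inter> C" using wN(2)[OF u(1)] u(2) by simp
    qed
    then have "card {u \<in> ?M. w u = w v} \<le> card (N (w v) \<inter> C)" by (intro card_mono) auto
    then show ?thesis using w2[OF v] by simp
  qed
  have "?M \<noteq> {}" using y(2) by auto
  then obtain v1 where v1: "v1 \<in> ?M" by blast
  obtain v2 where v2: "v2 \<in> ?M" "w v1 \<noteq> w v2" using other[OF v1] by metis
  have "\<exists>v3\<in>?M. w v3 \<noteq> w v1 \<and> w v3 \<noteq> w v2"
  proof (rule ccontr)
    assume "\<not> ?thesis"
    then have "?M \<subseteq> {u \<in> ?M. w u = w v1} \<union> {u \<in> ?M. w u = w v2}" by blast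
    then have "card ?M \<le> card ({u \<in> ?M. w u = w v1} \<union> {u \<in> ?M. w u = w v2})" by (intro card_mono) auto
    also have "\<dots> \<le> card {u \<in> ?M. w u = w v1} + card {u \<in> ?M. w u = w v2}" by (rule card_Un_le)
    finally show False using fib[OF v1] fib[OF v2(1)] y(2) by simp
  qed
  then obtain v3 where v3: "v3 \<in> ?M" "w v3 \<noteq> w v1" "w v3 \<noteq> w v2" by blast
  let ?a = "w v1" and ?b = "w v2" and ?c = "w v3"
  obtain A where A: "A \<subseteq> V - C - {y}" "complete_on adj A" "card A = D - 2" "A \<subseteq> N ?a \<inter> N ?b" "\<not> adj ?a ?b"
    using pair[OF v1 v2(1,2)] by (elim exE conjE) (rule that)
  obtain A' where A': "A' \<subseteq> V - C - {y}" "complete_on adj A'" "card A' = D - 2" "A' \<subseteq> N ?a \<inter> N ?c" "\<not> adj ?a ?c"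
    using pair[OF v1 v3(1) v3(2)[symmetric]] by (elim exE conjE) (rule that)
  have bc: "\<not> adj ?b ?c" using pair[OF v2(1) v3(1) v3(3)[symmetric]] by (elim exE conjE)
  have wV: "?a \<in> V" "?b \<in> V" "?c \<in> V" using wN(1)[OF v1] wN(1)[OF v2(1)] wN(1)[OF v3(1)] N_subset by auto
  have finA: "finite A" "finite A'" using A(1) A'(1) fin_subset by (meson Diff_subset order_trans)+
  have "card (A \<union> A') \<le> D"
    using card_mono[of "N ?a" "A \<union> A'"] A(4) A'(4) degD[OF wV(1)] by auto
  then have "A \<inter> A' \<noteq> {}"
    using card_Un_Int[OF finA] A(3) A'(3) D by auto
  then obtain z where z: "z \<in> A" "z \<in> A'" by blast
  have wA: "?a \<notin> A \<union> A'" "?b \<notin> A \<union> A'" "?c \<notin> A \<union> A'"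
    using A(4,5) A'(4,5) irr by (auto simp: nb_def)
  have zV: "z \<in> V" using z A(1) by auto
  have "(A \<union> A' - {z}) \<union> {?a, ?b, ?c} \<subseteq> N z"
  proof -
    have "A - {z} \<subseteq> N z" "A' - {z} \<subseteq> N z"
      using z A(1,2) A'(1,2) by (auto simp: complete_on_def nb_def)
    moreover have za: "adj ?a z" "adj ?b z" "adj ?c z" using z A(4) A'(4) by (auto simp: nb_def)
    have "{?a, ?b, ?c} \<subseteq> N z" using sym[OF za(1)] sym[OF za(2)] sym[OF za(3)] wV by (simp add: nb_def)
    ultimately show ?thesis by auto
  qed
  then have "card ((A \<union> A' - {z}) \<union> {?a, ?b, ?c}) \<le> D"
    using card_mono[OF finN[of z]] degD[OF zV] by (meson order_trans)
  moreover have "card ((A \<union> A' - {z}) \<union> {?a, ?b, ?c}) = card (A \<union> A' - {z}) + card {?a, ?b, ?c}"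
    using finA wA by (intro card_Un_disjoint) auto
  moreover have "card {?a, ?b, ?c} = 3" using v2(2) v3(2,3) by auto
  moreover have "card (A \<union> A' - {z}) = card (A \<union> A') - 1" using z by simp
  ultimately have "card (A \<union> A') \<le> card A" using A(3) D by simp
  then have AA: "A \<union> A' = A" using finA by (metis Un_upper1 card_seteq finite_Un)
  have Ac: "A \<subseteq> N ?c"
  proof -
    have "A' \<subseteq> A" using AA by auto
    then have "A' = A" using card_seteq[OF finA(1), of A'] A(3) A'(3) by simp
    then show ?thesis using A'(4) by auto
  qed
  let ?T = "{?a, ?b, ?c}" and ?S0 = "V - A - {?a, ?b, ?c}"
  obtain \<phi> where \<phi>: "proper_on adj (D - 1) ?S0 \<phi>" using sub_colouring[of ?S0] wV by blast
  have two: "card (N t \<inter> ?S0) \<le> 2" if "t \<in> ?T" for t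
  proof -
    have "A \<subseteq> N t" "t \<in> V" using that A(4) Ac wV by auto
    have "card (N t \<inter> ?S0) \<le> card (N t - A)" by (intro card_mono) auto
    also have "\<dots> = card (N t) - card A" using \<open>A \<subseteq> N t\<close> finA by (intro card_Diff_subset) auto
    finally show ?thesis using degD[OF \<open>t \<in> V\<close>] A(3) D by simp
  qed
  have "card (\<Union>t\<in>?T. N t \<inter> ?S0) \<le> (\<Sum>t\<in>?T. card (N t \<inter> ?S0))" by (rule card_UN_le) auto
  also have "\<dots> \<le> (\<Sum>t\<in>?T. 2)" by (rule sum_mono[OF two])
  also have "\<dots> \<le> 6" using \<open>card ?T = 3\<close> by simp
  finally have c: "card (\<Union>t\<in>?T. N t \<inter> ?S0) < D - 1" using D by simp
  have indep: "\<not> adj t t'" if "t \<in> ?T" "t' \<in> ?T" for t t'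
    using that A(5) A'(5) bc irr sym by auto
  obtain a where a: "proper_on adj (D - 1) (?S0 \<union> ?T) (\<lambda>v. if v \<in> ?T then a else \<phi> v)"
    by (rule add_colour_class[OF \<phi> _ _ _ indep c]) auto
  let ?S = "?S0 \<union> ?T" and ?\<phi> = "\<lambda>v. if v \<in> ?T then a else \<phi> v"
  have "\<exists>\<phi>'. proper_on adj (D - 1) (?S \<union> A) \<phi>' \<and> (\<forall>v\<in>?S. \<phi>' v = ?\<phi> v)"
  proof (rule extend_layer_saves[OF a])
    fix u assume u: "u \<in> A"
    have TN: "?T \<subseteq> N u" using u A(4) Ac wV sym by (auto simp: nb_def)
    have "saves ?\<phi> ?S u 2"
    proof (rule saves_I[where T = "{?b, ?c}"])
      show "{?b, ?c} \<subseteq> N u \<inter> ?S" using TN by auto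
      have "?a \<in> N u \<inter> ?S - {?b, ?c}" using TN v2 v3 by auto
      then show "\<exists>x\<in>N u \<inter> ?S - {?b, ?c}. ?\<phi> x = ?\<phi> t" if "t \<in> {?b, ?c}" for t
        using that by (intro bexI[of _ ?a]) auto
    qed (use v3 in auto)
    then show "\<exists>s. saves ?\<phi> ?S u s \<and> card (N u) + 2 \<le> D + s + card (N u - (?S \<union> A))"
      using degD[of u] u A(1) by (intro exI[of _ 2]) auto
  qed (use wV wA A(1) D in auto)
  moreover have "?S \<union> A = V" using wV A(1) by auto
  ultimately show False using not_colourable by metis
qed

section \<open>Small outside neighbours and blocks\<close>

definition small_ext :: "'a \<Rightarrow> 'a set" where
  "small_ext v = {y \<in> N v - C. card (N y \<inter> C) + card C \<le> D + 3}"

lemma finite_small_ext: "finite (small_ext v)" by (simp add: small_ext_def)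

text \<open>A vertex of degree d has d + 1 - \<open>card C\<close> outside neighbours. At most one
  of them is big, and none if d < D or \<open>card C = D - 1\<close>. The last exclusion secures the
  second small neighbour for degree D when the clique is as large as possible.\<close>

lemma card_small_ext:
  assumes v: "v \<in> C"
  shows "D - card C \<le> card (small_ext v)" "card (N v) = D \<Longrightarrow> 2 \<le> card (small_ext v)"
proof -
  let ?B = "N v - C - small_ext v"
  have split: "card (N v - C) = card (small_ext v) + card ?B"
  proof -
    have "N v - C = small_ext v \<union> ?B" by (auto simp: small_ext_def)
    then have "card (N v - C) = card (small_ext v \<union> ?B)" by (rule arg_cong)
    also have "\<dots> = card (small_ext v) + card ?B" by (rule card_Un_disjoint) (auto simp: small_ext_def)
    finally show ?thesis .
  qed
  have cE: "card (N v - C) + card C = card (N v) + 1" by (rule card_N_diff_clique[OF optimal_clique(1,2) v])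
  have B: "y \<in> N v - C \<and> D + 4 \<le> card (N y \<inter> C) + card C" if "y \<in> ?B" for y
    using that by (auto simp: small_ext_def)
  have "card ?B \<le> 1"
  proof (rule ccontr)
    assume "\<not> ?thesis"
    then obtain y1 y2 where "y1 \<in> ?B" "y2 \<in> ?B" "y1 \<noteq> y2"
      by (metis card_le_Suc0_iff_eq One_nat_def finN finite_Diff)
    then show False using B[of y1] B[of y2] no_two_big_exts[OF v] by blast
  qed
  moreover have "?B = {}" if "card (N v) < D"
    using B no_big_ext_low_degree[OF v that] by blast
  moreover have "?B = {}" if f: "card C = D - 1"
  proof (rule ccontr)
    assume "?B \<noteq> {}"
    then obtain y where y: "y \<in> ?B" by blast
    then have "5 \<le> card (N y \<inter> C)" using B[OF y] f D by linarith
    then show False using no_big_ext_full_clique[OF f, of y] y N_subset[of v] by auto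
  qed
  moreover have "D - 1 \<le> card (N v)" "card (N v) \<le> D" using degree_ge[of v] degD[of v] v optimal_clique(1) by auto
  ultimately show "D - card C \<le> card (small_ext v)" "card (N v) = D \<Longrightarrow> 2 \<le> card (small_ext v)"
    using split cE optimal_clique(4) D
    by (cases "card (N v) < D"; simp; linarith)
      (cases "card C = D - 1"; use split cE optimal_clique(4) D \<open>card ?B \<le> 1\<close> \<open>card C = D - 1 \<Longrightarrow> ?B = {}\<close> in force)
qed

text \<open>Double counting of the edges between \<open>B\<close> and \<open>U\<close>: a vertex of
  \<open>U\<close> that is a small outside neighbour of any vertex has at most
  \<open>D + 3 - card C\<close> neighbours in \<open>C\<close>.\<close>

lemma card_mult_le_small_ext:
  assumes B: "B \<subseteq> C" and U: "finite U" and k: "\<And>v. v \<in> B \<Longrightarrow> k \<le> card (small_ext v \<inter> U)"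
  shows "card B * k \<le> card U * (D + 3 - card C)"
proof -
  let ?U = "{u \<in> U. card (N u \<inter> C) + card C \<le> D + 3}"
  have finB: "finite B" using B optimal_clique(5) finite_subset by blast
  have "card B * k = (\<Sum>v\<in>B. k)" by simp
  also have "\<dots> \<le> (\<Sum>v\<in>B. card (small_ext v \<inter> U))" by (rule sum_mono[OF k])
  also have "\<dots> = card (Sigma B (\<lambda>v. small_ext v \<inter> U))" using finB U by (simp add: card_SigmaI)
  also have "\<dots> = card (prod.swap ` Sigma B (\<lambda>v. small_ext v \<inter> U))" by (simp add: card_image)
  also have "\<dots> \<le> card (Sigma ?U (\<lambda>u. N u \<inter> C))"
  proof (rule card_mono)
    show "prod.swap ` Sigma B (\<lambda>v. small_ext v \<inter> U) \<subseteq> Sigma ?U (\<lambda>u. N u \<inter> C)"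
    proof clarsimp
      fix v u assume h: "v \<in> B" "u \<in> small_ext v" "u \<in> U"
      then have "v \<in> V" "v \<in> C" "adj v u" "card (N u \<inter> C) + card C \<le> D + 3"
        using B optimal_clique(1) by (auto simp: small_ext_def nb_def)
      then show "card (N u \<inter> C) + card C \<le> D + 3 \<and> v \<in> N u \<and> v \<in> C" using sym by (simp add: nb_def)
    qed
  qed (use U optimal_clique(5) in auto)
  also have "\<dots> = (\<Sum>u\<in>?U. card (N u \<inter> C))" using U by (simp add: card_SigmaI)
  also have "\<dots> \<le> (\<Sum>u\<in>?U. D + 3 - card C)" by (rule sum_mono) auto
  also have "\<dots> \<le> card U * (D + 3 - card C)" using U by (simp add: card_mono)
  finally show ?thesis .
qed

text \<open>A block consists of a vertex \<open>v\<close> of \<open>C\<close> to be coloured last and of the outside neighbours whose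
  colours will be repeated in \<open>C\<close>: two if \<open>v\<close> has degree \<open>D\<close>, and only one, written \<open>y = y'\<close>, if \<open>v\<close> has
  smaller degree.\<close>

definition block_family :: "('a \<times> 'a \<times> 'a) set \<Rightarrow> bool" where
  "block_family M \<longleftrightarrow> finite M \<and> card M = D div 20 \<and>
     (\<forall>(v, y, y')\<in>M. v \<in> C \<and> y \<in> small_ext v \<and> y' \<in> small_ext v) \<and>
     (\<forall>t\<in>M. \<forall>t'\<in>M. t \<noteq> t' \<longrightarrow> block_set t \<inter> block_set t' = {}) \<and>
     ((\<forall>(v, y, y')\<in>M. y \<noteq> y') \<or> (\<forall>(v, y, y')\<in>M. y = y' \<and> card (N v) < D))"

lemma block_family_exists: "\<exists>M. block_family M"
proof -
  define Q1 where "Q1 = {v \<in> C. card (N v) < D}"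
  define Q2 where "Q2 = {v \<in> C. card (N v) = D}"
  define j where "j = D - 1 - card C"
  have jj: "D + 3 - card C = j + 4" "D - card C = j + 1" using optimal_clique(4) D by (auto simp: j_def)
  have smC: "small_ext v \<inter> C = {}" for v by (auto simp: small_ext_def)
  have smV: "small_ext v \<subseteq> V" for v using N_subset by (auto simp: small_ext_def)
  have finsm: "finite (small_ext v)" for v by (rule finite_small_ext)
  have Q1C: "Q1 \<subseteq> C" and Q2C: "Q2 \<subseteq> C" by (auto simp: Q1_def Q2_def)
  have "C = Q1 \<union> Q2" "Q1 \<inter> Q2 = {}" using degD optimal_clique(1) by (auto simp: Q1_def Q2_def le_less)
  then have cQ: "card C = card Q1 + card Q2" using optimal_clique(5) by (metis card_Un_disjoint finite_Un)
  have shrink: "\<exists>M. block_family M" if M: "finite M" "D div 20 \<le> card M"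
    "\<forall>(v, y, y')\<in>M. v \<in> C \<and> y \<in> small_ext v \<and> y' \<in> small_ext v"
    "\<forall>t\<in>M. \<forall>t'\<in>M. t \<noteq> t' \<longrightarrow> block_set t \<inter> block_set t' = {}"
    "(\<forall>(v, y, y')\<in>M. y \<noteq> y') \<or> (\<forall>(v, y, y')\<in>M. y = y' \<and> card (N v) < D)" for M
  proof -
    obtain M' where M': "M' \<subseteq> M" "card M' = D div 20" by (meson M(2) obtain_subset_with_card_n)
    have "finite M'" using M(1) M'(1) finite_subset by blast
    moreover have b: "\<forall>t\<in>M'. P t" if "\<forall>t\<in>M. P t" for P using that M'(1) by blast
    moreover have "\<forall>t\<in>M'. \<forall>t'\<in>M'. t \<noteq> t' \<longrightarrow> block_set t \<inter> block_set t' = {}"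
      using M(4) M'(1) by (intro ballI) (meson subsetD)
    moreover have "(\<forall>(v, y, y')\<in>M'. y \<noteq> y') \<or> (\<forall>(v, y, y')\<in>M'. y = y' \<and> card (N v) < D)"
      using M(5) by (elim disjE) (rule disjI1, erule b, rule disjI2, erule b)
    ultimately show ?thesis using b[OF M(3)] M'(2) unfolding block_family_def by (intro exI[of _ M'] conjI)
  qed
  have packing: "\<exists>M U. finite M \<and> (\<forall>(v, y, y')\<in>M. v \<in> Q \<and> y \<in> small_ext v \<and> y' \<in> small_ext v \<and> E y y') \<and>
      (\<forall>t\<in>M. \<forall>t'\<in>M. t \<noteq> t' \<longrightarrow> block_set t \<inter> block_set t' = {}) \<and> card (fst ` M) = card M \<and> fst ` M \<subseteq> Q \<and>
      U = (\<lambda>t. fst (snd t)) ` M \<union> (\<lambda>t. snd (snd t)) ` M \<and> finite U \<and>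
      (\<forall>v\<in>Q - fst ` M. \<forall>y\<in>small_ext v - U. \<forall>y'\<in>small_ext v - U. \<not> E y y')"
    if Q: "Q \<subseteq> C" for Q and E :: "'a \<Rightarrow> 'a \<Rightarrow> bool"
  proof -
    define T where "T = {(v, y, y'). v \<in> Q \<and> y \<in> small_ext v \<and> y' \<in> small_ext v \<and> E y y'}"
    have T_iff: "(v, y, y') \<in> T \<longleftrightarrow> v \<in> Q \<and> y \<in> small_ext v \<and> y' \<in> small_ext v \<and> E y y'" for v y y'
      by (simp add: T_def)
    have finT: "finite T"
      by (rule finite_subset[of _ "V \<times> V \<times> V"]) (use smV Q optimal_clique(1) finV in \<open>auto simp: T_def\<close>)
    obtain M where M: "M \<subseteq> T" "\<forall>t\<in>M. \<forall>t'\<in>M. t \<noteq> t' \<longrightarrow> block_set t \<inter> block_set t' = {}"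
      "\<forall>t\<in>T. block_set t \<noteq> {} \<longrightarrow> block_set t \<inter> \<Union>(block_set ` M) \<noteq> {}"
      using maximal_packing[OF finT, of block_set] by (elim exE conjE) (rule that)
    define U where "U = (\<lambda>t. fst (snd t)) ` M \<union> (\<lambda>t. snd (snd t)) ` M"
    have finM: "finite M" by (rule finite_subset[OF M(1) finT])
    have "inj_on fst M"
    proof (rule inj_onI, rule ccontr)
      fix t t' assume h: "t \<in> M" "t' \<in> M" "fst t = fst t'" "t \<noteq> t'"
      have "fst t \<in> block_set t" "fst t' \<in> block_set t'" by (cases t; simp) (cases t'; simp)
      then show False using M(2) h by (metis disjoint_iff)
    qed
    then have "card (fst ` M) = card M" by (rule card_image)
    moreover have "fst ` M \<subseteq> Q" using M(1) by (auto simp: T_def)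
    moreover have noE: "\<not> E y y'" if v: "v \<in> Q - fst ` M" and y: "y \<in> small_ext v - U" "y' \<in> small_ext v - U" for v y y'
    proof
      assume "E y y'"
      then have "(v, y, y') \<in> T" using v y by (simp add: T_def)
      then have "block_set (v, y, y') \<inter> \<Union>(block_set ` M) \<noteq> {}" using M(3) by (metis insert_not_empty block_set.simps)
      then obtain t where "t \<in> M" "block_set (v, y, y') \<inter> block_set t \<noteq> {}" by blast
      then obtain a b c where t: "(a, b, c) \<in> M" "{v, y, y'} \<inter> {a, b, c} \<noteq> {}" by (cases t) simp
      have "a \<in> Q" "b \<in> small_ext a" "c \<in> small_ext a" using t(1) M(1) T_iff by (meson subsetD)+
      then have "a \<in> C" "b \<notin> C" "c \<notin> C" using Q smC by blast+
      moreover have "v \<in> C" "y \<notin> C" "y' \<notin> C" using v y Q smC by blast+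
      moreover have "a \<in> fst ` M" "b \<in> U" "c \<in> U" unfolding U_def using image_eqI[OF _ t(1)] by (metis fst_conv, metis UnI1 fst_conv snd_conv, metis UnI2 snd_conv)
      ultimately show False using t(2) v y by auto
    qed
    moreover have "\<forall>(v, y, y')\<in>M. v \<in> Q \<and> y \<in> small_ext v \<and> y' \<in> small_ext v \<and> E y y'"
    proof clarify
      fix v y y' assume "(v, y, y') \<in> M"
      then show "v \<in> Q \<and> y \<in> small_ext v \<and> y' \<in> small_ext v \<and> E y y'" using M(1) T_iff by blast
    qed
    moreover have "finite U" using finM by (simp add: U_def)
    moreover have "\<forall>v\<in>Q - fst ` M. \<forall>y\<in>small_ext v - U. \<forall>y'\<in>small_ext v - U. \<not> E y y'"
      by (intro ballI noE)
    ultimately show ?thesis using finM M(2) U_def by (intro exI[of _ M] exI[of _ U] conjI)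
  qed
  show ?thesis
  \<comment> \<open>The two counts give \<open>card Q2 \<le> 11 * card M\<close> and
    \<open>card Q1 \<le> 5 * card M\<close>. The threshold 65% serves both cases, as 0.65 * 0.93 /
    11 and 0.35 * 0.93 / 5 exceed 1/20.\<close>
  proof (cases "65 * card C \<le> 100 * card Q2")
    case True
    obtain M U where M: "finite M" "\<forall>(v, y, y')\<in>M. v \<in> Q2 \<and> y \<in> small_ext v \<and> y' \<in> small_ext v \<and> y \<noteq> y'"
      "\<forall>t\<in>M. \<forall>t'\<in>M. t \<noteq> t' \<longrightarrow> block_set t \<inter> block_set t' = {}" "card (fst ` M) = card M" "fst ` M \<subseteq> Q2"
      "U = (\<lambda>t. fst (snd t)) ` M \<union> (\<lambda>t. snd (snd t)) ` M" "finite U"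
      "\<forall>v\<in>Q2 - fst ` M. \<forall>y\<in>small_ext v - U. \<forall>y'\<in>small_ext v - U. \<not> y \<noteq> y'"
      using packing[OF Q2C, of "\<lambda>y y'. y \<noteq> y'"] by (elim exE conjE) (rule that)
    have "card U \<le> card ((\<lambda>t. fst (snd t)) ` M) + card ((\<lambda>t. snd (snd t)) ` M)"
      unfolding M(6) by (rule card_Un_le)
    then have cU: "card U \<le> 2 * card M"
      using card_image_le[OF M(1), of "\<lambda>t. fst (snd t)"] card_image_le[OF M(1), of "\<lambda>t. snd (snd t)"] by linarith
    have "card (Q2 - fst ` M) * max 1 j \<le> card U * (D + 3 - card C)"
    proof (rule card_mult_le_small_ext)
      fix v assume v: "v \<in> Q2 - fst ` M"
      have "card (small_ext v - U) \<le> 1"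
        using M(8) v finsm by (auto simp: card_le_Suc0_iff_eq)
      moreover have "card (small_ext v) = card (small_ext v \<inter> U) + card (small_ext v - U)"
        using card_Un_disjoint[of "small_ext v \<inter> U" "small_ext v - U"] finsm[of v] by (simp add: Int_Diff_Un Int_Diff_disjoint)
      moreover have "v \<in> C" "card (N v) = D" using v by (auto simp: Q2_def)
      ultimately show "max 1 j \<le> card (small_ext v \<inter> U)"
        using card_small_ext[of v] jj by linarith
    qed (use M(7) in \<open>auto simp: Q2_def\<close>)
    \<comment> \<open>Here j + 4 \<le> 5 * max 1 j; the maximum covers the case j = 0.\<close>
    also have "\<dots> \<le> (2 * card M) * (10 * max 1 j div 2)"
      using cU jj by (intro mult_mono) auto
    also have "\<dots> \<le> 10 * card M * max 1 j" by simp
    finally have "card (Q2 - fst ` M) \<le> 10 * card M" by simp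
    moreover have "card (Q2 - fst ` M) = card Q2 - card M"
      using M(4,5) optimal_clique(5) by (subst card_Diff_subset) (auto simp: Q2_def intro: M(1))
    ultimately have "card Q2 \<le> 11 * card M" by linarith
    then have "D div 20 \<le> card M" using True optimal_clique(3) by linarith
    then show ?thesis using M(1-3) by (intro shrink[of M]) (auto simp: Q2_def)
  next
    case False
    obtain M U where M: "finite M" "\<forall>(v, y, y')\<in>M. v \<in> Q1 \<and> y \<in> small_ext v \<and> y' \<in> small_ext v \<and> y = y'"
      "\<forall>t\<in>M. \<forall>t'\<in>M. t \<noteq> t' \<longrightarrow> block_set t \<inter> block_set t' = {}" "card (fst ` M) = card M" "fst ` M \<subseteq> Q1"
      "U = (\<lambda>t. fst (snd t)) ` M \<union> (\<lambda>t. snd (snd t)) ` M" "finite U"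
      "\<forall>v\<in>Q1 - fst ` M. \<forall>y\<in>small_ext v - U. \<forall>y'\<in>small_ext v - U. \<not> y = y'"
      using packing[OF Q1C, of "\<lambda>y y'. y = y'"] by (elim exE conjE) (rule that)
    have "(\<lambda>t. snd (snd t)) ` M = (\<lambda>t. fst (snd t)) ` M" using M(2) by (intro image_cong) auto
    then have cU: "card U \<le> card M" using card_image_le[OF M(1), of "\<lambda>t. fst (snd t)"] M(6) by simp
    have "card (Q1 - fst ` M) * (j + 1) \<le> card U * (D + 3 - card C)"
    proof (rule card_mult_le_small_ext)
      fix v assume v: "v \<in> Q1 - fst ` M"
      have "small_ext v \<inter> U = small_ext v" using M(8) v by blast
      moreover have "v \<in> C" using v by (auto simp: Q1_def)
      ultimately show "j + 1 \<le> card (small_ext v \<inter> U)" using card_small_ext(1)[of v] jj by simp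
    qed (use M(7) in \<open>auto simp: Q1_def\<close>)
    also have "\<dots> \<le> card M * (4 * (j + 1))" using cU jj by (intro mult_mono) auto
    finally have "card (Q1 - fst ` M) * (j + 1) \<le> (4 * card M) * (j + 1)" by (simp add: algebra_simps)
    then have "card (Q1 - fst ` M) \<le> 4 * card M" by (rule mult_right_le_imp_le) simp
    moreover have "card (Q1 - fst ` M) = card Q1 - card M"
      using M(4,5) optimal_clique(5) by (subst card_Diff_subset) (auto simp: Q1_def intro: M(1))
    ultimately have "card Q1 \<le> 5 * card M" by linarith
    then have "D div 20 \<le> card M" using False cQ optimal_clique(3) by linarith
    then show ?thesis using M(1-3) by (intro shrink[of M]) (auto simp: Q1_def)
  qed
qed

end

section \<open>Random stages in a minimal counterexample\<close>

abbreviation q :: real where "q \<equiv> 1 / (2 * real D)"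
abbreviation pp :: real where "pp \<equiv> exp (- real D / 40000000)"

lemma decay_le_one: "(51/100::real) \<le> 1" by simp

lemma density_bounds: "0 \<le> q" "q \<le> 1" using D by (auto simp: field_simps)

lemma in_ball_two:
  assumes "u \<in> V"
  shows "N u \<subseteq> (nbrel V adj ^^ 2) `` {u}" "u \<in> (nbrel V adj ^^ 2) `` {u}"
    "w \<in> N u \<Longrightarrow> N w \<subseteq> (nbrel V adj ^^ 2) `` {u}"
  using assms by (auto simp: numeral_2_eq_2 nbrel_def nb_def)

lemma near_clique_ball:
  assumes "optimal \<C>" "C \<in> \<C>" "u \<in> C" "z \<in> C \<or> (\<exists>v\<in>C. z \<in> N v)"
  shows "z \<in> (nbrel V adj ^^ 2) `` {u}"
proof -
  have uV: "u \<in> V" using optimal_clique(1)[OF assms(1,2)] assms(3) by auto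
  have CN: "v = u \<or> v \<in> N u" if "v \<in> C" for v using clique_adjacent[OF assms(1,2) that assms(3)] by blast
  from assms(4) show ?thesis using CN in_ball_two[OF uV] by blast
qed

text \<open>The events of the local lemma sit at vertices, so all vertices of a clique carry the
  same demand and caps. At most \<open>e2\<close> of the disjoint sets
  \<open>insert y (R C y)\<close> are touched. A remaining \<open>y\<close> can use all of
  \<open>X0 C\<close> except its at most \<open>D + 3 - card C\<close> neighbours and the at most
  \<open>e1\<close> selected vertices. The product of the two counts is the supply of pairs required
  by the bound on \<open>M\<close>.\<close>

lemma clique_stage:
  fixes Y X0 Q :: "'a set \<Rightarrow> 'a set" and R :: "'a set \<Rightarrow> 'a \<Rightarrow> 'a set"
  assumes optimal: "optimal \<C>" and D\<C>: "\<D> \<subseteq> \<C>" and WV: "W \<subseteq> V"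
    and Y: "\<And>C. C \<in> \<D> \<Longrightarrow> Y C \<subseteq> W - C" and X0: "\<And>C. C \<in> \<D> \<Longrightarrow> X0 C \<subseteq> C \<inter> W"
    and small: "\<And>C y. C \<in> \<D> \<Longrightarrow> y \<in> Y C \<Longrightarrow> card (N y \<inter> C) + card C \<le> D + 3"
    and R: "\<And>C y. C \<in> \<D> \<Longrightarrow> y \<in> Y C \<Longrightarrow> R C y \<subseteq> W \<and> card (R C y) \<le> 2 \<and> R C y \<inter> X0 C = {} \<and> y \<notin> R C y"
    and disj: "\<And>C y y'. C \<in> \<D> \<Longrightarrow> y \<in> Y C \<Longrightarrow> y' \<in> Y C \<Longrightarrow> y \<noteq> y' \<Longrightarrow>
      insert y (R C y) \<inter> insert y' (R C y') = {}"
    and Q: "\<And>C. C \<in> \<D> \<Longrightarrow> (\<Union>y\<in>Y C. insert y (R C y)) \<subseteq> Q C"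
    and ball: "\<And>C z. C \<in> \<C> \<Longrightarrow> z \<in> Q C \<Longrightarrow> z \<in> C \<or> (\<exists>v\<in>C. z \<in> N v)"
    and bs: "\<And>C. C \<in> \<C> \<Longrightarrow> card (Q C) \<le> bs"
    and e1: "2 powr (- e1) * exp (q * real K * real D) \<le> pp"
    and e2: "2 powr (- e2) * exp (q * real K * real bs) \<le> pp"
    and Nb: "\<And>C. C \<in> \<D> \<Longrightarrow> e2 \<le> real (card (Y C)) \<and> 0 \<le> real (card (X0 C)) - real (D + 3 - card C) - e1 \<and>
      real M \<le> (real (card (Y C)) - e2) * (real (card (X0 C)) - real (D + 3 - card C) - e1)"
    and n: "2 * D + 1 + bs \<le> n"
    and p: "0 \<le> p" "p \<le> 1" "p \<le> real M * q\<^sup>2 * (1 - q) ^ n"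
    and L: "(1 + q) ^ (2 * L) \<le> 1 + p / 4"
    and fail: "2 ^ G * ((1 - p / 4) ^ K + real K * (51/100) ^ L) \<le> pp"
  shows "\<exists>S \<phi>. S \<subseteq> W \<and> proper_on adj K S \<phi> \<and> (\<forall>C\<in>\<C>. real (card (S \<inter> C)) \<le> e1 \<and> real (card (S \<inter> Q C)) \<le> e2) \<and>
    (\<forall>C\<in>\<D>. \<exists>Y'\<subseteq>Y C. G \<le> card Y' \<and>
       (\<forall>y\<in>Y'. y \<in> S \<and> R C y \<inter> S = {} \<and> (\<exists>x\<in>X0 C - N y. x \<in> S \<and> \<phi> x = \<phi> y)))"
proof -
  define cl where "cl u = (THE C. C \<in> \<C> \<and> u \<in> C)" for u
  have cl: "cl u = C" if "C \<in> \<C>" "u \<in> C" for u C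
    unfolding cl_def using that optimal by (intro the_equality) (auto simp: optimal_def clique_family_def)
  define U where "U u k = (if u \<in> \<Union>\<C> \<and> k = 1 then cl u else if u \<in> \<Union>\<C> \<and> k = 2 then Q (cl u) else {})"
    for u :: 'a and k :: nat
  define e where "e u k = (if k = 2 then e2 else e1)" for u :: 'a and k :: nat
  define Z where "Z u = (cl u \<union> Q (cl u)) \<inter> W" for u
  have CB: "C \<subseteq> V" "complete_on adj C" "card C \<le> D - 1" "finite C" if "C \<in> \<C>" for C
    using optimal_clique[OF optimal that] by auto
  have Cball: "C \<subseteq> (nbrel V adj ^^ 2) `` {u}" "Q C \<subseteq> (nbrel V adj ^^ 2) `` {u}"
    if "C \<in> \<C>" "u \<in> C" for C u
    using near_clique_ball[OF optimal that] ball[OF that(1)] by blast+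
  have finQ: "finite (Q C)" if "C \<in> \<C>" for C
  proof -
    have "Q C \<subseteq> V" using ball[OF that] CB(1)[OF that] N_subset by blast
    then show ?thesis by (rule fin_subset)
  qed
  have in\<D>: "\<exists>C. C \<in> \<D> \<and> C \<in> \<C> \<and> u \<in> C \<and> cl u = C" if "u \<in> \<Union>\<D>" for u
    using that D\<C> cl by blast
  have U1: "U u 1 = C" if "C \<in> \<C>" "u \<in> C" for C u
    using that cl[OF that] by (auto simp: U_def)
  have U2: "U u 2 = Q C" if "C \<in> \<C>" "u \<in> C" for C u
    using that cl[OF that] by (auto simp: U_def)
  have Ucases: thesis
    if "\<And>C. C \<in> \<C> \<Longrightarrow> u \<in> C \<Longrightarrow> U u k = C \<Longrightarrow> k = 1 \<Longrightarrow> thesis"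
      "\<And>C. C \<in> \<C> \<Longrightarrow> u \<in> C \<Longrightarrow> U u k = Q C \<Longrightarrow> k = 2 \<Longrightarrow> thesis"
      "U u k = {} \<Longrightarrow> thesis" for u k thesis
  proof -
    consider "u \<in> \<Union>\<C>" "k = 1" | "u \<in> \<Union>\<C>" "k = 2"
      | "\<not> (u \<in> \<Union>\<C> \<and> k = 1)" "\<not> (u \<in> \<Union>\<C> \<and> k = 2)" by blast
    then show thesis
    proof cases
      case 1
      then obtain C where "C \<in> \<C>" "u \<in> C" by blast
      then show thesis using that(1) U1 1 by simp
    next
      case 2
      then obtain C where "C \<in> \<C>" "u \<in> C" by blast
      then show thesis using that(2) U2 2 by simp
    next
      case 3
      then have "U u k = {}" unfolding U_def by (simp only: if_False)
      then show thesis by (rule that(3))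
    qed
  qed
  have "\<exists>S \<phi>. S \<subseteq> W \<and> \<phi> ` S \<subseteq> {..<K} \<and> (\<forall>v\<in>S. \<forall>w\<in>S. adj v w \<longrightarrow> \<phi> v \<noteq> \<phi> w) \<and>
    (\<forall>u\<in>V. \<forall>k<3. real (card (S \<inter> U u k)) \<le> e u k) \<and>
    (\<forall>u\<in>\<Union>\<D>. \<exists>Y'\<subseteq>Y (cl u). G \<le> card Y' \<and>
       (\<forall>y\<in>Y'. y \<in> S \<and> R (cl u) y \<inter> S = {} \<and> (\<exists>x\<in>X0 (cl u) - N y. x \<in> S \<and> \<phi> x = (\<phi> y :: nat))))"
  proof (rule random_partial_colouring[OF finV WV sym _ density_bounds _ _ _ _ _ p _ L theta_bound[OF D] decay_le_one fail local_lemma_bound[OF D],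
        where U = U and e = e and Z = Z and Y = "\<lambda>u. Y (cl u)" and X = "\<lambda>u y. X0 (cl u) - N y"
          and R = "\<lambda>u. R (cl u)" and Dm = "\<Union>\<D>"])
    show "card {w \<in> V. adj v w} \<le> D" if "v \<in> V" for v using degD[OF that] by (simp add: nb_def)
    show "U u k \<subseteq> (nbrel V adj ^^ 2) `` {u}" if "u \<in> V" for u k
      by (rule Ucases[of u k]) (use Cball in auto)
    show "2 powr (- e u k) * exp (q * real K * real (card (U u k))) \<le> pp" if "u \<in> V" for u k
    proof -
      have *: "2 powr (- x) * exp (q * real K * real (card S)) \<le> pp"
        if "2 powr (- x) * exp (q * real K * real b) \<le> pp" "card S \<le> b" for x b and S :: "'a set"
      proof -
        have "q * real K * real (card S) \<le> q * real K * real b" using that(2) density_bounds by (intro mult_left_mono) auto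
        then have "2 powr (- x) * exp (q * real K * real (card S)) \<le> 2 powr (- x) * exp (q * real K * real b)"
          by (intro mult_left_mono) auto
        then show ?thesis using that(1) by linarith
      qed
      show ?thesis
      proof (rule Ucases[of u k])
        fix C assume "C \<in> \<C>" "U u k = C" "k = 1"
        moreover from this have "card C \<le> D" using CB(3)[of C] by simp
        ultimately show ?thesis using *[OF e1] by (simp add: e_def)
      next
        fix C assume "C \<in> \<C>" "U u k = Q C" "k = 2"
        moreover from this have "card (Q C) \<le> bs" using bs by simp
        ultimately show ?thesis using *[OF e2] by (simp add: e_def)
      next
        assume "U u k = {}"
        then show ?thesis using *[OF e1, of "U u k"] *[OF e2, of "U u k"] by (simp add: e_def)
      qed
    qed
    show "\<Union>\<D> \<subseteq> V" using D\<C> CB(1) by blast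
    show "Z u \<subseteq> (nbrel V adj ^^ 2) `` {u}" if "u \<in> \<Union>\<D>" for u
      using in\<D>[OF that] Cball by (fastforce simp: Z_def)
    show "demand adj W (Y (cl u)) (Z u) (\<lambda>y. X0 (cl u) - N y) (R (cl u)) n" if u: "u \<in> \<Union>\<D>" for u
    proof -
      obtain C where C: "C \<in> \<D>" "C \<in> \<C>" "u \<in> C" "cl u = C" using in\<D>[OF u] by blast
      have YB: "Y C \<subseteq> Q C" "\<And>y. y \<in> Y C \<Longrightarrow> R C y \<subseteq> Q C" using Q[OF C(1)] by auto
      have ZC: "Z u = (C \<union> Q C) \<inter> W" using C by (simp add: Z_def)
      show ?thesis
        unfolding C(4)
      proof
        show "finite W" using WV fin_subset by blast
        show "Z u \<subseteq> W" by (simp add: Z_def)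
        show "Y C \<subseteq> Z u" using YB(1) Y[OF C(1)] ZC by blast
        show "adj v u" if "adj u v" for u v using sym that .
        show "\<not> adj u u" for u by (rule irr)
        show "X0 C - N y \<subseteq> Z u" for y using X0[OF C(1)] ZC by blast
        show "R C y \<subseteq> Z u" if "y \<in> Y C" for y using YB(2)[OF that] R[OF C(1) that] ZC by blast
        show "x \<noteq> y \<and> \<not> adj x y" if "y \<in> Y C" "x \<in> X0 C - N y" for y x
          using that X0[OF C(1)] Y[OF C(1)] WV sym by (auto simp: nb_def)
        show "y \<notin> R C y'" if "y \<in> Y C" "y' \<in> Y C" for y y'
          using R[OF C(1), of y] disj[OF C(1) that] that by (cases "y = y'") auto
        show "x \<notin> R C y'" if "x \<in> X0 C - N y" "y' \<in> Y C" for y x y'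
          using R[OF C(1) that(2)] that(1) by blast
        show "R C y \<inter> R C y' = {}" if "y \<in> Y C" "y' \<in> Y C" "y \<noteq> y'" for y y'
          using disj[OF C(1) that] by blast
        show "card (R C y) \<le> 2" if "y \<in> Y C" for y using R[OF C(1) that] by blast
        show "card (Z u \<union> {w \<in> W. adj w y \<or> adj w x}) \<le> n" if y: "y \<in> Y C" and x: "x \<in> X0 C - N y" for y x
        proof -
          have xC: "x \<in> C" using x X0[OF C(1)] by auto
          have yV: "y \<in> V" using y Y[OF C(1)] WV by auto
          \<comment> \<open>The neighbours of \<open>x\<close> inside \<open>C\<close> are not
            counted again, so \<open>C\<close> and \<open>N x - C\<close> contribute only
            \<open>D + 1\<close> together.\<close>
          have "Z u \<union> {w \<in> W. adj w y \<or> adj w x} \<subseteq> C \<union> Q C \<union> N y \<union> (N x - C)"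
            using WV sym unfolding ZC by (auto simp: nb_def)
          then have "card (Z u \<union> {w \<in> W. adj w y \<or> adj w x}) \<le> card (C \<union> Q C \<union> N y \<union> (N x - C))"
            using CB(4)[OF C(2)] finQ[OF C(2)] by (intro card_mono) auto
          also have "\<dots> \<le> card C + card (Q C) + card (N y) + card (N x - C)"
            by (meson card_Un_le add_right_mono order_trans)
          also have "\<dots> \<le> 2 * D + 1 + bs"
            using card_ext[OF optimal C(2) xC] degD[OF yV] bs[OF C(2)] by simp
          finally show ?thesis using n by simp
        qed
      qed
    qed
    show "real M \<le> real (card (avail (Y (cl u)) (\<lambda>y. X0 (cl u) - N y) (R (cl u)) F))"
      if u: "u \<in> \<Union>\<D>" and F: "F \<subseteq> W" and caps: "\<forall>k<3. real (card (F \<inter> U u k)) \<le> e u k" for u F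
    proof -
      obtain C where C: "C \<in> \<D>" "C \<in> \<C>" "u \<in> C" "cl u = C" using in\<D>[OF u] by blast
      have capC: "real (card (F \<inter> C)) \<le> e1" "real (card (F \<inter> Q C)) \<le> e2"
        using spec[OF caps, of 1] spec[OF caps, of 2] U1[OF C(2,3)] U2[OF C(2,3)] by (simp_all add: e_def)
      define Y1 where "Y1 = {y \<in> Y C. insert y (R C y) \<inter> F = {}}"
      define X1 where "X1 y = X0 C - N y - F" for y
      have finY: "finite (Y C)" using Y[OF C(1)] WV fin_subset by (meson Diff_subset order_trans)
      have "card (Y C - Y1) \<le> card (F \<inter> Q C)"
      proof -
        let ?g = "\<lambda>y. insert y (R C y)"
        have fin: "finite (\<Union>(?g ` Y C))" by (rule finite_subset[OF Q[OF C(1)] finQ[OF C(2)]])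
        have "Y C - Y1 = {y \<in> Y C. ?g y \<inter> F \<noteq> {}}" by (auto simp: Y1_def)
        then have "card (Y C - Y1) \<le> card (F \<inter> \<Union>(?g ` Y C))"
          using card_disjoint_sets_hit[OF fin disj[OF C(1)], of F] by simp
        also have "\<dots> \<le> card (F \<inter> Q C)" using Q[OF C(1)] finQ[OF C(2)] by (intro card_mono) auto
        finally show ?thesis .
      qed
      moreover have "card (Y C - Y1) = card (Y C) - card Y1" "card Y1 \<le> card (Y C)"
        using finY by (auto simp: Y1_def intro: card_Diff_subset card_mono)
      ultimately have cY1: "real (card (Y C)) - e2 \<le> real (card Y1)" using capC(2) by linarith
      have cX1: "real (card (X0 C)) - real (D + 3 - card C) - e1 \<le> real (card (X1 y))" if y: "y \<in> Y1" for y
      proof -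
        have finX: "finite (X0 C)" using X0[OF C(1)] CB(4)[OF C(2)] finite_subset by blast
        have "X0 C \<subseteq> X1 y \<union> (N y \<inter> C) \<union> (F \<inter> C)" using X0[OF C(1)] by (auto simp: X1_def)
        then have "card (X0 C) \<le> card (X1 y \<union> (N y \<inter> C) \<union> (F \<inter> C))"
          using finX CB(4)[OF C(2)] by (intro card_mono) (auto simp: X1_def)
        also have "\<dots> \<le> card (X1 y) + card (N y \<inter> C) + card (F \<inter> C)"
          by (meson card_Un_le add_right_mono order_trans)
        finally show ?thesis using capC(1) small[OF C(1), of y] y by (auto simp: Y1_def)
      qed
      let ?g = "\<lambda>(y, x). {y, x}"
      have Y1C: "y \<notin> C" if "y \<in> Y1" for y using that Y[OF C(1)] by (auto simp: Y1_def)
      have X1C: "x \<in> C" if "x \<in> X1 y" for x y using that X0[OF C(1)] by (auto simp: X1_def)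
      have "inj_on ?g (Sigma Y1 X1)"
        unfolding inj_on_def using Y1C X1C by (auto simp: doubleton_eq_iff)
      then have "card (?g ` Sigma Y1 X1) = card (Sigma Y1 X1)" by (rule card_image)
      also have "\<dots> = (\<Sum>y\<in>Y1. card (X1 y))"
        using finY X0[OF C(1)] CB(4)[OF C(2)]
        by (intro card_SigmaI) (auto simp: Y1_def X1_def intro: finite_subset)
      finally have cg: "card (?g ` Sigma Y1 X1) = (\<Sum>y\<in>Y1. card (X1 y))" .
      have sub: "?g ` Sigma Y1 X1 \<subseteq> avail (Y C) (\<lambda>y. X0 C - N y) (R C) F"
      proof
        fix s assume "s \<in> ?g ` Sigma Y1 X1"
        then obtain y x where "s = {y, x}" "y \<in> Y1" "x \<in> X1 y" by auto
        then show "s \<in> avail (Y C) (\<lambda>y. X0 C - N y) (R C) F"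
          unfolding avail_def by (intro CollectI exI[of _ y] exI[of _ x]) (auto simp: Y1_def X1_def)
      qed
      have fin: "finite (avail (Y C) (\<lambda>y. X0 C - N y) (R C) F)"
        by (rule finite_subset[of _ "Pow V"])
          (use Y[OF C(1)] X0[OF C(1)] WV finV in \<open>auto simp: avail_def\<close>)
      let ?a = "real (card (Y C)) - e2" and ?b = "real (card (X0 C)) - real (D + 3 - card C) - e1"
      have "real M \<le> ?a * ?b" using Nb[OF C(1)] by blast
      also have "\<dots> \<le> real (card Y1) * ?b" using cY1 Nb[OF C(1)] by (intro mult_right_mono) auto
      also have "\<dots> = (\<Sum>y\<in>Y1. ?b)" by simp
      also have "\<dots> \<le> (\<Sum>y\<in>Y1. real (card (X1 y)))" by (rule sum_mono[OF cX1])
      also have "\<dots> = real (card (?g ` Sigma Y1 X1))" unfolding cg by simp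
      also have "\<dots> \<le> real (card (avail (Y C) (\<lambda>y. X0 C - N y) (R C) F))"
        using card_mono[OF fin sub] by simp
      finally show ?thesis unfolding C(4) .
    qed
  qed
  then obtain S \<phi> where S: "S \<subseteq> W" "\<phi> ` S \<subseteq> {..<K}" "\<forall>v\<in>S. \<forall>w\<in>S. adj v w \<longrightarrow> \<phi> v \<noteq> \<phi> w"
    "\<forall>u\<in>V. \<forall>k<3. real (card (S \<inter> U u k)) \<le> e u k"
    "\<forall>u\<in>\<Union>\<D>. \<exists>Y'\<subseteq>Y (cl u). G \<le> card Y' \<and>
       (\<forall>y\<in>Y'. y \<in> S \<and> R (cl u) y \<inter> S = {} \<and> (\<exists>x\<in>X0 (cl u) - N y. x \<in> S \<and> \<phi> x = \<phi> y))"
    by (elim exE conjE) (rule that)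
  have ex_in: "\<exists>u. u \<in> C" if "C \<in> \<C>" for C
    using optimal_clique(3)[OF optimal that] D by (auto simp: ex_in_conv)
  show ?thesis
  proof (rule exI[of _ S], rule exI[of _ \<phi>], intro conjI ballI)
    show "S \<subseteq> W" by (rule S(1))
    show "proper_on adj K S \<phi>" using S(2,3) by (simp add: proper_on_def)
    show "real (card (S \<inter> C)) \<le> e1" "real (card (S \<inter> Q C)) \<le> e2" if C: "C \<in> \<C>" for C
    proof -
      obtain u where u: "u \<in> C" using ex_in[OF C] by blast
      have "u \<in> V" using u CB(1)[OF C] by auto
      then have "real (card (S \<inter> U u 1)) \<le> e u 1" "real (card (S \<inter> U u 2)) \<le> e u 2" using S(4) by simp_all
      then show "real (card (S \<inter> C)) \<le> e1" "real (card (S \<inter> Q C)) \<le> e2"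
        using U1[OF C u] U2[OF C u] by (simp_all add: e_def)
    qed
    show "\<exists>Y'\<subseteq>Y C. G \<le> card Y' \<and>
       (\<forall>y\<in>Y'. y \<in> S \<and> R C y \<inter> S = {} \<and> (\<exists>x\<in>X0 C - N y. x \<in> S \<and> \<phi> x = \<phi> y))" if C: "C \<in> \<D>" for C
    proof -
      have CC: "C \<in> \<C>" using C D\<C> by auto
      obtain u where u: "u \<in> C" using ex_in[OF CC] by blast
      have "u \<in> \<Union>\<D>" using u C by auto
      from bspec[OF S(5) this] show ?thesis unfolding cl[OF CC u] .
    qed
  qed
qed

section \<open>Repetitions around sparse vertices\<close>

definition sparse :: "'a \<Rightarrow> bool" where
  "sparse u \<longleftrightarrow> u \<in> V \<and> D * D \<le> 100 * card {(x, y). x \<in> N u \<and> y \<in> N u \<and> x \<noteq> y \<and> \<not> adj x y}"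

text \<open>Three vertices are required for two savings, because two of them may have only each
  other as partners.\<close>

lemma saves_of_three:
  assumes Y: "Y \<subseteq> N u \<inter> S" "3 \<le> card Y" and x: "\<And>y. y \<in> Y \<Longrightarrow> \<exists>x\<in>N u \<inter> S. x \<noteq> y \<and> \<phi> x = \<phi> y"
  shows "saves \<phi> S u 2"
proof -
  obtain Y3 where "Y3 \<subseteq> Y" "card Y3 = 3" using Y(2) by (meson obtain_subset_with_card_n)
  then obtain y1 y2 y3 where y: "y1 \<in> Y" "y2 \<in> Y" "y3 \<in> Y" "y1 \<noteq> y2" "y1 \<noteq> y3" "y2 \<noteq> y3"
    by (auto simp: card_3_iff)
  have yS: "y1 \<in> N u \<inter> S" "y2 \<in> N u \<inter> S" "y3 \<in> N u \<inter> S" using y Y by auto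
  have gen: "saves \<phi> S u 2" if "a \<in> N u \<inter> S" "b \<in> N u \<inter> S" "a \<noteq> b"
    "pa \<in> N u \<inter> S - {a, b}" "pb \<in> N u \<inter> S - {a, b}" "\<phi> pa = \<phi> a" "\<phi> pb = \<phi> b" for a b pa pb
  proof (rule saves_I[where T = "{a, b}"])
    show "\<exists>x\<in>N u \<inter> S - {a, b}. \<phi> x = \<phi> t" if "t \<in> {a, b}" for t
      using that \<open>pa \<in> _\<close> \<open>pb \<in> _\<close> \<open>\<phi> pa = _\<close> \<open>\<phi> pb = _\<close> by blast
  qed (use that in auto)
  obtain x1 where x1: "x1 \<in> N u \<inter> S" "x1 \<noteq> y1" "\<phi> x1 = \<phi> y1" using x[OF y(1)] by blast
  obtain x2 where x2: "x2 \<in> N u \<inter> S" "x2 \<noteq> y2" "\<phi> x2 = \<phi> y2" using x[OF y(2)] by blast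
  obtain x3 where x3: "x3 \<in> N u \<inter> S" "x3 \<noteq> y3" "\<phi> x3 = \<phi> y3" using x[OF y(3)] by blast
  consider "x1 \<noteq> y2" "x2 \<noteq> y1" | "\<phi> y1 = \<phi> y2" "\<phi> y3 = \<phi> y1" | "\<phi> y1 = \<phi> y2" "\<phi> y3 \<noteq> \<phi> y1"
    using x1 x2 by metis
  then show ?thesis
  proof cases
    case 1
    show ?thesis by (rule gen[of y1 y2 x1 x2]) (use 1 x1 x2 yS y in auto)
  next
    case 2
    show ?thesis by (rule gen[of y1 y2 y3 y3]) (use 2 yS y in auto)
  next
    case 3
    then have "x3 \<noteq> y1" using x3 by auto
    show ?thesis by (rule gen[of y1 y3 y2 x3]) (use 3 x3 \<open>x3 \<noteq> y1\<close> yS y in auto)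
  qed
qed

text \<open>Of at least D^2 / 100 ordered nonadjacent pairs, at most 2 (D / 400) D meet
  \<open>F\<close>. The remaining D^2 / 200 ordered pairs give half as many unordered ones.\<close>

lemma card_avail_sparse:
  assumes u: "sparse u" and F: "real (card (F \<inter> N u)) \<le> real D / 400"
  shows "real (D * D div 400) \<le> real (card (avail (N u) (\<lambda>y. {x \<in> N u. x \<noteq> y \<and> \<not> adj y x}) (\<lambda>_. {}) F))"
proof -
  define P where "P = {(x, y). x \<in> N u \<and> y \<in> N u \<and> x \<noteq> y \<and> \<not> adj x y}"
  define PF where "PF = {(x, y). (x, y) \<in> P \<and> x \<notin> F \<and> y \<notin> F}"
  let ?g = "\<lambda>(y, x). {y, x}" and ?av = "avail (N u) (\<lambda>y. {x \<in> N u. x \<noteq> y \<and> \<not> adj y x}) (\<lambda>_. {}) F"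
  have uV: "u \<in> V" using u by (simp add: sparse_def)
  have finP: "finite P" by (rule finite_subset[of _ "N u \<times> N u"]) (auto simp: P_def)
  have finPF: "finite PF" by (rule finite_subset[OF _ finP]) (auto simp: PF_def)
  have "P - PF \<subseteq> (F \<inter> N u) \<times> N u \<union> N u \<times> (F \<inter> N u)" by (auto simp: P_def PF_def)
  then have "card (P - PF) \<le> card ((F \<inter> N u) \<times> N u \<union> N u \<times> (F \<inter> N u))" by (intro card_mono) auto
  also have "\<dots> \<le> card ((F \<inter> N u) \<times> N u) + card (N u \<times> (F \<inter> N u))" by (rule card_Un_le)
  also have "\<dots> = 2 * (card (F \<inter> N u) * card (N u))" by (simp add: card_cartesian_product)
  finally have "real (card (P - PF)) \<le> 2 * (real (card (F \<inter> N u)) * real (card (N u)))"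
    by (metis of_nat_le_iff of_nat_mult of_nat_numeral)
  also have "\<dots> \<le> 2 * (real D / 400 * real D)"
    using F degD[OF uV] by (intro mult_left_mono mult_mono) auto
  finally have d: "real (card (P - PF)) \<le> real D * real D / 200" by simp
  have "card P \<le> card (P - PF) + card PF"
    using card_mono[of "(P - PF) \<union> PF" P] card_Un_le[of "P - PF" PF] finP finPF by fastforce
  moreover have "real D * real D \<le> 100 * real (card P)"
    using u unfolding sparse_def P_def[symmetric] by (metis of_nat_le_iff of_nat_mult of_nat_numeral)
  ultimately have PFb: "real D * real D / 200 \<le> real (card PF)" using d by linarith
  have sub: "?g ` PF \<subseteq> ?av"
  proof
    fix s assume "s \<in> ?g ` PF"
    then obtain y x where "s = {y, x}" "(y, x) \<in> PF" by auto
    then show "s \<in> ?av" unfolding avail_def by (intro CollectI exI[of _ y] exI[of _ x]) (auto simp: P_def PF_def)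
  qed
  have "?av \<subseteq> Pow V" using N_subset[of u] by (auto simp: avail_def)
  then have finav: "finite ?av" using finV finite_subset by blast
  have "PF \<subseteq> (\<Union>s\<in>?g ` PF. {p \<in> PF. ?g p = s})" by auto
  then have "card PF \<le> card (\<Union>s\<in>?g ` PF. {p \<in> PF. ?g p = s})" using finPF by (intro card_mono) auto
  also have "\<dots> \<le> (\<Sum>s\<in>?g ` PF. card {p \<in> PF. ?g p = s})" using finPF by (intro card_UN_le) auto
  also have "\<dots> \<le> (\<Sum>s\<in>?g ` PF. 2)"
  proof (rule sum_mono)
    fix s assume "s \<in> ?g ` PF"
    then obtain y x where s: "s = {y, x}" by auto
    have "{p \<in> PF. ?g p = s} \<subseteq> {(y, x), (x, y)}"
    proof
      fix p assume "p \<in> {p \<in> PF. ?g p = s}"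
      then have g: "?g p = {y, x}" using s by simp
      obtain a b where ab: "p = (a, b)" by (cases p)
      then have "{a, b} = {y, x}" using g by simp
      then show "p \<in> {(y, x), (x, y)}" using ab by (simp add: doubleton_eq_iff)
    qed
    then have "card {p \<in> PF. ?g p = s} \<le> card {(y, x), (x, y)}" by (intro card_mono) auto
    also have "\<dots> \<le> 2" using card_insert_le_m1[of 2 "{(x, y)}" "(y, x)"] by simp
    finally show "card {p \<in> PF. ?g p = s} \<le> 2" .
  qed
  also have "\<dots> = 2 * card (?g ` PF)" by simp
  also have "\<dots> \<le> 2 * card ?av" using card_mono[OF finav sub] by simp
  finally have "real (card PF) \<le> 2 * real (card ?av)" by linarith
  then have "real (D * D) / 400 \<le> real (card ?av)" using PFb by simp
  moreover have "real (D * D div 400) \<le> real (D * D) / 400" by linarith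
  ultimately show ?thesis by linarith
qed

text \<open>\<open>U1\<close> and \<open>U2\<close> are placeholders for the clique of a vertex and
  the vertices of its blocks. Capping the colours spent there leaves most blocks intact for the
  later stages.\<close>

lemma sparse_stage:
  assumes U1: "\<And>u. u \<in> V \<Longrightarrow> U1 u \<subseteq> (nbrel V adj ^^ 2) `` {u} \<and> card (U1 u) \<le> D"
    and U2: "\<And>u. u \<in> V \<Longrightarrow> U2 u \<subseteq> (nbrel V adj ^^ 2) `` {u} \<and> card (U2 u) \<le> D"
  shows "\<exists>S \<phi>. S \<subseteq> V \<and> proper_on adj (3 * D div 1000) S \<phi> \<and>
    (\<forall>u\<in>V. real (card (S \<inter> U1 u)) \<le> real D / 400 \<and> real (card (S \<inter> U2 u)) \<le> real D / 400) \<and>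
    (\<forall>u. sparse u \<longrightarrow> saves \<phi> S u 2)"
proof -
  define K where "K = 3 * D div 1000"
  \<comment> \<open>Just below 1/400 * 1/4 * 1/8: the supply of pairs, the squared density and the
    survival bound.\<close>
  define p :: real where "p = 77/1000000"
  define L where "L = nat \<lfloor>p / 5 * real D\<rfloor>"
  define U where "U u k = (if k = 0 then N u else if k = 1 then U1 u else U2 u)" for u and k :: nat
  note Dr = Dreal[OF D]
  have K: "real K \<le> 3/1000 * real D" "3/1000 * real D - 1 \<le> real K" unfolding K_def by linarith+
  have L: "real L \<le> p / 5 * real D" "p / 5 * real D - 1 \<le> real L"
    unfolding L_def using Dr by (auto simp: p_def) linarith+
  have p: "0 \<le> p" "p \<le> 1" by (auto simp: p_def)
  have "\<exists>S \<phi>. S \<subseteq> V \<and> \<phi> ` S \<subseteq> {..<K} \<and> (\<forall>v\<in>S. \<forall>w\<in>S. adj v w \<longrightarrow> \<phi> v \<noteq> \<phi> w) \<and>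
    (\<forall>u\<in>V. \<forall>k<3. real (card (S \<inter> U u k)) \<le> real D / 400) \<and>
    (\<forall>u\<in>{u. sparse u}. \<exists>Y'\<subseteq>N u. 3 \<le> card Y' \<and>
       (\<forall>y\<in>Y'. y \<in> S \<and> {} \<inter> S = {} \<and> (\<exists>x\<in>{x \<in> N u. x \<noteq> y \<and> \<not> adj y x}. x \<in> S \<and> \<phi> x = (\<phi> y :: nat))))"
  proof (rule random_partial_colouring[OF finV order_refl sym _ density_bounds _ _ _ _ _ p _ _ growth_bound[OF D p L(1)] theta_bound[OF D] decay_le_one _
        local_lemma_bound[OF D], where U = U and Z = N and Y = N and X = "\<lambda>u y. {x \<in> N u. x \<noteq> y \<and> \<not> adj y x}"
          and R = "\<lambda>_ _. {}" and Dm = "{u. sparse u}" and e = "\<lambda>_ _. real D / 400" and N = "D * D div 400" and n = "3 * D"])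
    show "card {w \<in> V. adj v w} \<le> D" if "v \<in> V" for v using degD[OF that] by (simp add: nb_def)
    show "U u k \<subseteq> (nbrel V adj ^^ 2) `` {u}" if "u \<in> V" for u k
      using U1[OF that] U2[OF that] in_ball_two(1)[OF that] by (simp add: U_def)
    show "2 powr (- (real D / 400)) * exp (q * real K * real (card (U u k))) \<le> pp" if "u \<in> V" for u k
    proof -
      have "card (U u k) \<le> D" using U1[OF that] U2[OF that] degD[OF that] by (simp add: U_def)
      then have "q * real K * real (card (U u k)) \<le> q * real K * real D" using density_bounds by (intro mult_left_mono) auto
      also have "\<dots> = real K / 2" using Dr by simp
      finally have "q * real K * real (card (U u k)) + real D / 40000000 \<le> 2/3 * (real D / 400)" using K Dr by linarith
      then show ?thesis using cap_bound[OF D, of "q * real K * real (card (U u k))" "real D / 40000000" "real D / 400"] Dr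
        by simp
    qed
    show "{u. sparse u} \<subseteq> V" by (auto simp: sparse_def)
    show "demand adj V (N u) (N u) (\<lambda>y. {x \<in> N u. x \<noteq> y \<and> \<not> adj y x}) (\<lambda>_. {}) (3 * D)"
      if "u \<in> {u. sparse u}" for u
    proof
      show "card (N u \<union> {w \<in> V. adj w y \<or> adj w x}) \<le> 3 * D"
        if "y \<in> N u" "x \<in> {x \<in> N u. x \<noteq> y \<and> \<not> adj y x}" for y x
      proof -
        have V: "y \<in> V" "x \<in> V" "u \<in> V" using that \<open>u \<in> {u. sparse u}\<close> by (auto simp: nb_def sparse_def)
        have "N u \<union> {w \<in> V. adj w y \<or> adj w x} \<subseteq> N u \<union> N y \<union> N x" using sym by (auto simp: nb_def)
        then have "card (N u \<union> {w \<in> V. adj w y \<or> adj w x}) \<le> card (N u \<union> N y \<union> N x)" by (intro card_mono) auto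
        also have "\<dots> \<le> card (N u) + card (N y) + card (N x)" by (meson card_Un_le add_right_mono order_trans)
        finally show ?thesis using degD[OF V(1)] degD[OF V(2)] degD[OF V(3)] by simp
      qed
    qed (use finV N_subset sym irr in auto)
    show "N u \<subseteq> (nbrel V adj ^^ 2) `` {u}" if "u \<in> {u. sparse u}" for u
      using that in_ball_two(1) by (simp add: sparse_def)
    show "p \<le> real (D * D div 400) * q\<^sup>2 * (1 - q) ^ (3 * D)"
    proof (rule hit_bound[OF D _ _ survive_sparse[OF D], where \<nu> = "1/400"])
      have "real (D * D) / 400 - 1 \<le> real (D * D div 400)" by linarith
      then show "1/400 * (real D)\<^sup>2 - 1 \<le> real (D * D div 400)" by (simp add: power2_eq_square)
    qed (auto simp: p_def)
    show "real (D * D div 400) \<le> real (card (avail (N u) (\<lambda>y. {x \<in> N u. x \<noteq> y \<and> \<not> adj y x}) (\<lambda>_. {}) F))"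
      if "u \<in> {u. sparse u}" "\<forall>k<3. real (card (F \<inter> U u k)) \<le> real D / 400" for u F
      using that card_avail_sparse[of u F] spec[OF that(2), of 0] by (simp add: U_def)
    show "2 ^ 3 * ((1 - p / 4) ^ K + real K * (51/100) ^ L) \<le> pp"
    proof -
      have "2 ^ 3 * ((1 - p / 4) ^ K + real K * (51/100) ^ L) \<le> exp (- (real D / 40000000))"
      proof (rule fail_bound[OF D p])
        show "real K \<le> real D" using K Dr by linarith
        show "7/10 * real 3 + real D / 40000000 + 1 \<le> p / 4 * real K" using K Dr unfolding p_def by simp
        show "7/10 * real 3 + real D / 40000000 + 1 + real D / 100000000 \<le> 49/100 * real L"
          using L Dr unfolding p_def by simp
      qed
      then show ?thesis by simp
    qed
  qed
  then obtain S \<phi> where S: "S \<subseteq> V" "\<phi> ` S \<subseteq> {..<K}" "\<forall>v\<in>S. \<forall>w\<in>S. adj v w \<longrightarrow> \<phi> v \<noteq> \<phi> w"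
    "\<forall>u\<in>V. \<forall>k<3. real (card (S \<inter> U u k)) \<le> real D / 400"
    "\<forall>u\<in>{u. sparse u}. \<exists>Y'\<subseteq>N u. 3 \<le> card Y' \<and>
       (\<forall>y\<in>Y'. y \<in> S \<and> {} \<inter> S = {} \<and> (\<exists>x\<in>{x \<in> N u. x \<noteq> y \<and> \<not> adj y x}. x \<in> S \<and> \<phi> x = \<phi> y))"
    by (elim exE conjE) (rule that)
  show ?thesis
  proof (rule exI[of _ S], rule exI[of _ \<phi>], intro conjI ballI allI impI)
    show "S \<subseteq> V" by (rule S(1))
    show "proper_on adj (3 * D div 1000) S \<phi>" using S(2,3) by (simp add: proper_on_def K_def)
    fix u
    show "real (card (S \<inter> U1 u)) \<le> real D / 400" if "u \<in> V"
      using spec[OF bspec[OF S(4) that], of 1] by (simp add: U_def)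
    show "real (card (S \<inter> U2 u)) \<le> real D / 400" if "u \<in> V"
      using spec[OF bspec[OF S(4) that], of 2] by (simp add: U_def)
    show "saves \<phi> S u 2" if sp: "sparse u"
    proof -
      have su: "u \<in> {u. sparse u}" using sp by simp
      obtain Y' where Y': "Y' \<subseteq> N u" "3 \<le> card Y'"
        "\<forall>y\<in>Y'. y \<in> S \<and> {} \<inter> S = {} \<and> (\<exists>x\<in>{x \<in> N u. x \<noteq> y \<and> \<not> adj y x}. x \<in> S \<and> \<phi> x = \<phi> y)"
        using bspec[OF S(5) su] by (elim exE conjE) (rule that)
      show ?thesis
      proof (rule saves_of_three[OF _ Y'(2)])
        show "Y' \<subseteq> N u \<inter> S" using Y'(1,3) by blast
        fix y assume "y \<in> Y'"
        then obtain x where "x \<in> {x \<in> N u. x \<noteq> y \<and> \<not> adj y x}" "x \<in> S" "\<phi> x = \<phi> y" using Y'(3) by blast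
        then show "\<exists>x\<in>N u \<inter> S. x \<noteq> y \<and> \<phi> x = \<phi> y" by blast
      qed
    qed
  qed
qed

section \<open>Repetitions from blocks\<close>

lemma block_family_facts:
  assumes "optimal \<C>" "C \<in> \<C>" "block_family C M"
  shows "finite M" "card M = D div 20" "t \<in> M \<Longrightarrow> fst t \<in> C"
    "t \<in> M \<Longrightarrow> z \<in> {fst (snd t), snd (snd t)} \<Longrightarrow> z \<in> N (fst t) - C \<and> card (N z \<inter> C) + card C \<le> D + 3"
    "t \<in> M \<Longrightarrow> t' \<in> M \<Longrightarrow> t \<noteq> t' \<Longrightarrow> block_set t \<inter> block_set t' = {}"
    "(\<forall>t\<in>M. fst (snd t) \<noteq> snd (snd t)) \<or> (\<forall>t\<in>M. card (N (fst t)) < D)"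
proof -
  note b = assms(3)[unfolded block_family_def[OF assms(1,2)]]
  show "finite M" "card M = D div 20" using b by blast+
  show "fst t \<in> C" if "t \<in> M" using b that by (cases t) auto
  show "z \<in> N (fst t) - C \<and> card (N z \<inter> C) + card C \<le> D + 3"
    if "t \<in> M" "z \<in> {fst (snd t), snd (snd t)}"
  proof -
    obtain v y y' where t: "t = (v, y, y')" by (cases t)
    then have "y \<in> small_ext C v" "y' \<in> small_ext C v" using b that(1) by auto
    then show ?thesis using that(2) t by (auto simp: small_ext_def[OF assms(1,2)])
  qed
  show "block_set t \<inter> block_set t' = {}" if "t \<in> M" "t' \<in> M" "t \<noteq> t'" using b that by blast
  show "(\<forall>t\<in>M. fst (snd t) \<noteq> snd (snd t)) \<or> (\<forall>t\<in>M. card (N (fst t)) < D)" using b by auto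
qed

text \<open>A version of \<open>clique_stage\<close> indexed by blocks: \<open>f\<close> picks the
  outside neighbour to be coloured and \<open>r\<close> the part of the block to be kept free.
  Blocks are disjoint, so \<open>f\<close> is injective and the reserved set of a vertex is that of
  its block.\<close>

lemma block_stage:
  fixes M M' :: "'a set \<Rightarrow> ('a \<times> 'a \<times> 'a) set" and f :: "'a \<times> 'a \<times> 'a \<Rightarrow> 'a"
    and r :: "'a \<times> 'a \<times> 'a \<Rightarrow> 'a set" and X0 Q :: "'a set \<Rightarrow> 'a set"
  assumes optimal: "optimal \<C>" and D\<C>: "\<D> \<subseteq> \<C>" and WV: "W \<subseteq> V"
    and bf: "\<And>C. C \<in> \<D> \<Longrightarrow> block_family C (M C)" and M': "\<And>C. C \<in> \<D> \<Longrightarrow> M' C \<subseteq> M C"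
    and f: "\<And>t. f t \<in> {fst (snd t), snd (snd t)}" and r: "\<And>t. r t \<subseteq> block_set t - {f t}"
    and inW: "\<And>C t. C \<in> \<D> \<Longrightarrow> t \<in> M' C \<Longrightarrow> insert (f t) (r t) \<subseteq> W"
    and X0: "\<And>C. C \<in> \<D> \<Longrightarrow> X0 C \<subseteq> C \<inter> W - fst ` M C"
    and Q: "\<And>C. C \<in> \<D> \<Longrightarrow> (\<Union>t\<in>M' C. insert (f t) (r t)) \<subseteq> Q C"
    and ball: "\<And>C z. C \<in> \<C> \<Longrightarrow> z \<in> Q C \<Longrightarrow> z \<in> C \<or> (\<exists>v\<in>C. z \<in> N v)"
    and bs: "\<And>C. C \<in> \<C> \<Longrightarrow> card (Q C) \<le> bs"
    and e1: "2 powr (- e1) * exp (q * real K * real D) \<le> pp"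
    and e2: "2 powr (- e2) * exp (q * real K * real bs) \<le> pp"
    and Nb: "\<And>C. C \<in> \<D> \<Longrightarrow> e2 \<le> real (card (M' C)) \<and> 0 \<le> real (card (X0 C)) - real (D + 3 - card C) - e1 \<and>
      real NN \<le> (real (card (M' C)) - e2) * (real (card (X0 C)) - real (D + 3 - card C) - e1)"
    and n: "2 * D + 1 + bs \<le> n"
    and p: "0 \<le> p" "p \<le> 1" "p \<le> real NN * q\<^sup>2 * (1 - q) ^ n"
    and L: "(1 + q) ^ (2 * L) \<le> 1 + p / 4"
    and fail: "2 ^ G * ((1 - p / 4) ^ K + real K * (51/100) ^ L) \<le> pp"
  shows "\<exists>S \<phi>. S \<subseteq> W \<and> proper_on adj K S \<phi> \<and>
    (\<forall>C\<in>\<C>. real (card (S \<inter> C)) \<le> e1 \<and> real (card (S \<inter> Q C)) \<le> e2) \<and>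
    (\<forall>C\<in>\<D>. \<exists>M''\<subseteq>M' C. G \<le> card M'' \<and>
       (\<forall>t\<in>M''. f t \<in> S \<and> r t \<inter> S = {} \<and> (\<exists>x\<in>X0 C - N (f t). x \<in> S \<and> \<phi> x = \<phi> (f t))))"
proof -
  define Y where "Y C = f ` M' C" for C
  define R where "R C y = \<Union>(r ` {t \<in> M' C. f t = y})" for C y
  have bff: "finite (M C)" "t \<in> M C \<Longrightarrow> fst t \<in> C"
    "t \<in> M C \<Longrightarrow> z \<in> {fst (snd t), snd (snd t)} \<Longrightarrow> z \<in> N (fst t) - C \<and> card (N z \<inter> C) + card C \<le> D + 3"
    "t \<in> M C \<Longrightarrow> t' \<in> M C \<Longrightarrow> t \<noteq> t' \<Longrightarrow> block_set t \<inter> block_set t' = {}" if "C \<in> \<D>" for C t t' z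
    using block_family_facts[OF optimal _ bf[OF that]] that D\<C> by blast+
  have ftset: "f t \<in> block_set t" for t using f[of t] by (auto simp: block_set_eq)
  have inj: "inj_on f (M' C)" if C: "C \<in> \<D>" for C
  proof (rule inj_onI, rule ccontr)
    fix t t' assume h: "t \<in> M' C" "t' \<in> M' C" "f t = f t'" "t \<noteq> t'"
    then have "block_set t \<inter> block_set t' = {}" using bff(4)[OF C] M'[OF C] by blast
    then show False using ftset[of t] ftset[of t'] h(3) by auto
  qed
  have Rf: "R C (f t) = r t" if "C \<in> \<D>" "t \<in> M' C" for C t
  proof -
    have "{t' \<in> M' C. f t' = f t} = {t}" using inj[OF that(1)] that(2) by (auto simp: inj_on_def)
    then show ?thesis by (simp add: R_def)
  qed
  have fC: "f t \<in> N (fst t) - C" "card (N (f t) \<inter> C) + card C \<le> D + 3" "fst t \<in> C"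
    if "C \<in> \<D>" "t \<in> M' C" for C t
  proof -
    have "t \<in> M C" using that M' by blast
    then show "f t \<in> N (fst t) - C" "card (N (f t) \<inter> C) + card C \<le> D + 3" "fst t \<in> C"
      using bff(3)[OF that(1) \<open>t \<in> M C\<close> f[of t]] bff(2)[OF that(1) \<open>t \<in> M C\<close>] by blast+
  qed
  have "\<exists>S \<phi>. S \<subseteq> W \<and> proper_on adj K S \<phi> \<and>
    (\<forall>C\<in>\<C>. real (card (S \<inter> C)) \<le> e1 \<and> real (card (S \<inter> Q C)) \<le> e2) \<and>
    (\<forall>C\<in>\<D>. \<exists>Y'\<subseteq>Y C. G \<le> card Y' \<and>
       (\<forall>y\<in>Y'. y \<in> S \<and> R C y \<inter> S = {} \<and> (\<exists>x\<in>X0 C - N y. x \<in> S \<and> \<phi> x = \<phi> y)))"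
  proof (rule clique_stage[OF optimal D\<C> WV _ _ _ _ _ _ ball bs e1 e2 _ n p L fail])
    fix C assume C: "C \<in> \<D>"
    show "Y C \<subseteq> W - C"
    proof
      fix y assume "y \<in> Y C"
      then obtain t where "t \<in> M' C" "y = f t" by (auto simp: Y_def)
      then show "y \<in> W - C" using fC(1)[OF C] inW[OF C] by blast
    qed
    show "X0 C \<subseteq> C \<inter> W" using X0[OF C] by blast
    show "e2 \<le> real (card (Y C)) \<and> 0 \<le> real (card (X0 C)) - real (D + 3 - card C) - e1 \<and>
      real NN \<le> (real (card (Y C)) - e2) * (real (card (X0 C)) - real (D + 3 - card C) - e1)"
      using Nb[OF C] by (simp add: Y_def card_image[OF inj[OF C]])
    show "(\<Union>y\<in>Y C. insert y (R C y)) \<subseteq> Q C"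
    proof
      fix z assume "z \<in> (\<Union>y\<in>Y C. insert y (R C y))"
      then obtain t where "t \<in> M' C" "z \<in> insert (f t) (R C (f t))" by (auto simp: Y_def)
      then show "z \<in> Q C" using Q[OF C] Rf[OF C] by auto
    qed
    fix y assume "y \<in> Y C"
    then obtain t where t: "t \<in> M' C" "y = f t" by (auto simp: Y_def)
    show "card (N y \<inter> C) + card C \<le> D + 3" using fC(2)[OF C t(1)] t(2) by simp
    have tM: "t \<in> M C" using t M'[OF C] by blast
    show "R C y \<subseteq> W \<and> card (R C y) \<le> 2 \<and> R C y \<inter> X0 C = {} \<and> y \<notin> R C y"
    proof (intro conjI)
      have Ry: "R C y = r t" using Rf[OF C t(1)] t(2) by simp
      show "R C y \<subseteq> W" unfolding Ry using inW[OF C t(1)] by blast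
      show "y \<notin> R C y" unfolding Ry using r[of t] t(2) by blast
      have "card (r t) \<le> card (block_set t - {f t})" using r[of t] by (intro card_mono) (auto simp: block_set_eq)
      also have "\<dots> = card (block_set t) - 1" using ftset by simp
      also have "card (block_set t) \<le> 3"
        using card_insert_le_m1[of 3 "{fst (snd t), snd (snd t)}" "fst t"]
          card_insert_le_m1[of 2 "{snd (snd t)}" "fst (snd t)"] by (simp add: block_set_eq)
      finally show "card (R C y) \<le> 2" unfolding Ry by simp
      have "fst t \<notin> X0 C" using X0[OF C] tM by blast
      moreover have "fst (snd t) \<notin> C" "snd (snd t) \<notin> C"
        using bff(3)[OF C tM, of "fst (snd t)"] bff(3)[OF C tM, of "snd (snd t)"] by blast+
      ultimately show "R C y \<inter> X0 C = {}" unfolding Ry using r[of t] X0[OF C] by (auto simp: block_set_eq)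
    qed
    fix y' assume "y' \<in> Y C" and ne: "y \<noteq> y'"
    then obtain t' where t': "t' \<in> M' C" "y' = f t'" by (auto simp: Y_def)
    have "block_set t \<inter> block_set t' = {}" using bff(4)[OF C tM, of t'] t' M'[OF C] ne t by blast
    moreover have "insert y (R C y) \<subseteq> block_set t" "insert y' (R C y') \<subseteq> block_set t'"
      using Rf[OF C t(1)] Rf[OF C t'(1)] t(2) t'(2) r[of t] r[of t'] ftset by auto
    ultimately show "insert y (R C y) \<inter> insert y' (R C y') = {}" by blast
  qed
  then obtain S \<phi> where S: "S \<subseteq> W" "proper_on adj K S \<phi>"
    "\<forall>C\<in>\<C>. real (card (S \<inter> C)) \<le> e1 \<and> real (card (S \<inter> Q C)) \<le> e2"
    "\<forall>C\<in>\<D>. \<exists>Y'\<subseteq>Y C. G \<le> card Y' \<and>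
       (\<forall>y\<in>Y'. y \<in> S \<and> R C y \<inter> S = {} \<and> (\<exists>x\<in>X0 C - N y. x \<in> S \<and> \<phi> x = \<phi> y))"
    by (elim exE conjE) (rule that)
  have "\<exists>M''\<subseteq>M' C. G \<le> card M'' \<and>
       (\<forall>t\<in>M''. f t \<in> S \<and> r t \<inter> S = {} \<and> (\<exists>x\<in>X0 C - N (f t). x \<in> S \<and> \<phi> x = \<phi> (f t)))" if C: "C \<in> \<D>" for C
  proof -
    obtain Y' where Y': "Y' \<subseteq> Y C" "G \<le> card Y'"
      "\<forall>y\<in>Y'. y \<in> S \<and> R C y \<inter> S = {} \<and> (\<exists>x\<in>X0 C - N y. x \<in> S \<and> \<phi> x = \<phi> y)"
      using bspec[OF S(4) C] by (elim exE conjE) (rule that)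
    let ?M = "{t \<in> M' C. f t \<in> Y'}"
    have finM: "finite ?M" using bff(1)[OF C] M'[OF C] finite_subset by fastforce
    have "f ` ?M = Y'" using Y'(1) by (auto simp: Y_def)
    then have "card Y' \<le> card ?M" using card_image_le[OF finM, of f] by simp
    then have "G \<le> card ?M" using Y'(2) by simp
    moreover have "f t \<in> S \<and> r t \<inter> S = {} \<and> (\<exists>x\<in>X0 C - N (f t). x \<in> S \<and> \<phi> x = \<phi> (f t))" if "t \<in> ?M" for t
    proof -
      have "R C (f t) = r t" using Rf[OF C] that by simp
      moreover have "f t \<in> Y'" using that by simp
      ultimately show ?thesis using bspec[OF Y'(3), of "f t"] by simp
    qed
    ultimately show ?thesis by (intro exI[of _ ?M]) blast
  qed
  then show ?thesis using S(1-3) by blast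
qed

section \<open>Combination of the three stages\<close>

lemma no_counterexample: False
proof -
  note Dr = Dreal[OF D]
  have DD: "7400000000 * real D \<le> real D * real D" using Dr by (intro mult_right_mono) auto
  obtain \<C> where optimal: "optimal \<C>" using optimal_exists by blast
  have "\<forall>C\<in>\<C>. \<exists>m. block_family C m" using block_family_exists[OF optimal] by blast
  then obtain M where bf: "\<And>C. C \<in> \<C> \<Longrightarrow> block_family C (M C)"
    using bchoice[of \<C> block_family] by blast
  note bff = block_family_facts[OF optimal _ bf]
  have disjC: "C \<inter> C' = {}" if "C \<in> \<C>" "C' \<in> \<C>" "C \<noteq> C'" for C C'
    using optimal that by (auto simp: optimal_def clique_family_def)
  have Cf: "C \<subseteq> V" "complete_on adj C" "93/100 * real D \<le> real (card C)" "card C \<le> D - 1" "finite C"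
    if "C \<in> \<C>" for C
    using optimal_clique[OF optimal that] by auto
  define m0 where "m0 = D div 20"
  have m0: "real m0 \<le> real D / 20" "real D / 20 - 1 \<le> real m0" unfolding m0_def by linarith+
  define BS where "BS C = \<Union>(block_set ` M C)" for C
  have BSn: "z \<in> C \<or> (\<exists>v\<in>C. z \<in> N v)" if C: "C \<in> \<C>" and z: "z \<in> BS C" for C z
  proof -
    obtain t where t: "t \<in> M C" "z \<in> block_set t" using z by (auto simp: BS_def)
    then consider "z = fst t" | "z \<in> {fst (snd t), snd (snd t)}" by (auto simp: block_set_eq)
    then show ?thesis
      using bff(3)[OF C C t(1)] bff(4)[OF C C t(1), of z] by cases blast+
  qed
  have BSc: "card (BS C) \<le> 3 * m0" "finite (BS C)" if "C \<in> \<C>" for C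
  proof -
    have c3: "card (block_set t) \<le> 3" for t :: "'a \<times> 'a \<times> 'a"
      using card_insert_le_m1[of 3 "{fst (snd t), snd (snd t)}" "fst t"]
        card_insert_le_m1[of 2 "{snd (snd t)}" "fst (snd t)"] by (simp add: block_set_eq)
    have "card (BS C) \<le> (\<Sum>t\<in>M C. card (block_set t))" unfolding BS_def by (rule card_UN_le[OF bff(1)[OF that that]])
    also have "\<dots> \<le> (\<Sum>t\<in>M C. 3)" by (rule sum_mono) (rule c3)
    finally show "card (BS C) \<le> 3 * m0" using bff(2)[OF that that] by (simp add: m0_def)
    show "finite (BS C)" unfolding BS_def using bff(1)[OF that that] by (auto simp: block_set_eq)
  qed
  define cl where "cl u = (THE C. C \<in> \<C> \<and> u \<in> C)" for u
  have cl: "cl u = C" if "C \<in> \<C>" "u \<in> C" for u C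
    unfolding cl_def using that disjC by (intro the_equality) auto
  define U1 where "U1 u = (if u \<in> \<Union>\<C> then cl u else {})" for u
  define U2 where "U2 u = (if u \<in> \<Union>\<C> then BS (cl u) else {})" for u
  have U12: "U1 u = C" "U2 u = BS C" if "C \<in> \<C>" "u \<in> C" for u C
    using that cl[OF that] by (auto simp: U1_def U2_def)
  have near: "C \<subseteq> (nbrel V adj ^^ 2) `` {u}" "BS C \<subseteq> (nbrel V adj ^^ 2) `` {u}" if "C \<in> \<C>" "u \<in> C" for C u
    using near_clique_ball[OF optimal that] BSn[OF that(1)] by blast+
  have m0D: "3 * m0 \<le> D" by (simp add: m0_def)
  have "\<exists>S \<phi>. S \<subseteq> V \<and> proper_on adj (3 * D div 1000) S \<phi> \<and>
    (\<forall>u\<in>V. real (card (S \<inter> U1 u)) \<le> real D / 400 \<and> real (card (S \<inter> U2 u)) \<le> real D / 400) \<and>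
    (\<forall>u. sparse u \<longrightarrow> saves \<phi> S u 2)"
  proof (rule sparse_stage)
    fix u
    show "U1 u \<subseteq> (nbrel V adj ^^ 2) `` {u} \<and> card (U1 u) \<le> D"
    proof (cases "u \<in> \<Union>\<C>")
      case True
      then obtain C where C: "C \<in> \<C>" "u \<in> C" by blast
      then show ?thesis using U12(1)[OF C] near(1)[OF C] Cf(4)[OF C(1)] by simp
    qed (simp add: U1_def)
    show "U2 u \<subseteq> (nbrel V adj ^^ 2) `` {u} \<and> card (U2 u) \<le> D"
    proof (cases "u \<in> \<Union>\<C>")
      case True
      then obtain C where C: "C \<in> \<C>" "u \<in> C" by blast
      then show ?thesis using U12(2)[OF C] near(2)[OF C] BSc(1)[OF C(1)] m0D by simp
    qed (simp add: U2_def)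
  qed
  then obtain S0 \<phi>0 where S0: "S0 \<subseteq> V" "proper_on adj (3 * D div 1000) S0 \<phi>0"
    "\<forall>u\<in>V. real (card (S0 \<inter> U1 u)) \<le> real D / 400 \<and> real (card (S0 \<inter> U2 u)) \<le> real D / 400"
    "\<forall>u. sparse u \<longrightarrow> saves \<phi>0 S0 u 2"
    by (elim exE conjE) (rule that)
  have cap0: "real (card (S0 \<inter> C)) \<le> real D / 400" "real (card (S0 \<inter> BS C)) \<le> real D / 400" if C: "C \<in> \<C>" for C
  proof -
    have "C \<noteq> {}" using Cf(3)[OF C] Dr by auto
    then obtain u where u: "u \<in> C" by blast
    then have "u \<in> V" using Cf(1)[OF C] by blast
    then show "real (card (S0 \<inter> C)) \<le> real D / 400" "real (card (S0 \<inter> BS C)) \<le> real D / 400"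
      using bspec[OF S0(3), of u] U12[OF C u] by simp_all
  qed
  define M1 where "M1 C = {t \<in> M C. block_set t \<inter> S0 = {}}" for C
  have cM1: "real m0 - real D / 400 \<le> real (card (M1 C))" if C: "C \<in> \<C>" for C
  proof -
    have fin: "finite (M C)" by (rule bff(1)[OF C C])
    have "card {t \<in> M C. block_set t \<inter> S0 \<noteq> {}} \<le> card (S0 \<inter> \<Union>(block_set ` M C))"
      by (rule card_disjoint_sets_hit) (use BSc(2)[OF C] bff(5)[OF C C] in \<open>auto simp: BS_def\<close>)
    then have "real (card {t \<in> M C. block_set t \<inter> S0 \<noteq> {}}) \<le> real D / 400" using cap0(2)[OF C] by (simp add: BS_def)
    moreover have "card (M C) \<le> card (M1 C) + card {t \<in> M C. block_set t \<inter> S0 \<noteq> {}}"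
      by (rule card_le_cover) (use fin in \<open>auto simp: M1_def\<close>)
    ultimately show ?thesis using bff(2)[OF C C] by (simp add: m0_def)
  qed
  \<comment> \<open>Subtracting the first outside neighbour accounts for blocks with
    \<open>y = y'\<close>, where only the clique vertex is left to reserve. The clique vertices of
    all blocks are excluded as partners.\<close>
  let ?f1 = "\<lambda>t :: 'a \<times> 'a \<times> 'a. fst (snd t)" and ?r1 = "\<lambda>t :: 'a \<times> 'a \<times> 'a. {fst t, snd (snd t)} - {fst (snd t)}"
  let ?X1 = "\<lambda>C. C - S0 - fst ` M C"
  define K1 where "K1 = D div 5"
  \<comment> \<open>A compromise: \<open>2 ^ G\<close> spends 28 of the 42 millionths of D that
    \<open>p1 / 4 * K1\<close> provides in the exponent, and the next stage has only these
    \<open>G\<close> blocks per clique to start from. \<open>p1\<close> is below 1456/100000 * 1/4 *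
    237/1000.\<close>
  define G where "G = D div 25000"
  define p1 :: real where "p1 = 84/100000"
  define L1 where "L1 = nat \<lfloor>p1 / 5 * real D\<rfloor>"
  have K1: "real K1 \<le> real D / 5" "real D / 5 - 1 \<le> real K1" unfolding K1_def by linarith+
  have G: "real G \<le> real D / 25000" "real D / 25000 - 1 \<le> real G" unfolding G_def by linarith+
  have L1: "real L1 \<le> p1 / 5 * real D" "p1 / 5 * real D - 1 \<le> real L1"
    unfolding L1_def using Dr by (auto simp: p1_def) linarith+
  have p1: "0 \<le> p1" "p1 \<le> 1" by (auto simp: p1_def)
  have cX1: "real (card C) - real D / 400 - real m0 \<le> real (card (?X1 C))" if C: "C \<in> \<C>" for C
  proof -
    have "C \<subseteq> ?X1 C \<union> (S0 \<inter> C) \<union> fst ` M C" by auto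
    then have "card C \<le> card (?X1 C \<union> (S0 \<inter> C) \<union> fst ` M C)"
      using Cf(5)[OF C] bff(1)[OF C C] by (intro card_mono) auto
    also have "\<dots> \<le> card (?X1 C) + card (S0 \<inter> C) + card (fst ` M C)"
      by (meson card_Un_le add_right_mono order_trans)
    also have "card (fst ` M C) \<le> card (M C)" by (rule card_image_le[OF bff(1)[OF C C]])
    finally show ?thesis using cap0(1)[OF C] bff(2)[OF C C] by (simp add: m0_def)
  qed
  have ext: "real (D + 3 - card C) = real D + 3 - real (card C)" if "C \<in> \<C>" for C
    using Cf(4)[OF that] by linarith
  have "\<exists>S \<phi>. S \<subseteq> V - S0 \<and> proper_on adj K1 S \<phi> \<and>
    (\<forall>C\<in>\<C>. real (card (S \<inter> C)) \<le> 16/100 * real D \<and> real (card (S \<inter> BS C)) \<le> real m0 / 2) \<and>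
    (\<forall>C\<in>\<C>. \<exists>M''\<subseteq>M1 C. G \<le> card M'' \<and>
       (\<forall>t\<in>M''. ?f1 t \<in> S \<and> ?r1 t \<inter> S = {} \<and> (\<exists>x\<in>?X1 C - N (?f1 t). x \<in> S \<and> \<phi> x = \<phi> (?f1 t))))"
  proof (rule block_stage[OF optimal order_refl _ bf, where M' = M1 and bs = "3 * m0" and n = "5 * (D div 2)"
        and p = p1 and L = L1 and NN = "D * D * 1456 div 100000"])
    show "V - S0 \<subseteq> V" by blast
    show "M1 C \<subseteq> M C" for C by (auto simp: M1_def)
    show "?f1 t \<in> {fst (snd t), snd (snd t)}" for t by simp
    show "?r1 t \<subseteq> block_set t - {?f1 t}" for t by (auto simp: block_set_eq)
    show "insert (?f1 t) (?r1 t) \<subseteq> V - S0" if C: "C \<in> \<C>" and t: "t \<in> M1 C" for C t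
    proof -
      have tM: "t \<in> M C" "block_set t \<inter> S0 = {}" using t by (auto simp: M1_def)
      have "block_set t \<subseteq> V"
        using bff(3)[OF C C tM(1)] bff(4)[OF C C tM(1), of "fst (snd t)"] bff(4)[OF C C tM(1), of "snd (snd t)"]
          Cf(1)[OF C] N_subset[of "fst t"] by (auto simp: block_set_eq)
      moreover have "insert (?f1 t) (?r1 t) \<subseteq> block_set t" by (auto simp: block_set_eq)
      ultimately show ?thesis using tM(2) by blast
    qed
    show "?X1 C \<subseteq> C \<inter> (V - S0) - fst ` M C" if "C \<in> \<C>" for C using Cf(1)[OF that] by blast
    show "(\<Union>t\<in>M1 C. insert (?f1 t) (?r1 t)) \<subseteq> BS C" for C
      by (auto simp: BS_def M1_def block_set_eq)
    show "z \<in> C \<or> (\<exists>v\<in>C. z \<in> N v)" if "C \<in> \<C>" "z \<in> BS C" for C z by (rule BSn[OF that])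
    show "card (BS C) \<le> 3 * m0" if "C \<in> \<C>" for C by (rule BSc[OF that])
    have qK: "q * real K1 \<le> 1/10" using K1 Dr by (simp add: field_simps)
    show "2 powr (- (16/100 * real D)) * exp (q * real K1 * real D) \<le> pp"
    proof -
      have "q * real K1 * real D \<le> 1/10 * real D" by (rule mult_right_mono[OF qK]) simp
      then show ?thesis
        using cap_bound[OF D, of "q * real K1 * real D" "real D / 40000000" "16/100 * real D"] Dr by simp
    qed
    show "2 powr (- (real m0 / 2)) * exp (q * real K1 * real (3 * m0)) \<le> pp"
    proof -
      have "q * real K1 * real (3 * m0) \<le> 1/10 * real (3 * m0)" by (rule mult_right_mono[OF qK]) simp
      then show ?thesis
        using cap_bound[OF D, of "q * real K1 * real (3 * m0)" "real D / 40000000" "real m0 / 2"] Dr m0 by simp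
    qed
    show "real m0 / 2 \<le> real (card (M1 C)) \<and>
      0 \<le> real (card (?X1 C)) - real (D + 3 - card C) - 16/100 * real D \<and>
      real (D * D * 1456 div 100000) \<le> (real (card (M1 C)) - real m0 / 2) *
        (real (card (?X1 C)) - real (D + 3 - card C) - 16/100 * real D)" if C: "C \<in> \<C>" for C
    proof -
      let ?b = "real (card (?X1 C)) - real (D + 3 - card C) - 16/100 * real D"
      \<comment> \<open>The coefficients are 1/20 - 1/400 - 1/40 for the blocks, and 0.93 - 1/400 -
        1/20 - 0.07 - 0.16 for the partners, where 0.07 bounds the neighbours of the outside vertex
        in \<open>C\<close>.\<close>
      have a: "225/10000 * real D - 1/2 \<le> real (card (M1 C)) - real m0 / 2" using cM1[OF C] m0 by linarith
      have b: "6475/10000 * real D - 3 \<le> ?b" using cX1[OF C] ext[OF C] m0 Cf(3)[OF C] by linarith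
      have "(225/10000 * real D - 1/2) * (6475/10000 * real D - 3)
          = 1456875/100000000 * (real D * real D) - 39125/100000 * real D + 3/2" by (simp add: algebra_simps)
      then have "1456/100000 * (real D * real D) \<le> (225/10000 * real D - 1/2) * (6475/10000 * real D - 3)"
        using DD Dr by linarith
      also have "\<dots> \<le> (real (card (M1 C)) - real m0 / 2) * ?b"
        using a b Dr by (intro mult_mono) auto
      finally have c: "1456/100000 * (real D * real D) \<le> (real (card (M1 C)) - real m0 / 2) * ?b" .
      have "real (D * D * 1456 div 100000) \<le> real (D * D * 1456) / 100000" by linarith
      also have "\<dots> = 1456/100000 * (real D * real D)" by simp
      finally show ?thesis using a b c Dr by (intro conjI) linarith+
    qed
    show "2 * D + 1 + 3 * m0 \<le> 5 * (D div 2)" using D by (simp add: m0_def)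
    show "0 \<le> p1" "p1 \<le> 1" by (rule p1)+
    show "p1 \<le> real (D * D * 1456 div 100000) * q\<^sup>2 * (1 - q) ^ (5 * (D div 2))"
    proof (rule hit_bound[OF D _ _ survive_clique[OF D], where \<nu> = "1456/100000"])
      have "real (D * D * 1456) / 100000 - 1 \<le> real (D * D * 1456 div 100000)" by linarith
      then show "1456/100000 * (real D)\<^sup>2 - 1 \<le> real (D * D * 1456 div 100000)" by (simp add: power2_eq_square)
    qed (auto simp: p1_def)
    show "(1 + q) ^ (2 * L1) \<le> 1 + p1 / 4" by (rule growth_bound[OF D p1 L1(1)])
    have "2 ^ G * ((1 - p1 / 4) ^ K1 + real K1 * (51/100) ^ L1) \<le> exp (- (real D / 40000000))"
    proof (rule fail_bound[OF D p1])
      show "real K1 \<le> real D" using K1 Dr by linarith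
      show "7/10 * real G + real D / 40000000 + 1 \<le> p1 / 4 * real K1" using K1 G Dr unfolding p1_def by simp
      show "7/10 * real G + real D / 40000000 + 1 + real D / 100000000 \<le> 49/100 * real L1"
        using L1 G Dr unfolding p1_def by simp
    qed
    then show "2 ^ G * ((1 - p1 / 4) ^ K1 + real K1 * (51/100) ^ L1) \<le> pp" by simp
  qed
  then obtain S1 \<phi>1 where S1: "S1 \<subseteq> V - S0" "proper_on adj K1 S1 \<phi>1"
    "\<forall>C\<in>\<C>. real (card (S1 \<inter> C)) \<le> 16/100 * real D \<and> real (card (S1 \<inter> BS C)) \<le> real m0 / 2"
    "\<forall>C\<in>\<C>. \<exists>M''\<subseteq>M1 C. G \<le> card M'' \<and>
       (\<forall>t\<in>M''. ?f1 t \<in> S1 \<and> ?r1 t \<inter> S1 = {} \<and> (\<exists>x\<in>?X1 C - N (?f1 t). x \<in> S1 \<and> \<phi>1 x = \<phi>1 (?f1 t)))"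
    by (elim exE conjE) (rule that)
  define P1 where "P1 C t \<longleftrightarrow> ?f1 t \<in> S1 \<and> ?r1 t \<inter> S1 = {} \<and>
    (\<exists>x\<in>?X1 C - N (?f1 t). x \<in> S1 \<and> \<phi>1 x = \<phi>1 (?f1 t))" for C t
  have "\<forall>C\<in>\<C>. \<exists>m. m \<subseteq> M1 C \<and> card m = G \<and> (\<forall>t\<in>m. P1 C t)"
  proof
    fix C assume C: "C \<in> \<C>"
    obtain M'' where M'': "M'' \<subseteq> M1 C" "G \<le> card M''" "\<forall>t\<in>M''. P1 C t"
      using bspec[OF S1(4) C, folded P1_def] by (elim exE conjE) (rule that)
    obtain m where "m \<subseteq> M''" "card m = G" using M''(2) by (meson obtain_subset_with_card_n)
    then show "\<exists>m. m \<subseteq> M1 C \<and> card m = G \<and> (\<forall>t\<in>m. P1 C t)" using M'' by (intro exI[of _ m]) blast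
  qed
  from bchoice[OF this] obtain M2 where
    "\<forall>C\<in>\<C>. M2 C \<subseteq> M1 C \<and> card (M2 C) = G \<and> (\<forall>t\<in>M2 C. P1 C t)" by (elim exE)
  then have M2: "M2 C \<subseteq> M1 C" "card (M2 C) = G" "\<And>t. t \<in> M2 C \<Longrightarrow> P1 C t" if "C \<in> \<C>" for C
    using that by blast+
  have M2M: "M2 C \<subseteq> M C" "finite (M2 C)" if C: "C \<in> \<C>" for C
  proof -
    show sub: "M2 C \<subseteq> M C" using M2(1)[OF C] by (auto simp: M1_def)
    show "finite (M2 C)" by (rule finite_subset[OF sub bff(1)[OF C C]])
  qed
  have tV: "block_set t \<subseteq> V" "block_set t \<inter> S0 = {}" "fst t \<in> C" "fst t \<noteq> fst (snd t)" "fst t \<notin> S1"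
    if C: "C \<in> \<C>" and t: "t \<in> M2 C" for C t
  proof -
    have tM: "t \<in> M C" "block_set t \<inter> S0 = {}" using t M2(1)[OF C] by (auto simp: M1_def)
    note b = bff(3)[OF C C tM(1)] bff(4)[OF C C tM(1), of "fst (snd t)"] bff(4)[OF C C tM(1), of "snd (snd t)"]
    show "block_set t \<subseteq> V" using b Cf(1)[OF C] N_subset[of "fst t"] by (auto simp: block_set_eq)
    show "block_set t \<inter> S0 = {}" "fst t \<in> C" using tM(2) b(1) by auto
    show ne: "fst t \<noteq> fst (snd t)" using b by auto
    show "fst t \<notin> S1" using M2(3)[OF C t] ne by (auto simp: P1_def)
  qed
  \<comment> \<open>Only cliques whose blocks have two outside neighbours need a second repetition.
    In the other cliques the block vertices have degree less than \<open>D\<close>; the second stage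
    merely has to leave enough of them uncoloured, which the cap on \<open>Q C\<close>
    ensures.\<close>
  define \<D> where "\<D> = {C \<in> \<C>. \<forall>t\<in>M C. fst (snd t) \<noteq> snd (snd t)}"
  let ?f2 = "\<lambda>t :: 'a \<times> 'a \<times> 'a. snd (snd t)" and ?r2 = "\<lambda>t :: 'a \<times> 'a \<times> 'a. {fst t} - {snd (snd t)}"
  let ?X2 = "\<lambda>C. C - S0 - S1 - fst ` M C"
  define Q where "Q C = (\<Union>t\<in>M2 C. {fst t, snd (snd t)})" for C
  define K2 where "K2 = 3 * D div 10"
  define p2 :: real where "p2 = 46/100000000"
  define L2 where "L2 = nat \<lfloor>p2 / 5 * real D\<rfloor>"
  have K2: "real K2 \<le> 3/10 * real D" "3/10 * real D - 1 \<le> real K2" unfolding K2_def by linarith+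
  have L2: "real L2 \<le> p2 / 5 * real D" "p2 / 5 * real D - 1 \<le> real L2"
    unfolding L2_def using Dr by (auto simp: p2_def) linarith+
  have p2: "0 \<le> p2" "p2 \<le> 1" by (auto simp: p2_def)
  have QBS: "Q C \<subseteq> BS C" if "C \<in> \<C>" for C
    using M2M(1)[OF that] by (auto simp: Q_def BS_def block_set_eq)
  have Qc: "card (Q C) \<le> 2 * G" if "C \<in> \<C>" for C
  proof -
    have "card (Q C) \<le> (\<Sum>t\<in>M2 C. card {fst t, snd (snd t)})" unfolding Q_def by (rule card_UN_le[OF M2M(2)[OF that]])
    also have "\<dots> \<le> (\<Sum>t\<in>M2 C. 2)"
      by (rule sum_mono) (use card_insert_le_m1[of 2 "{snd (snd t)}" "fst t" for t] in auto)
    finally show ?thesis using M2(2)[OF that] by simp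
  qed
  have cX2: "real (card C) - real D / 400 - 16/100 * real D - real m0 \<le> real (card (?X2 C))" if C: "C \<in> \<C>" for C
  proof -
    have "?X1 C \<subseteq> ?X2 C \<union> (S1 \<inter> C)" by auto
    then have "card (?X1 C) \<le> card (?X2 C \<union> (S1 \<inter> C))" using Cf(5)[OF C] by (intro card_mono) auto
    also have "\<dots> \<le> card (?X2 C) + card (S1 \<inter> C)" by (rule card_Un_le)
    finally show ?thesis using cX1[OF C] bspec[OF S1(3) C] by linarith
  qed
  have "\<exists>S \<phi>. S \<subseteq> V - S0 - S1 \<and> proper_on adj K2 S \<phi> \<and>
    (\<forall>C\<in>\<C>. real (card (S \<inter> C)) \<le> 24/100 * real D \<and> real (card (S \<inter> Q C)) \<le> real G / 2) \<and>
    (\<forall>C\<in>\<D>. \<exists>M''\<subseteq>M2 C. 2 \<le> card M'' \<and>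
       (\<forall>t\<in>M''. ?f2 t \<in> S \<and> ?r2 t \<inter> S = {} \<and> (\<exists>x\<in>?X2 C - N (?f2 t). x \<in> S \<and> \<phi> x = \<phi> (?f2 t))))"
  proof (rule block_stage[OF optimal _ _ bf, where M' = M2 and bs = "2 * G" and n = "5 * (D div 2)"
        and p = p2 and L = L2 and NN = "D * D * 8 div 1000000"])
    show "\<D> \<subseteq> \<C>" by (auto simp: \<D>_def)
    show "C \<in> \<C>" if "C \<in> \<D>" for C using that by (simp add: \<D>_def)
    show "V - S0 - S1 \<subseteq> V" by blast
    show "M2 C \<subseteq> M C" if "C \<in> \<D>" for C using that M2M(1) by (simp add: \<D>_def)
    show "?f2 t \<in> {fst (snd t), snd (snd t)}" for t by simp
    show "?r2 t \<subseteq> block_set t - {?f2 t}" for t by (auto simp: block_set_eq)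
    show "insert (?f2 t) (?r2 t) \<subseteq> V - S0 - S1" if CD: "C \<in> \<D>" and t: "t \<in> M2 C" for C t
    proof -
      have C: "C \<in> \<C>" using CD by (simp add: \<D>_def)
      have "t \<in> M C" using M2M(1)[OF C] t by blast
      then have ne: "snd (snd t) \<noteq> fst (snd t)" using CD by (auto simp: \<D>_def)
      then have "snd (snd t) \<notin> S1" using M2(3)[OF C t] by (auto simp: P1_def)
      then show ?thesis using tV[OF C t] by (auto simp: block_set_eq)
    qed
    show "?X2 C \<subseteq> C \<inter> (V - S0 - S1) - fst ` M C" if "C \<in> \<D>" for C
      using Cf(1)[of C] that by (auto simp: \<D>_def)
    show "(\<Union>t\<in>M2 C. insert (?f2 t) (?r2 t)) \<subseteq> Q C" for C by (auto simp: Q_def)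
    show "z \<in> C \<or> (\<exists>v\<in>C. z \<in> N v)" if "C \<in> \<C>" "z \<in> Q C" for C z using BSn[OF that(1)] QBS[OF that(1)] that(2) by blast
    show "card (Q C) \<le> 2 * G" if "C \<in> \<C>" for C by (rule Qc[OF that])
    have qK: "q * real K2 \<le> 15/100" using K2 Dr by (simp add: field_simps)
    show "2 powr (- (24/100 * real D)) * exp (q * real K2 * real D) \<le> pp"
    proof -
      have "q * real K2 * real D \<le> 15/100 * real D" by (rule mult_right_mono[OF qK]) simp
      then show ?thesis
        using cap_bound[OF D, of "q * real K2 * real D" "real D / 40000000" "24/100 * real D"] Dr by simp
    qed
    show "2 powr (- (real G / 2)) * exp (q * real K2 * real (2 * G)) \<le> pp"
    proof -
      have "q * real K2 * real (2 * G) \<le> 15/100 * real (2 * G)" by (rule mult_right_mono[OF qK]) simp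
      then show ?thesis
        using cap_bound[OF D, of "q * real K2 * real (2 * G)" "real D / 40000000" "real G / 2"] Dr G by simp
    qed
    show "real G / 2 \<le> real (card (M2 C)) \<and>
      0 \<le> real (card (?X2 C)) - real (D + 3 - card C) - 24/100 * real D \<and>
      real (D * D * 8 div 1000000) \<le> (real (card (M2 C)) - real G / 2) *
        (real (card (?X2 C)) - real (D + 3 - card C) - 24/100 * real D)" if CD: "C \<in> \<D>" for C
    proof -
      have C: "C \<in> \<C>" using CD by (simp add: \<D>_def)
      let ?b = "real (card (?X2 C)) - real (D + 3 - card C) - 24/100 * real D"
      have a: "2/100000 * real D - 1/2 \<le> real (card (M2 C)) - real G / 2" using M2(2)[OF C] G by simp
      have b: "4075/10000 * real D - 3 \<le> ?b" using cX2[OF C] ext[OF C] m0 Cf(3)[OF C] by linarith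
      have "(2/100000 * real D - 1/2) * (4075/10000 * real D - 3)
          = 815/100000000 * (real D * real D) - 20381/100000 * real D + 3/2" by (simp add: algebra_simps)
      then have "8/1000000 * (real D * real D) \<le> (2/100000 * real D - 1/2) * (4075/10000 * real D - 3)"
        using DD Dr by linarith
      also have "\<dots> \<le> (real (card (M2 C)) - real G / 2) * ?b"
        using a b Dr by (intro mult_mono) auto
      finally have c: "8/1000000 * (real D * real D) \<le> (real (card (M2 C)) - real G / 2) * ?b" .
      have "real (D * D * 8 div 1000000) \<le> real (D * D * 8) / 1000000" by linarith
      also have "\<dots> = 8/1000000 * (real D * real D)" by simp
      finally show ?thesis using a b c Dr by (intro conjI) linarith+
    qed
    show "2 * D + 1 + 2 * G \<le> 5 * (D div 2)" using D by (simp add: G_def)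
    show "0 \<le> p2" "p2 \<le> 1" by (rule p2)+
    show "p2 \<le> real (D * D * 8 div 1000000) * q\<^sup>2 * (1 - q) ^ (5 * (D div 2))"
    proof (rule hit_bound[OF D _ _ survive_clique[OF D], where \<nu> = "8/1000000"])
      have "real (D * D * 8) / 1000000 - 1 \<le> real (D * D * 8 div 1000000)" by linarith
      then show "8/1000000 * (real D)\<^sup>2 - 1 \<le> real (D * D * 8 div 1000000)" by (simp add: power2_eq_square)
    qed (auto simp: p2_def)
    show "(1 + q) ^ (2 * L2) \<le> 1 + p2 / 4" by (rule growth_bound[OF D p2 L2(1)])
    have "2 ^ 2 * ((1 - p2 / 4) ^ K2 + real K2 * (51/100) ^ L2) \<le> exp (- (real D / 40000000))"
    proof (rule fail_bound[OF D p2])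
      show "real K2 \<le> real D" using K2 Dr by linarith
      show "7/10 * real 2 + real D / 40000000 + 1 \<le> p2 / 4 * real K2" using K2 Dr unfolding p2_def by simp
      show "7/10 * real 2 + real D / 40000000 + 1 + real D / 100000000 \<le> 49/100 * real L2"
        using L2 Dr unfolding p2_def by simp
    qed
    then show "2 ^ 2 * ((1 - p2 / 4) ^ K2 + real K2 * (51/100) ^ L2) \<le> pp" by simp
  qed
  then obtain S2 \<phi>2 where S2: "S2 \<subseteq> V - S0 - S1" "proper_on adj K2 S2 \<phi>2"
    "\<forall>C\<in>\<C>. real (card (S2 \<inter> C)) \<le> 24/100 * real D \<and> real (card (S2 \<inter> Q C)) \<le> real G / 2"
    "\<forall>C\<in>\<D>. \<exists>M''\<subseteq>M2 C. 2 \<le> card M'' \<and>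
       (\<forall>t\<in>M''. ?f2 t \<in> S2 \<and> ?r2 t \<inter> S2 = {} \<and> (\<exists>x\<in>?X2 C - N (?f2 t). x \<in> S2 \<and> \<phi>2 x = \<phi>2 (?f2 t)))"
    by (elim exE conjE) (rule that)
  define S where "S = S0 \<union> S1 \<union> S2"
  define \<phi> where "\<phi> v = (if v \<in> S0 \<union> S1 then (if v \<in> S0 then \<phi>0 v else 3 * D div 1000 + \<phi>1 v)
    else (3 * D div 1000 + K1) + \<phi>2 v)" for v
  have SV: "S \<subseteq> V" using S0(1) S1(1) S2(1) by (auto simp: S_def)
  have "proper_on adj (3 * D div 1000 + K1 + K2) S \<phi>"
    unfolding S_def \<phi>_def
    by (intro proper_on_union S0(2) S1(2) S2(2)) (use S1(1) S2(1) in auto)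
  moreover have "3 * D div 1000 + K1 + K2 \<le> D - 1" using D by (simp add: K1_def K2_def)
  ultimately have col: "proper_on adj (D - 1) S \<phi>" by (rule proper_on_mono)
  have eq1: "\<phi> x = \<phi> y" if "x \<in> S1" "y \<in> S1" "\<phi>1 x = \<phi>1 y" for x y using that S1(1) by (auto simp: \<phi>_def)
  have eq2: "\<phi> x = \<phi> y" if "x \<in> S2" "y \<in> S2" "\<phi>2 x = \<phi>2 y" for x y using that S2(1) by (auto simp: \<phi>_def)
  have capS: "real (card (S \<inter> C)) \<le> 41/100 * real D" if C: "C \<in> \<C>" for C
  proof -
    have "card (S \<inter> C) \<le> card (S0 \<inter> C) + card ((S1 \<inter> C) \<union> (S2 \<inter> C))"
      by (rule card_le_cover) (use Cf(5)[OF C] in \<open>auto simp: S_def\<close>)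
    moreover have "card ((S1 \<inter> C) \<union> (S2 \<inter> C)) \<le> card (S1 \<inter> C) + card (S2 \<inter> C)" by (rule card_Un_le)
    ultimately show ?thesis using cap0(1)[OF C] bspec[OF S1(3) C] bspec[OF S2(3) C] by linarith
  qed
  have saved1: "\<exists>x y. y \<in> N (fst t) - C \<and> y = fst (snd t) \<and> x \<in> N (fst t) \<inter> C \<and> x \<in> S1 \<and> y \<in> S1 \<and> \<phi> x = \<phi> y"
    if C: "C \<in> \<C>" and t: "t \<in> M2 C" for C t
  proof -
    obtain x where x: "x \<in> ?X1 C" "x \<in> S1" "\<phi>1 x = \<phi>1 (fst (snd t))" and y: "fst (snd t) \<in> S1"
      using M2(3)[OF C t] unfolding P1_def by blast
    have tM: "t \<in> M C" using M2M(1)[OF C] t by blast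
    have "x \<in> N (fst t)" using clique_adjacent[OF optimal C, of x "fst t"] x(1) tM bff(3)[OF C C tM] by blast
    then show ?thesis
      using bff(4)[OF C C tM, of "fst (snd t)"] x y eq1[OF x(2) y x(3)] by blast
  qed
  have saves1: "saves \<phi> S (fst t) 1" if C: "C \<in> \<C>" and t: "t \<in> M2 C" for C t
  proof -
    obtain x y where xy: "y \<in> N (fst t) - C" "x \<in> N (fst t) \<inter> C" "x \<in> S1" "y \<in> S1" "\<phi> x = \<phi> y"
      using saved1[OF C t] by blast
    show ?thesis
    proof (rule saves_I[where T = "{y}"])
      show "{y} \<subseteq> N (fst t) \<inter> S" using xy by (auto simp: S_def)
      show "\<exists>x\<in>N (fst t) \<inter> S - {y}. \<phi> x = \<phi> t'" if "t' \<in> {y}" for t'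
        using that xy by (intro bexI[of _ x]) (auto simp: S_def)
    qed simp
  qed
  have vdist: "fst t \<noteq> fst t'" if C: "C \<in> \<C>" and t: "t \<in> M C" "t' \<in> M C" "t \<noteq> t'" for C t t'
    using bff(5)[OF C C t] by (auto simp: block_set_eq)
  have "\<exists>\<phi>. proper_on adj (D - 1) V \<phi>"
  proof (rule finish_cliques[OF degD _ col SV, where \<C> = \<C>])
    show "2 \<le> D" using D by simp
    show "C \<subseteq> V \<and> complete_on adj C" if "C \<in> \<C>" for C using Cf(1,2)[OF that] by simp
    show "C \<inter> C' = {}" if "C \<in> \<C>" "C' \<in> \<C>" "C \<noteq> C'" for C C' by (rule disjC[OF that])
    show "saves \<phi> S u 2 \<or> 2 \<le> card (N u \<inter> (\<Union>\<C> - S))" if u: "u \<in> V - S - \<Union>\<C>" for u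
    proof (cases "sparse u")
      case True
      then have "saves \<phi>0 S0 u 2" using S0(4) by blast
      then have "saves \<phi> S u 2" by (rule saves_mono_colouring) (auto simp: S_def \<phi>_def)
      then show ?thesis by blast
    next
      case False
      then have "100 * card {(x, y). x \<in> N u \<and> y \<in> N u \<and> x \<noteq> y \<and> \<not> adj x y} < D * D"
        using u by (auto simp: sparse_def)
      \<comment> \<open>A vertex outside the family that is not sparse still lies in a large clique
        \<open>C'\<close>. It meets a member \<open>C\<close> in about 86% of D vertices, because a
        common vertex has degree at most \<open>D\<close>. At most 41% of D vertices of
        \<open>C\<close> are coloured, so \<open>u\<close> has waiting neighbours there.\<close>
      then obtain C' where C': "C' \<subseteq> V" "u \<in> C'" "complete_on adj C'" "93 * D \<le> 100 * card C'"
        using clique_of_dense[of u] u by blast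
      then obtain C where C: "C \<in> \<C>" "C' \<inter> C \<noteq> {}" using large_clique_meets_optimal[OF optimal, of C'] by (auto simp: large_clique_def)
      then obtain z where z: "z \<in> C'" "z \<in> C" by blast
      have zV: "z \<in> V" using z C' by auto
      have "C \<union> C' \<subseteq> insert z (N z)"
        using z C'(1,3) Cf(1,2)[OF C(1)] by (auto simp: complete_on_def nb_def)
      then have "card (C \<union> C') \<le> card (insert z (N z))" by (intro card_mono) auto
      also have "\<dots> \<le> Suc (card (N z))" by (rule card_insert_le_m1) auto
      finally have un: "card (C \<union> C') \<le> D + 1" using degD[OF zV] by simp
      have finC': "finite C'" using C'(1) fin_subset by blast
      have "card C + card C' = card (C \<union> C') + card (C \<inter> C')" by (rule card_Un_Int[OF Cf(5)[OF C(1)] finC'])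
      then have int: "86/100 * real D - 1 \<le> real (card (C \<inter> C'))" using un C'(4) Cf(3)[OF C(1)] by linarith
      have uC: "u \<notin> C" using u C by blast
      have "C \<inter> C' \<subseteq> (N u \<inter> (\<Union>\<C> - S)) \<union> (S \<inter> C)"
        using C'(1,2,3) uC C(1) by (auto simp: complete_on_def nb_def)
      then have "card (C \<inter> C') \<le> card ((N u \<inter> (\<Union>\<C> - S)) \<union> (S \<inter> C))"
        using Cf(5)[OF C(1)] by (intro card_mono) auto
      also have "\<dots> \<le> card (N u \<inter> (\<Union>\<C> - S)) + card (S \<inter> C)" by (rule card_Un_le)
      finally have "2 \<le> card (N u \<inter> (\<Union>\<C> - S))" using int capS[OF C(1)] Dr by linarith
      then show ?thesis by blast
    qed
    show "\<exists>v v'. v \<in> C - S \<and> v' \<in> C - S \<and> v \<noteq> v' \<and> saves \<phi> S v' 1 \<and>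
       (saves \<phi> S v 2 \<or> saves \<phi> S v 1 \<and> card (N v) < D)" if C: "C \<in> \<C>" for C
    proof (cases "C \<in> \<D>")
      case True
      obtain M3 where M3: "M3 \<subseteq> M2 C" "2 \<le> card M3"
        "\<forall>t\<in>M3. ?f2 t \<in> S2 \<and> ?r2 t \<inter> S2 = {} \<and> (\<exists>x\<in>?X2 C - N (?f2 t). x \<in> S2 \<and> \<phi>2 x = \<phi>2 (?f2 t))"
        using bspec[OF S2(4) True] by (elim exE conjE) (rule that)
      have free: "fst t \<in> C - S" if t: "t \<in> M3" for t
      proof -
        have t2: "t \<in> M2 C" using t M3(1) by blast
        have tM: "t \<in> M C" using t2 M2M(1)[OF C] by blast
        have "fst t \<noteq> snd (snd t)" using bff(3)[OF C C tM] bff(4)[OF C C tM, of "snd (snd t)"] by auto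
        then have "fst t \<notin> S2" using bspec[OF M3(3) t] by blast
        then show ?thesis using tV(2,3,5)[OF C t2] by (auto simp: S_def block_set_eq)
      qed
      have sav2: "saves \<phi> S (fst t) 2" if t: "t \<in> M3" for t
      proof -
        have t2: "t \<in> M2 C" using t M3(1) by blast
        have tM: "t \<in> M C" using t2 M2M(1)[OF C] by blast
        obtain x y where xy: "y \<in> N (fst t) - C" "y = fst (snd t)" "x \<in> N (fst t) \<inter> C" "x \<in> S1" "y \<in> S1" "\<phi> x = \<phi> y"
          using saved1[OF C t2] by blast
        let ?y = "snd (snd t)"
        obtain x' where x': "x' \<in> ?X2 C" "x' \<in> S2" "\<phi>2 x' = \<phi>2 ?y" and y': "?y \<in> S2"
          using bspec[OF M3(3) t] by blast
        have x'N: "x' \<in> N (fst t)" using clique_adjacent[OF optimal C, of x' "fst t"] x'(1,2) free[OF t] by (auto simp: S_def)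
        have y'N: "?y \<in> N (fst t) - C" using bff(4)[OF C C tM, of ?y] by blast
        have e: "\<phi> x' = \<phi> ?y" by (rule eq2[OF x'(2) y' x'(3)])
        have ne: "y \<noteq> ?y" using True tM xy(2) by (auto simp: \<D>_def)
        show ?thesis
        proof (rule saves_I[where T = "{y, ?y}"])
          show "{y, ?y} \<subseteq> N (fst t) \<inter> S" using xy y' y'N by (auto simp: S_def)
          have "x \<in> N (fst t) \<inter> S - {y, ?y}" "x' \<in> N (fst t) \<inter> S - {y, ?y}"
            using xy x' x'N y'N by (auto simp: S_def)
          then show "\<exists>x\<in>N (fst t) \<inter> S - {y, ?y}. \<phi> x = \<phi> t'" if "t' \<in> {y, ?y}" for t'
            using that xy(6) e by blast
        qed (use ne in simp)
      qed
      obtain t t' where t: "t \<in> M3" "t' \<in> M3" "t \<noteq> t'" using two_elements[OF M3(2)] by (elim exE conjE) (rule that)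
      have "fst t \<noteq> fst t'" using vdist[OF C _ _ t(3)] t M3(1) M2M(1)[OF C] by blast
      moreover have "saves \<phi> S (fst t') 1" using saves1[OF C] t(2) M3(1) by blast
      ultimately show ?thesis
        using free[OF t(1)] free[OF t(2)] sav2[OF t(1)] by (intro exI[of _ "fst t"] exI[of _ "fst t'"]) blast
    next
      case False
      then have low: "card (N (fst t)) < D" if "t \<in> M C" for t
        using bff(6)[OF C C] that C by (auto simp: \<D>_def)
      \<comment> \<open>The second stage colours the clique vertex of at most half of the
        \<open>G\<close> blocks, so two of them remain free.\<close>
      let ?B = "{t \<in> M2 C. {fst t} \<inter> S2 \<noteq> {}}"
      have "card ?B \<le> card (S2 \<inter> \<Union>((\<lambda>t. {fst t}) ` M2 C))"
      proof (rule card_disjoint_sets_hit)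
        show "finite (\<Union>((\<lambda>t. {fst t}) ` M2 C))" using M2M(2)[OF C] by simp
        show "{fst t} \<inter> {fst t'} = {}" if "t \<in> M2 C" "t' \<in> M2 C" "t \<noteq> t'" for t t'
          using vdist[OF C _ _ that(3)] that(1,2) M2M(1)[OF C] by blast
      qed
      also have "\<dots> \<le> card (S2 \<inter> Q C)"
        using M2M(2)[OF C] by (intro card_mono) (auto simp: Q_def)
      finally have B: "real (card ?B) \<le> real G / 2" using bspec[OF S2(3) C] by linarith
      have "card (M2 C) \<le> card (M2 C - ?B) + card ?B"
        by (rule card_le_cover) (use M2M(2)[OF C] in auto)
      then have c2: "2 \<le> card (M2 C - ?B)" using B M2(2)[OF C] G Dr by linarith
      obtain t t' where t: "t \<in> M2 C - ?B" "t' \<in> M2 C - ?B" "t \<noteq> t'"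
        using two_elements[OF c2] by (elim exE conjE) (rule that)
      have free: "fst s \<in> C - S" if "s \<in> M2 C - ?B" for s
        using that tV(2,3,5)[OF C, of s] by (auto simp: S_def block_set_eq)
      have tM: "t \<in> M C" "t' \<in> M C" using t M2M(1)[OF C] by blast+
      have sv: "saves \<phi> S (fst t) 1" "saves \<phi> S (fst t') 1" using saves1[OF C] t by blast+
      show ?thesis
        using free[OF t(1)] free[OF t(2)] vdist[OF C tM t(3)] sv low[OF tM(1)]
        by (intro exI[of _ "fst t"] exI[of _ "fst t'"]) blast
    qed
  qed
  then show False using not_colourable by blast
qed

end

section \<open>Colouring with at most as many colours as the maximum degree\<close>

text \<open>The induction on the number of vertices ranges over all relations, so that its
  hypothesis yields \<open>minimal\<close> including graphs with added edges.\<close>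

lemma colourable_max_degree_minus_one:
  assumes "finite V" "\<And>u v. adj u v \<Longrightarrow> adj v u" "\<And>u. \<not> adj u u" "7400000000 \<le> D"
    "\<And>v. v \<in> V \<Longrightarrow> card (nb V adj v) \<le> D" "\<And>K. K \<subseteq> V \<Longrightarrow> complete_on adj K \<Longrightarrow> card K \<noteq> D"
  shows "\<exists>\<phi>. proper_on adj (D - 1) V \<phi>"
  using assms(1,2,3,5,6)
proof (induction "card V" arbitrary: V adj rule: less_induct)
  case (less V adj)
  show ?case
  proof (rule ccontr)
    assume n: "\<nexists>\<phi>. proper_on adj (D - 1) V \<phi>"
    interpret minimal_counterexample V adj D
    proof
      show "\<exists>\<phi>. proper_on adj' (D - 1) V' \<phi>"
        if "V' \<subset> V" "\<And>u v. adj' u v \<Longrightarrow> adj' v u" "\<And>u. \<not> adj' u u"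
          "\<And>v. v \<in> V' \<Longrightarrow> card (nb V' adj' v) \<le> D"
          "\<And>K. K \<subseteq> V' \<Longrightarrow> complete_on adj' K \<Longrightarrow> card K \<noteq> D" for V' adj'
      proof (rule less.hyps)
        show "card V' < card V" by (rule psubset_card_mono[OF less.prems(1) that(1)])
        show "finite V'" using that(1) less.prems(1) finite_subset by blast
      qed (use that in blast)+
    qed (use less.prems n assms(4) in blast)+
    show False by (rule no_counterexample)
  qed
qed

text \<open>Brooks' theorem for large \<open>D\<close>: a clique \<open>C\<close> with \<open>D\<close> vertices is removed, after forcing two
  vertices of \<open>C\<close> to have differently coloured outside neighbours by an extra edge.\<close>

lemma colourable_max_degree:
  assumes "finite V" "\<And>u v. adj u v \<Longrightarrow> adj v u" "\<And>u. \<not> adj u u" "7400000000 \<le> D"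
    "\<And>v. v \<in> V \<Longrightarrow> card (nb V adj v) \<le> D" "\<And>K. K \<subseteq> V \<Longrightarrow> complete_on adj K \<Longrightarrow> card K \<noteq> D + 1"
  shows "\<exists>\<phi>. proper_on adj D V \<phi>"
  using assms(1,2,3,5,6)
proof (induction "card V" arbitrary: V adj rule: less_induct)
  case (less V adj)
  interpret finite_graph V adj using less.prems by unfold_locales auto
  have D: "7400000000 \<le> D" by (rule assms(4))
  have deg: "\<And>v. v \<in> V \<Longrightarrow> card (N v) \<le> D" by (rule less.prems(4))
  show ?case
  proof (cases "\<exists>C\<subseteq>V. complete_on adj C \<and> card C = D")
    case False
    have "\<exists>\<phi>. proper_on adj (D - 1) V \<phi>"
      by (rule colourable_max_degree_minus_one[OF less.prems(1) sym irr D deg]) (use False in auto)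
    then show ?thesis by (meson diff_le_self proper_on_mono)
  next
    case True
    then obtain C where C: "C \<subseteq> V" "complete_on adj C" "card C = D" by blast
    have finC: "finite C" using C(1) by (rule fin_subset)
    let ?V = "V - C"
    have IH: "\<exists>\<phi>. proper_on adj' D V' \<phi>"
      if "V' \<subset> V" "\<And>u v. adj' u v \<Longrightarrow> adj' v u" "\<And>u. \<not> adj' u u"
        "\<And>v. v \<in> V' \<Longrightarrow> card (nb V' adj' v) \<le> D"
        "\<And>K. K \<subseteq> V' \<Longrightarrow> complete_on adj' K \<Longrightarrow> card K \<noteq> D + 1" for V' adj'
    proof (rule less.hyps)
      show "card V' < card V" by (rule psubset_card_mono[OF less.prems(1) that(1)])
      show "finite V'" using that(1) less.prems(1) finite_subset by blast
    qed (use that in blast)+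
    have "C \<noteq> {}" using C(3) D by auto
    then have VC: "?V \<subset> V" using C(1) by auto
    have NC: "N v \<inter> C = C - {v}" if "v \<in> C" for v
      using C(1,2) that irr by (auto simp: complete_on_def nb_def)
    have ext: "card (N v - C) \<le> 1" if v: "v \<in> C" for v
    proof -
      have "card (N v) = card (N v \<inter> C) + card (N v - C)"
        using card_Un_disjoint[of "N v \<inter> C" "N v - C"] by (simp add: Int_Diff_Un Int_Diff_disjoint)
      moreover have "card (N v \<inter> C) = D - 1" using NC[OF v] v C(3) by simp
      ultimately show ?thesis using deg[of v] v C(1) D by auto
    qed
    \<comment> \<open>\<open>v\<close> is coloured last. Every other uncoloured vertex of
      \<open>C\<close> has \<open>v\<close> as a waiting neighbour, which makes up for degree
      \<open>D\<close>; the bound assumed for \<open>v\<close> says that it sees fewer than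
      \<open>D\<close> colours.\<close>
    have finish: "\<exists>\<phi>. proper_on adj D V \<phi>"
      if \<phi>: "proper_on adj D S \<phi>" "V - C \<subseteq> S" "S \<subseteq> V" and v: "v \<in> C - S" "card (\<phi> ` (N v \<inter> S)) + card (N v - S) < D" for S \<phi> v
    proof -
      let ?L = "C - S - {v}"
      have "\<exists>\<phi>'. proper_on adj D (S \<union> ?L) \<phi>' \<and> (\<forall>u\<in>S. \<phi>' u = \<phi> u)"
      proof (rule extend_layer[OF \<phi>(1,3)])
        fix u assume u: "u \<in> ?L"
        have vN: "v \<in> N u" using NC[of u] u v(1) by auto
        have "card (\<phi> ` (N u \<inter> S)) + card (N u \<inter> ?L) \<le> card (N u \<inter> S) + card (N u \<inter> ?L)"
          by (simp add: card_image_le)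
        also have "\<dots> = card ((N u \<inter> S) \<union> (N u \<inter> ?L))" by (rule card_Un_disjoint[symmetric]) auto
        also have "\<dots> \<le> card (N u - {v})" using v(1) by (intro card_mono) auto
        also have "\<dots> < card (N u)" using vN by (intro psubset_card_mono) auto
        also have "\<dots> \<le> D" using deg[of u] u C(1) by auto
        finally show "card (\<phi> ` (N u \<inter> S)) + card (N u \<inter> ?L) < D" .
      qed (use C(1) in auto)
      then obtain \<phi>' where \<phi>': "proper_on adj D (S \<union> ?L) \<phi>'" "\<forall>u\<in>S. \<phi>' u = \<phi> u" by blast
      have "\<exists>\<phi>''. proper_on adj D (S \<union> ?L \<union> {v}) \<phi>'' \<and> (\<forall>u\<in>S \<union> ?L. \<phi>'' u = \<phi>' u)"
      proof (rule extend_layer[OF \<phi>'(1)])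
        fix u assume "u \<in> {v}"
        then have u: "u = v" by simp
        have im: "\<phi>' ` (N v \<inter> S) = \<phi> ` (N v \<inter> S)" using \<phi>'(2) by (intro image_cong) auto
        have "\<phi>' ` (N v \<inter> (S \<union> ?L)) = \<phi> ` (N v \<inter> S) \<union> \<phi>' ` (N v \<inter> ?L)"
          unfolding Int_Un_distrib image_Un im ..
        then have "card (\<phi>' ` (N v \<inter> (S \<union> ?L))) \<le> card (\<phi> ` (N v \<inter> S)) + card (\<phi>' ` (N v \<inter> ?L))"
          by (simp add: card_Un_le)
        moreover have "card (\<phi>' ` (N v \<inter> ?L)) \<le> card (N v \<inter> ?L)" by (simp add: card_image_le)
        moreover have "card (N v \<inter> ?L) \<le> card (N v - S)" by (intro card_mono) auto
        ultimately have "card (\<phi>' ` (N v \<inter> (S \<union> ?L))) < D" using v(2) by linarith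
        moreover have "N v \<inter> {v} = {}" using irr by (auto simp: nb_def)
        ultimately show "card (\<phi>' ` (N u \<inter> (S \<union> ?L))) + card (N u \<inter> {v}) < D" using u by simp
      qed (use v \<phi>(3) C(1) in auto)
      moreover have "S \<union> ?L \<union> {v} = V" using \<phi>(2,3) v(1) C(1) by auto
      ultimately show ?thesis by metis
    qed
    show ?thesis
    proof (cases "\<exists>v\<in>C. N v - C = {}")
      case True
      then obtain v where v: "v \<in> C" "N v - C = {}" by blast
      obtain \<phi> where \<phi>: "proper_on adj D ?V \<phi>"
      proof -
        have "\<exists>\<phi>. proper_on adj D ?V \<phi>"
        proof (rule IH[OF VC sym irr])
          fix u assume "u \<in> ?V"
          then have "card (nb ?V adj u) \<le> card (N u)" by (intro card_mono finN) (auto simp: nb_def)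
          then show "card (nb ?V adj u) \<le> D" using deg[of u] \<open>u \<in> ?V\<close> by auto
        qed (use less.prems(5) in auto)
        then show thesis using that by blast
      qed
      have "N v = C - {v}" using NC[OF v(1)] v(2) by auto
      then have "N v \<inter> ?V = {}" "N v - ?V = C - {v}" using C(1) by auto
      then have "card (\<phi> ` (N v \<inter> ?V)) + card (N v - ?V) < D" using D v(1) C(3) by simp
      then show ?thesis using finish[OF \<phi>, of v] v(1) by auto
    next
      case False
      have one: "\<exists>w. N v - C = {w}" if "v \<in> C" for v
      proof -
        have "card (N v - C) = 1" using ext[OF that] False that by (auto simp: le_Suc_eq)
        then show ?thesis by (simp add: card_1_singleton_iff)
      qed
      then have "\<forall>v\<in>C. \<exists>w. N v - C = {w}" by (intro ballI)
      from bchoice[OF this] obtain w where "\<forall>v\<in>C. N v - C = {w v}" by (elim exE) (rule that)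
      then have w: "N v - C = {w v}" if "v \<in> C" for v using that by (rule bspec)
      have wV: "w v \<in> ?V" "v \<in> N (w v)" if "v \<in> C" for v
      proof -
        have "w v \<in> N v - C" using w[OF that] by blast
        then show "w v \<in> ?V" "v \<in> N (w v)" using that C(1) sym by (auto simp: nb_def)
      qed
      text \<open>If adding the edge between two outside neighbours creates no clique on \<open>D + 1\<close> vertices,
        the induction hypothesis colours them differently.\<close>
      have pair: "(\<exists>\<phi>. proper_on adj D V \<phi>) \<or> (\<exists>A\<subseteq>?V. card A = D - 1 \<and> A \<subseteq> N (w a) \<inter> N (w b) \<and> complete_on adj A \<and> \<not> adj (w a) (w b))"
        if a: "a \<in> C" and b: "b \<in> C" and ne: "w a \<noteq> w b" for a b
      proof (rule disjCI)
        assume no: "\<not> (\<exists>A\<subseteq>?V. card A = D - 1 \<and> A \<subseteq> N (w a) \<inter> N (w b) \<and> complete_on adj A \<and> \<not> adj (w a) (w b))"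
        have ab: "a \<noteq> b" using ne by auto
        define adj' where "adj' x y \<longleftrightarrow> adj x y \<or> x = w a \<and> y = w b \<or> x = w b \<and> y = w a" for x y
        have "\<exists>\<phi>. proper_on adj' D ?V \<phi>"
        proof (rule IH[OF VC])
          show "adj' y x" if "adj' x y" for x y using that sym by (auto simp: adj'_def)
          show "\<not> adj' x x" for x using irr ne by (auto simp: adj'_def)
          have le: "card (insert z (N x - {u})) \<le> D" if "u \<in> N x" "x \<in> V" for x z u
          proof -
            have "card (insert z (N x - {u})) \<le> Suc (card (N x - {u}))" by (rule card_insert_le_m1) auto
            also have "\<dots> = card (N x)" using that by (intro card_Suc_Diff1) auto
            finally show ?thesis using deg[OF that(2)] by simp
          qed
          show "card (nb ?V adj' x) \<le> D" if x: "x \<in> ?V" for x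
          proof -
            consider "x = w a" | "x = w b" | "x \<noteq> w a" "x \<noteq> w b" by blast
            then show ?thesis
            proof cases
              case 1
              then have "nb ?V adj' x \<subseteq> insert (w b) (N (w a) - {a})" using a by (auto simp: nb_def adj'_def)
              then have "card (nb ?V adj' x) \<le> card (insert (w b) (N (w a) - {a}))" by (intro card_mono) auto
              then show ?thesis using le[OF wV(2)[OF a], of "w b"] wV(1)[OF a] by auto
            next
              case 2
              then have "nb ?V adj' x \<subseteq> insert (w a) (N (w b) - {b})" using b by (auto simp: nb_def adj'_def)
              then have "card (nb ?V adj' x) \<le> card (insert (w a) (N (w b) - {b}))" by (intro card_mono) auto
              then show ?thesis using le[OF wV(2)[OF b], of "w a"] wV(1)[OF b] by auto
            next
              case 3
              then have "nb ?V adj' x \<subseteq> N x" by (auto simp: nb_def adj'_def)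
              then have "card (nb ?V adj' x) \<le> card (N x)" by (intro card_mono) auto
              then show ?thesis using deg[of x] x by auto
            qed
          qed
          show "card K \<noteq> D + 1" if K: "K \<subseteq> ?V" "complete_on adj' K" for K
          proof
            assume cK: "card K = D + 1"
            have wK: "w a \<in> K" "w b \<in> K" "\<not> adj (w a) (w b)"
            proof -
              have "w a \<in> K \<and> w b \<in> K \<and> \<not> adj (w a) (w b)"
              proof (rule ccontr)
                assume h: "\<not> ?thesis"
                have "complete_on adj K"
                  unfolding complete_on_def
                proof (intro ballI impI)
                  fix x y assume xy: "x \<in> K" "y \<in> K" "x \<noteq> y"
                  then have "adj' x y" using K(2) by (simp add: complete_on_def)
                  then show "adj x y" using h xy sym by (auto simp: adj'_def)
                qed
                then show False using less.prems(5)[of K] K(1) cK by auto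
              qed
              then show "w a \<in> K" "w b \<in> K" "\<not> adj (w a) (w b)" by auto
            qed
            let ?A = "K - {w a, w b}"
            have "complete_on adj ?A" using K(2) unfolding complete_on_def by (auto simp: adj'_def)
            moreover have "?A \<subseteq> N (w a) \<inter> N (w b)"
            proof
              fix x assume x: "x \<in> ?A"
              then have "adj' (w a) x" "adj' (w b) x" using K(2) wK unfolding complete_on_def by auto
              then show "x \<in> N (w a) \<inter> N (w b)" using x K(1) by (auto simp: adj'_def nb_def)
            qed
            moreover have "card ?A = D - 1"
              using card_Diff_subset[of "{w a, w b}" K] wK ne cK by simp
            moreover have "?A \<subseteq> ?V" using K(1) by auto
            ultimately have "\<exists>A\<subseteq>?V. card A = D - 1 \<and> A \<subseteq> N (w a) \<inter> N (w b) \<and> complete_on adj A \<and> \<not> adj (w a) (w b)"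
              using wK(3) by (intro exI[of _ ?A] conjI)
            then show False using no by contradiction
          qed
        qed
        then obtain \<phi> where \<phi>': "proper_on adj' D ?V \<phi>" by blast
        have \<phi>: "proper_on adj D ?V \<phi>" using \<phi>' by (auto simp: proper_on_def adj'_def)
        have dw: "\<phi> (w a) \<noteq> \<phi> (w b)" using \<phi>' wV(1)[OF a] wV(1)[OF b] by (auto simp: proper_on_def adj'_def)
        have wk: "\<phi> (w a) < D" using \<phi> wV(1)[OF a] by (auto simp: proper_on_def)
        have Nb: "N b \<inter> ?V = {w b}" using w[OF b] N_subset by auto
        \<comment> \<open>\<open>b\<close> repeats the colour of \<open>w a\<close>. Its only
          coloured neighbour \<open>w b\<close> has another colour because of the added edge, and
          \<open>a\<close> then sees one colour on both \<open>w a\<close> and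
          \<open>b\<close>.\<close>
        let ?\<psi> = "\<phi>(b := \<phi> (w a))"
        have col: "proper_on adj D (insert b ?V) ?\<psi>"
          by (rule proper_on_insert[OF \<phi>]) (use b wk dw Nb in auto)
        have "N a \<inter> insert b ?V = {w a, b}" using w[OF a] NC[OF a] b ab N_subset[of a] by auto
        then have c0: "?\<psi> ` (N a \<inter> insert b ?V) = ?\<psi> ` {w a, b}" by (rule arg_cong)
        have c2: "?\<psi> ` {w a, b} = {\<phi> (w a)}" using wV(1)[OF a] b by auto
        have c1: "card (?\<psi> ` (N a \<inter> insert b ?V)) = 1" unfolding c0 c2 by simp
        have "N a - insert b ?V = C - {a, b}" using w[OF a] NC[OF a] N_subset[of a] C(1) by auto
        then have "card (N a - insert b ?V) = D - 2"
          using card_Diff_subset[of "{a, b}" C] a b ab C(3) by simp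
        then have "card (?\<psi> ` (N a \<inter> insert b ?V)) + card (N a - insert b ?V) < D" using c1 D by linarith
        then show "\<exists>\<phi>. proper_on adj D V \<phi>"
          using finish[OF col, of a] a b ab C(1) by auto
      qed
      show ?thesis
      proof (rule ccontr)
        assume nocol: "\<not> ?thesis"
        obtain a where a: "a \<in> C" using \<open>C \<noteq> {}\<close> by blast
        have "\<exists>b\<in>C. w b \<noteq> w a"
        proof (rule ccontr)
          assume "\<not> ?thesis"
          then have eq: "w b = w a" if "b \<in> C" for b using that by blast
          have "adj (w a) b" if "b \<in> C" for b using wV(2)[OF that] eq[OF that] by (simp add: nb_def)
          then have "complete_on adj (insert (w a) C)"
            using C(2) sym unfolding complete_on_def by auto
          moreover have "card (insert (w a) C) = D + 1" using wV(1)[OF a] finC C(3) by simp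
          ultimately show False using less.prems(5)[of "insert (w a) C"] wV(1)[OF a] C(1) by auto
        qed
        then obtain b where b: "b \<in> C" "w a \<noteq> w b" by metis
        obtain A where A: "A \<subseteq> ?V" "card A = D - 1" "A \<subseteq> N (w a) \<inter> N (w b)" "complete_on adj A" "\<not> adj (w a) (w b)"
          using pair[OF a b] nocol by (elim disjE exE conjE) (blast, rule that)
        \<comment> \<open>With its \<open>D - 1\<close> vertices, \<open>A\<close> together with
          \<open>c\<close> exhausts the neighbours of \<open>w c\<close>. Hence a third vertex of
          \<open>C\<close> has a third outside neighbour, joined to the same \<open>A\<close>, and
          each vertex of \<open>A\<close> would have D - 2 + 3 neighbours.\<close>
        have NA: "N (w c) = insert c A" if c: "c \<in> C" "w c = w a \<or> w c = w b" for c
        proof -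
          have sub: "insert c A \<subseteq> N (w c)" using A(3) c wV(2)[OF c(1)] by auto
          have "card (insert c A) = D" using A(1,2) c(1) D fin_subset[of A] by (subst card_insert_disjoint) auto
          moreover have "w c \<in> V" using wV(1)[OF c(1)] by blast
          ultimately show ?thesis using card_seteq[OF finN sub] deg[of "w c"] by simp
        qed
        have "\<not> C \<subseteq> {a, b}" using card_mono[of "{a, b}" C] card_insert_le_m1[of 2 "{b}" a] C(3) D by auto
        then obtain c where c: "c \<in> C" "c \<noteq> a" "c \<noteq> b" by blast
        have cA: "c \<notin> A" "a \<notin> A" "b \<notin> A" using A(1) a b c by auto
        have wc: "w c \<noteq> w a" "w c \<noteq> w b"
          using wV(2)[OF c(1)] NA[OF a] NA[OF b(1)] c cA by auto
        obtain B where B: "B \<subseteq> ?V" "card B = D - 1" "B \<subseteq> N (w a) \<inter> N (w c)" "\<not> adj (w a) (w c)"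
          using pair[OF a c(1) wc(1)[symmetric]] nocol by (elim disjE exE conjE) (blast, rule that)
        have "B \<subseteq> A" using B(1,3) NA[OF a] a by auto
        then have BA: "B = A" using card_seteq[of A B] A(1,2) B(2) fin_subset[of A] by auto
        have "A \<noteq> {}" using A(2) D by auto
        then obtain z where z: "z \<in> A" by blast
        have zV: "z \<in> V" using z A(1) by auto
        have wA: "w a \<notin> A" "w b \<notin> A" "w c \<notin> A"
          using A(3) B(3) BA irr by (auto simp: nb_def)
        have za: "adj (w a) z" "adj (w b) z" "adj (w c) z" using z A(3) B(3) BA by (auto simp: nb_def)
        have "(A - {z}) \<union> {w a, w b, w c} \<subseteq> N z"
        proof -
          have "A - {z} \<subseteq> N z" using z A(1,4) by (auto simp: complete_on_def nb_def)
          moreover have "{w a, w b, w c} \<subseteq> N z"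
            using sym[OF za(1)] sym[OF za(2)] sym[OF za(3)] wV(1)[OF a] wV(1)[OF b(1)] wV(1)[OF c(1)]
            by (simp add: nb_def)
          ultimately show ?thesis by auto
        qed
        then have "card ((A - {z}) \<union> {w a, w b, w c}) \<le> D"
          using card_mono[OF finN[of z]] deg[OF zV] by (meson order_trans)
        moreover have "card ((A - {z}) \<union> {w a, w b, w c}) = card (A - {z}) + card {w a, w b, w c}"
          using wA A(1) fin_subset[of A] by (intro card_Un_disjoint) auto
        moreover have "card {w a, w b, w c} = 3" using b(2) wc by auto
        moreover have "card (A - {z}) = D - 2" using z A(2) by simp
        ultimately show False using D by simp
      qed
    qed
  qed
qed

section \<open>The bound by maximum degree and clique number\<close>

theorem theorem3:
  fixes V :: "'a set" and E :: "'a set set"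
  assumes "finite_simple_graph V E"
    and "real (max_degree V E) \<ge> 7.4 * 10 ^ 9"
  shows "chromatic_number V E \<le> max (max_degree V E - 1) (clique_number V E)"
proof -
  define D where "D = max_degree V E"
  define adj where "adj u v \<longleftrightarrow> {u, v} \<in> E" for u v
  have finV: "finite V" by (rule finite_simple_graph.finite_verts[OF assms(1)])
  have edge: "u \<in> V \<and> v \<in> V \<and> u \<noteq> v" if "{u, v} \<in> E" for u v
    using subsetD[OF finite_simple_graph.edges[OF assms(1)] that] by simp
  have sym: "adj u v \<Longrightarrow> adj v u" and irr: "\<not> adj u u" for u v
    using edge[of u u] by (auto simp: adj_def insert_commute)
  interpret finite_graph V adj by unfold_locales (use finV sym irr in auto)
  have "real 7400000000 \<le> real D" using assms(2) by (simp add: D_def)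
  then have D: "7400000000 \<le> D" by (simp only: of_nat_le_iff)
  have deg: "card (N v) \<le> D" if "v \<in> V" for v
  proof -
    have "N v = neighbourhood E v" using edge by (auto simp: nb_def adj_def neighbourhood_def)
    then show ?thesis
      unfolding D_def max_degree_def using that finV by (intro Max_ge) (auto simp: vertex_degree_def)
  qed
  have chrom: "chromatic_number V E \<le> k" if "\<exists>\<phi>. proper_on adj k V \<phi>" for k
  proof -
    from that obtain \<phi> where "proper_on adj k V \<phi>" by blast
    then have "proper_colouring V E k \<phi>"
      unfolding proper_colouring_def proper_on_def adj_def .
    then show ?thesis unfolding chromatic_number_def by (intro Least_le exI)
  qed
  have fin: "finite {card K | K. K \<subseteq> V \<and> clique K E}"
    by (rule finite_subset[of _ "card ` Pow V"]) (use finV in auto)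
  have complete: "card K \<le> clique_number V E" if "K \<subseteq> V" "complete_on adj K" for K
    unfolding clique_number_def using that fin
    by (intro Max_ge) (auto simp: clique_def complete_on_def adj_def)
  \<comment> \<open>Below \<open>D\<close> the term \<open>D - 1\<close> of the maximum has to
    suffice; in the other cases the clique number itself supplies enough colours.\<close>
  consider (small) "clique_number V E < D" | (tight) "clique_number V E = D" | (large) "D + 1 \<le> clique_number V E"
    by linarith
  then show ?thesis
  proof cases
    case small
    have "\<exists>\<phi>. proper_on adj (D - 1) V \<phi>"
    proof (rule colourable_max_degree_minus_one[OF finV sym irr D deg])
      show "card K \<noteq> D" if "K \<subseteq> V" "complete_on adj K" for K
        using complete[OF that] small by linarith
    qed
    from chrom[OF this] show ?thesis by (simp add: D_def)
  next
    case tight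
    have "\<exists>\<phi>. proper_on adj D V \<phi>"
    proof (rule colourable_max_degree[OF finV sym irr D deg])
      show "card K \<noteq> D + 1" if "K \<subseteq> V" "complete_on adj K" for K
        using complete[OF that] tight by linarith
    qed
    from chrom[OF this] show ?thesis using tight by simp
  next
    case large
    have "\<exists>\<phi>'. proper_on adj (D + 1) ({} \<union> V) \<phi>' \<and> (\<forall>v\<in>{}. \<phi>' v = (\<lambda>_. 0) v)"
    proof (rule extend_layer)
      fix u assume "u \<in> V"
      then show "card ((\<lambda>_. 0) ` (N u \<inter> {})) + card (N u \<inter> V) < D + 1"
        using deg[of u] N_subset[of u] by (simp add: Int_absorb2)
    qed (auto simp: proper_on_def)
    then have "chromatic_number V E \<le> D + 1" by (intro chrom) auto
    then show ?thesis using large by simp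
  qed
qed

end
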